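(* Let $D\subset\mathbb{R}^n$ be open, $I\subset\mathbb{R}$ an interval, and let $f:D\to\mathbb{R}^n$ and $g:I\times D\to\mathbb{R}^n$ be of class $C^r$, $r\ge 2$. Consider the perturbed system $\dot{\mathbf z}=f(\mathbf z)+g(t,\mathbf z)$. Suppose the unperturbed system $\dot{\mathbf z}=f(\mathbf z)$ has a non-trivial $T$-periodic hyperbolic limit cycle $\varphi(t)$, and let $d$ be the A-index of the first variational equation $\dot{\mathbf y}=Df(\varphi(t))\mathbf y$. Then there is a real matrix function $U:\mathbb{R}\to\mathbb{R}^{n\times(n-1)}$ of class $C^r$ satisfying \[ U(t+T)=U(t)\,\big[I_{n-d-1}\oplus(-I_d)\big]\quad\text{for all }t, \] such that, in a neighborhood of the cycle (i.e. for $(\mathbf v,\mathbf w)$ in a sufficiently small neighborhood of $0$), the change of variables $\mathbf z\mapsto(s,\mathbf v,\mathbf w)\in\mathbb{R}\times\mathbb{R}^{n-d-1}\times\mathbb{R}^{d}$ given by \[ \mathbf z=\varphi(s)+U(s)\begin{bmatrix}\mathbf v\\ \mathbf w\end{bmatrix} \] transforms the perturbed system into \[ \begin{aligned} \dot s&=1+\Lambda_0(s,\mathbf v,\mathbf w)+\tilde\Lambda_0(t,s,\mathbf v,\mathbf w),\\ \dot{\mathbf v}&=H_1\mathbf v+\Lambda_1(s,\mathbf v,\mathbf w)+\tilde\Lambda_1(t,s,\mathbf v,\mathbf w),\\ \dot{\mathbf w}&=H_2\mathbf w+\Lambda_2(s,\mathbf v,\mathbf w)+\tilde\Lambda_2(t,s,\mathbf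 v,\mathbf w), \end{aligned} \] where $H_1\in\mathbb{R}^{(n-d-1)\times(n-d-1)}$, $H_2\in\mathbb{R}^{d\times d}$, and: (i) if $\{\lambda_\ell\in\mathbb{C}:\ell=1,\dots,n-1\}$ are the eigenvalues (with multiplicity) of the derivative of the Poincaré map associated to $\varphi$, then the real parts of the eigenvalues (with multiplicity) of $H_1\oplus H_2$ are $\{\tfrac1T\log|\lambda_\ell|:\ell=1,\dots,n-1\}$; (ii) $\Lambda_\ell(s,0,0)=0$ and $\frac{\partial\Lambda_\ell}{\partial(\mathbf v,\mathbf w)}(s,0,0)=0$ for all $s\in\mathbb{R}$ and $\ell\in\{0,1,2\}$; (iii) for $\ell\in\{0,1\}$: $\Lambda_\ell(s+T,\mathbf v,\mathbf w)=\Lambda_\ell(s,\mathbf v,-\mathbf w)$ and $\tilde\Lambda_\ell(t,s+T,\mathbf v,\mathbf w)=\tilde\Lambda_\ell(t,s,\mathbf v,-\mathbf w)$; (iv) $\Lambda_2(s+T,\mathbf v,\mathbf w)=-\Lambda_2(s,\mathbf v,-\mathbf w)$ and $\tilde\Lambda_2(t,s+T,\mathbf v,\mathbf w)=-\tilde\Lambda_2(t,s,\mathbf v,-\mathbf w)$; (v) there is $C>0$ such that $\big\|\tilde\Lambda_\ell(t,s,\mathbf v,\mathbf w)\big\|<C\,\big\|g\big(t,\varphi(s)+U(s)[\mathbf v;\mathbf w]\big)\big\|$ for each $\ell\in\{0,1,2\}$ (on the domain of the new coordinates).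
   Context: Hyperbolic limit cycle: the characteristic multiplier $1$ (associated to $\varphi'(0)$) of the first variational equation along $\varphi$ is simple and all other characteristic multipliers (eigenvalues of the derivative of the Poincaré map) have modulus different from $1$. For a linear $T$-periodic system $\dot{\mathbf x}=A(t)\mathbf x$ with fundamental matrix $\Phi$, the monodromy matrix is $\Phi^{-1}(0)\Phi(T)$ (its Jordan form is independent of $\Phi$). The A-index of such a system is the sum, over each distinct Jordan block of the Jordan normal form of a monodromy matrix that is associated to a real negative eigenvalue and occurs an odd number of times, of the dimension of that block (each such distinct block counted only once). $I_m$ is the $m\times m$ identity, $\oplus$ the block-diagonal direct sum.
   Formalization: In (v) the strict inequality "<" is replaced by "≤", since the strict one fails wherever g vanishes (e.g. g = 0); where g ≠ 0 the strict bound follows by enlarging C. *)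

theory Defs
  imports "HOL-Analysis.Analysis" "Jordan_Normal_Form.Jordan_Normal_Form_Uniqueness"
begin

fun iter_dderiv :: "'a::real_normed_vector set \<Rightarrow> 'a list \<Rightarrow> ('a \<Rightarrow> 'b::real_normed_vector) \<Rightarrow> 'a \<Rightarrow> 'b" where
  "iter_dderiv S [] f = f"
| "iter_dderiv S (v # vs) f = (\<lambda>x. frechet_derivative (iter_dderiv S vs f) (at x within S) v)"

definition Cr_on :: "nat \<Rightarrow> 'a::real_normed_vector set \<Rightarrow> ('a \<Rightarrow> 'b::real_normed_vector) \<Rightarrow> bool" where
  "Cr_on r S f \<longleftrightarrow>
     (\<forall>vs. length vs < r \<longrightarrow> (\<forall>x\<in>S. iter_dderiv S vs f differentiable (at x within S))) \<and>
     (\<forall>vs. length vs \<le> r \<longrightarrow> continuous_on S (iter_dderiv S vs f))"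

definition fundamental_matrix :: "(real \<Rightarrow> real^'n^'n) \<Rightarrow> (real \<Rightarrow> real^'n^'n) \<Rightarrow> bool" where
  "fundamental_matrix A \<Phi> \<longleftrightarrow>
     (\<forall>t. (\<Phi> has_vector_derivative (A t ** \<Phi> t)) (at t) \<and> invertible (\<Phi> t))"

definition monodromy :: "(real \<Rightarrow> real^'n^'n) \<Rightarrow> real \<Rightarrow> real^'n^'n" where
  "monodromy A T = (let \<Phi> = (SOME \<Phi>. fundamental_matrix A \<Phi>) in matrix_inv (\<Phi> 0) ** \<Phi> T)"

text \<open>Conversion of a real (HOL-Analysis) matrix into a complex JNF matrix, using some
  enumeration of the index type (the Jordan structure / spectrum does not depend on it).\<close>
definition idx_enum :: "nat \<Rightarrow> 'n::finite" where
  "idx_enum = (SOME h. bij_betw h {..<CARD('n)} (UNIV :: 'n set))"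

definition to_cmat :: "real^'m^'n \<Rightarrow> complex Matrix.mat" where
  "to_cmat M = Matrix.mat CARD('n) CARD('m)
      (\<lambda>(i, j). complex_of_real (M $ idx_enum i $ idx_enum j))"

definition eigs_mult :: "real^'n^'n \<Rightarrow> complex multiset" where
  "eigs_mult M = proots (char_poly (to_cmat M))"

text \<open>A Jordan normal form (list of blocks (size, eigenvalue)) of a real square matrix
  (over the complex numbers); unique up to order of blocks.\<close>
definition jordan_blocks :: "real^'n^'n \<Rightarrow> (nat \<times> complex) list" where
  "jordan_blocks M = (SOME n_as. jordan_nf (to_cmat M) n_as)"

definition A_index_mat :: "real^'n^'n \<Rightarrow> nat" where
  "A_index_mat M = (let bs = jordan_blocks M in
     \<Sum>(k, a) \<in> {(k, a) \<in> set bs. Im a = 0 \<and> Re a < 0 \<and> odd (count (mset bs) (k, a))}. k)"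

definition A_index :: "(real \<Rightarrow> real^'n^'n) \<Rightarrow> real \<Rightarrow> nat" where
  "A_index A T = A_index_mat (monodromy A T)"

definition is_solution :: "(real^'n \<Rightarrow> real^'n) \<Rightarrow> (real^'n) set \<Rightarrow> (real \<Rightarrow> real^'n) \<Rightarrow> bool" where
  "is_solution f D \<psi> \<longleftrightarrow> (\<forall>t. \<psi> t \<in> D \<and> (\<psi> has_vector_derivative f (\<psi> t)) (at t))"

definition periodic_orbit :: "(real^'n \<Rightarrow> real^'n) \<Rightarrow> (real^'n) set \<Rightarrow> (real \<Rightarrow> real^'n) \<Rightarrow> real \<Rightarrow> bool" where
  "periodic_orbit f D \<phi> T \<longleftrightarrow> T > 0 \<and> is_solution f D \<phi> \<and> (\<forall>t. \<phi> (t + T) = \<phi> t) \<and>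
     (\<forall>\<tau>. 0 < \<tau> \<and> \<tau> < T \<longrightarrow> (\<exists>t. \<phi> (t + \<tau>) \<noteq> \<phi> t))"

definition limit_cycle :: "(real^'n \<Rightarrow> real^'n) \<Rightarrow> (real^'n) set \<Rightarrow> (real \<Rightarrow> real^'n) \<Rightarrow> real \<Rightarrow> bool" where
  "limit_cycle f D \<phi> T \<longleftrightarrow> periodic_orbit f D \<phi> T \<and>
     (\<exists>\<epsilon>>0. \<forall>\<psi> T'. T' > 0 \<and> is_solution f D \<psi> \<and> (\<forall>t. \<psi> (t + T') = \<psi> t) \<and>
        (\<forall>t. infdist (\<psi> t) (range \<phi>) < \<epsilon>) \<longrightarrow> range \<psi> = range \<phi>)"

definition variational_matrix :: "(real^'n \<Rightarrow> real^'n) \<Rightarrow> (real \<Rightarrow> real^'n) \<Rightarrow> real \<Rightarrow> real^'n^'n" where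
  "variational_matrix f \<phi> t = matrix (frechet_derivative f (at (\<phi> t)))"

definition char_multipliers :: "(real^'n \<Rightarrow> real^'n) \<Rightarrow> (real \<Rightarrow> real^'n) \<Rightarrow> real \<Rightarrow> complex multiset" where
  "char_multipliers f \<phi> T = eigs_mult (monodromy (variational_matrix f \<phi>) T)"

text \<open>Eigenvalues of the derivative of the Poincare map: the characteristic multipliers other
  than the trivial multiplier 1 associated with \<phi>'(0) (one copy of 1 removed).\<close>
definition poincare_multipliers :: "(real^'n \<Rightarrow> real^'n) \<Rightarrow> (real \<Rightarrow> real^'n) \<Rightarrow> real \<Rightarrow> complex multiset" where
  "poincare_multipliers f \<phi> T = char_multipliers f \<phi> T - {#1#}"

definition hyperbolic_limit_cycle :: "(real^'n \<Rightarrow> real^'n) \<Rightarrow> (real^'n) set \<Rightarrow> (real \<Rightarrow> real^'n) \<Rightarrow> real \<Rightarrow> bool" where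
  "hyperbolic_limit_cycle f D \<phi> T \<longleftrightarrow> limit_cycle f D \<phi> T \<and>
     count (char_multipliers f \<phi> T) 1 = 1 \<and>
     (\<forall>\<mu> \<in># poincare_multipliers f \<phi> T. cmod \<mu> \<noteq> 1)"

text \<open>The coordinates of R^(n-1) (index type 'm) are split into the v-block (indices not in W)
  and the w-block (indices in W).\<close>
definition flip_w :: "'m set \<Rightarrow> real^'m \<Rightarrow> real^'m" where
  "flip_w W y = (\<chi> i. if i \<in> W then - (y $ i) else y $ i)"

definition flip_mat :: "'m set \<Rightarrow> real^'m^'m" where
  "flip_mat W = (\<chi> i j. if i = j then (if i \<in> W then -1 else 1) else 0)"

definition proj_on :: "'m set \<Rightarrow> real^'m \<Rightarrow> real^'m" where
  "proj_on S y = (\<chi> i. if i \<in> S then y $ i else 0)"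

definition block_diag_wrt :: "'m set \<Rightarrow> real^'m^'m \<Rightarrow> bool" where
  "block_diag_wrt W H \<longleftrightarrow> (\<forall>i j. (i \<in> W) \<noteq> (j \<in> W) \<longrightarrow> H $ i $ j = 0)"

end

theory Submission
  imports Defs "Jordan_Normal_Form.Jordan_Normal_Form_Existence"
begin

text \<open>
  Let \<open>\<Phi>\<close> be a fundamental matrix of the variational equation \<open>y' = A(t) y\<close> and \<open>M\<close> its monodromy matrix.
  The Jordan blocks of \<open>M\<close> come in conjugate pairs, so up to the simple block of the multiplier 1 they
  split into blocks with positive eigenvalue, conjugate pairs (an even number of equal negative blocks is
  such a family of pairs), and one copy of each negative block of odd multiplicity, of total size the
  A-index \<open>d\<close>. The first two kinds are Jordan forms of \<open>exp (T H\<^sub>1)\<close>, the negatives of the last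
  kind of \<open>exp (T H\<^sub>2)\<close>, with \<open>H\<^sub>1\<close>, \<open>H\<^sub>2\<close> real. Hence \<open>M\<close> is similar, first over the complex and
  then over the real numbers, to \<open>1 \<oplus> exp (T H\<^sub>1) \<oplus> - exp (T H\<^sub>2)\<close>. If \<open>P\<close> consists of all but the
  first column of the conjugating matrix and \<open>H = H\<^sub>1 \<oplus> H\<^sub>2\<close>, then \<open>U(t) = \<Phi>(t) P exp (- t H)\<close> satisfies
  \<open>U(t + T) = U(t) (I \<oplus> - I)\<close> and \<open>U' = A U - U H\<close>. The last equation says that the vector field in the
  coordinates \<open>\<phi>(s) + U(s) y\<close> is \<open>(1, H y)\<close> up to terms of second order in \<open>y\<close>, and the
  bounds are uniform in \<open>s\<close> because all data are \<open>2T\<close>-periodic.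
\<close>

text \<open>A real matrix with a negative Jordan block of odd multiplicity has no real logarithm;
  this forces the factor \<open>- exp (T H\<^sub>2)\<close> and makes the frame \<open>U\<close>
  only \<open>2T\<close>-periodic. The sign matrix commutes with the block-diagonal
  \<open>H\<close>, hence with its exponential, so the flip can be moved to the right end of
  \<open>U (t + T)\<close>. Simplicity of the multiplier 1 gives transversality: 1 is not an
  eigenvalue of the complementary block, so the initial velocity, which \<open>M\<close> fixes after
  transport by \<open>\<Phi> 0\<close>, lies outside the column space of \<open>P\<close>. The
  deleted column of the conjugating matrix is never compared with the velocity. The matrix
  \<open>A\<close> has one derivative less than \<open>f\<close>, but \<open>U' = A U - U H\<close>
  returns that derivative to \<open>U\<close>. The remainders come from inverting the derivative of
  the coordinate map and pulling back \<open>f\<close> and \<open>g\<close> separately. One lower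
  bound \<open>c\<close> for this derivative, uniform along the cycle, bounds the inverse by
  \<open>1 / c\<close>; this yields both the vanishing linear part of the unperturbed remainders and
  the constant in the estimate of the perturbed ones.\<close>

no_notation Matrix.vec_index (infixl \<open>$\<close> 100)
hide_const (open) Matrix.mat

subsection \<open>Linear differential equations\<close>

text \<open>Picard iteration; a bound \<open>K\<close> uniform in time makes the series converge on
  the whole line. The right-hand side is an abstract family of linear maps so that both
  \<open>X \<mapsto> A X\<close> and \<open>X \<mapsto> - X A\<close> are covered.\<close>

lemma linear_ode_solution_exists:
  fixes l :: "real \<Rightarrow> 'a::euclidean_space \<Rightarrow> 'a" and x0 :: 'a
  assumes lin: "\<And>t. linear (l t)"
    and bd: "\<And>t x. norm (l t x) \<le> K * norm x"
    and cont: "\<And>x. continuous_on UNIV x \<Longrightarrow> continuous_on UNIV (\<lambda>t. l t (x t))"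
  shows "\<exists>x. x 0 = x0 \<and> (\<forall>t. (x has_vector_derivative l t (x t)) (at t))"
proof -
  have K: "K \<ge> 0"
  proof (rule ccontr)
    assume "\<not> K \<ge> 0"
    obtain b :: 'a where b: "b \<in> Basis" using nonempty_Basis by blast
    have "norm (l 0 b) \<le> K" using bd[of 0 b] b by simp
    thus False using \<open>\<not> K \<ge> 0\<close> norm_ge_zero[of "l 0 b"] by linarith
  qed
  have ex: "\<exists>z. z 0 = 0 \<and> (\<forall>t. (z has_vector_derivative l t (y t)) (at t))"
    if y: "continuous_on UNIV y" for y
  proof -
    have "\<exists>F. \<forall>x::real. -\<infinity> < ereal x \<longrightarrow> ereal x < \<infinity> \<longrightarrow> (F has_vector_derivative l x (y x)) (at x)"
      using cont[OF y] by (intro einterval_antiderivative) (auto simp: continuous_on_eq_continuous_at)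
    then obtain F where F: "\<And>t. (F has_vector_derivative l t (y t)) (at t)" by auto
    show ?thesis
      by (rule exI[of _ "\<lambda>t. F t - F 0"]) (auto intro!: derivative_eq_intros F)
  qed
  define S where "S y = (SOME z. z 0 = 0 \<and> (\<forall>t. (z has_vector_derivative l t (y t)) (at t)))" for y
  have S0: "S y 0 = 0" and S: "(S y has_vector_derivative l t (y t)) (at t)" if "continuous_on UNIV y" for y t
    using someI_ex[OF ex[OF that]] unfolding S_def by auto
  \<comment> \<open>\<open>P k\<close> is the \<open>k\<close>-fold iterated integral, a term of the
    Peano-Baker series; the partial sums are the Picard iterates.\<close>
  define P where "P = rec_nat (\<lambda>_. x0) (\<lambda>_. S)"
  have P0: "P 0 = (\<lambda>_. x0)" and PS: "\<And>k. P (Suc k) = S (P k)" by (simp_all add: P_def)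
  have Sc: "continuous_on UNIV (S y)" if "continuous_on UNIV y" for y
    using has_vector_derivative_continuous[OF S[OF that]] by (simp add: continuous_on_eq_continuous_at)
  have Pc: "continuous_on UNIV (P k)" for k
    by (induction k) (auto simp: P0 PS Sc)
  have PSd: "(P (Suc k) has_vector_derivative l t (P k t)) (at t)" for k t
    unfolding PS by (rule S[OF Pc])
  have PS0: "P (Suc k) 0 = 0" for k unfolding PS by (rule S0[OF Pc])
  have bnd: "norm (P k t) \<le> norm x0 * (K * \<bar>t\<bar>) ^ k / fact k" for k t
  proof (induction k arbitrary: t)
    case 0 show ?case by (simp add: P0)
  next
    case (Suc k)
    define \<psi> where "\<psi> = (\<lambda>t. norm x0 * (K * t) ^ Suc k / fact (Suc k))"
    have \<psi>d: "(\<psi> has_vector_derivative K * (norm x0 * (K * t) ^ k / fact k)) (at t)" for t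
    proof -
      have "(\<psi> has_real_derivative (norm x0 * (real (Suc k) * (K * t) ^ k * K) / fact (Suc k))) (at t)"
        unfolding \<psi>_def
        by (rule derivative_eq_intros refl)+ (simp_all add: mult.commute mult.left_commute del: power_Suc fact_Suc)
      moreover have "(norm x0 * (real (Suc k) * (K * t) ^ k * K) / fact (Suc k)) = K * (norm x0 * (K * t) ^ k / fact k)"
        by (simp add: divide_simps del: of_nat_Suc)
      ultimately show ?thesis unfolding has_real_derivative_iff_has_vector_derivative by metis
    qed
    have \<psi>c: "continuous_on X \<psi>" for X
      unfolding \<psi>_def by (intro continuous_intros) auto
    have dbd: "norm (l s (P k s)) \<le> K * (norm x0 * (K * \<bar>s\<bar>) ^ k / fact k)" for s
      using bd[of s "P k s"] mult_left_mono[OF Suc.IH[of s] K] by linarith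
    have \<psi>0: "\<psi> 0 = 0" by (simp add: \<psi>_def)
    consider "t = 0" | "t > 0" | "t < 0" by linarith
    then have "norm (P (Suc k) t) \<le> \<psi> \<bar>t\<bar>"
    proof cases
      case 1 thus ?thesis by (simp add: PS0 \<psi>0)
    next
      case 2
      have "norm (P (Suc k) t - P (Suc k) 0) \<le> \<psi> t - \<psi> 0"
      proof (rule differentiable_bound_general[OF 2 _ \<psi>c PSd \<psi>d])
        show "continuous_on {0..t} (P (Suc k))" using Pc continuous_on_subset by blast
        show "norm (l x (P k x)) \<le> K * (norm x0 * (K * x) ^ k / fact k)" if "0 < x" "x < t" for x
          using dbd[of x] that by simp
      qed
      thus ?thesis using 2 by (simp add: PS0 \<psi>0)
    next
      case 3
      have d: "((\<lambda>s. P (Suc k) (- s)) has_vector_derivative - l (- s) (P k (- s))) (at s)" for s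
      proof -
        have "(uminus has_vector_derivative (-1::real)) (at s)" by (auto intro!: derivative_eq_intros)
        from vector_diff_chain_at[OF this PSd[of k "- s"]] show ?thesis by (simp add: o_def)
      qed
      have "norm (P (Suc k) (- (- t)) - P (Suc k) (- 0)) \<le> \<psi> (- t) - \<psi> 0"
      proof (rule differentiable_bound_general[where f = "\<lambda>s. P (Suc k) (- s)", OF _ _ \<psi>c d \<psi>d])
        show "0 < - t" using 3 by simp
        show "continuous_on {0..- t} (\<lambda>s. P (Suc k) (- s))"
          by (rule continuous_on_compose2[OF Pc[of "Suc k"]]) (auto intro!: continuous_intros)
        show "norm (- l (- x) (P k (- x))) \<le> K * (norm x0 * (K * x) ^ k / fact k)" if "0 < x" "x < - t" for x
          using dbd[of "- x"] that by simp
      qed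
      thus ?thesis using 3 by (simp add: PS0 \<psi>0)
    qed
    thus ?case by (simp add: \<psi>_def)
  qed
  have sums: "\<exists>x. uniform_limit {-R..R} (\<lambda>n t. \<Sum>i<n. P i t) x sequentially" for R
  proof -
    have "uniformly_convergent_on {-R..R} (\<lambda>n t. \<Sum>i<n. P i t)"
    proof (rule Weierstrass_m_test')
      show "norm (P k t) \<le> norm x0 * (K * \<bar>R\<bar>) ^ k / fact k" if "t \<in> {-R..R}" for k t
        using that K by (intro order_trans[OF bnd[of k t]] divide_right_mono mult_left_mono power_mono) auto
      show "summable (\<lambda>k. norm x0 * (K * \<bar>R\<bar>) ^ k / fact k)"
        using summable_mult[OF summable_exp[of "K * \<bar>R\<bar>"], of "norm x0"] by (simp add: field_simps)
    qed
    thus ?thesis by (simp add: uniformly_convergent_on_def)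
  qed
  define x where "x t = (\<Sum>i. P i t)" for t
  have ul: "uniform_limit {-R..R} (\<lambda>n t. \<Sum>i<n. P i t) x sequentially" for R
  proof -
    obtain y where y: "uniform_limit {-R..R} (\<lambda>n t. \<Sum>i<n. P i t) y sequentially" using sums by blast
    have "y t = x t" if "t \<in> {-R..R}" for t
      using tendsto_uniform_limitI[OF y that] unfolding x_def sums_def[symmetric] by (rule sums_unique)
    then show ?thesis using y uniform_limit_cong'[of "{-R..R}" "\<lambda>n t. \<Sum>i<n. P i t" "\<lambda>n t. \<Sum>i<n. P i t" y x] by blast
  qed
  have sx: "(\<lambda>i. P i t) sums x t" for t
  proof -
    have "t \<in> {-\<bar>t\<bar>..\<bar>t\<bar>}" using abs_ge_self[of t] abs_ge_minus_self[of t] by simp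
    thus ?thesis using tendsto_uniform_limitI[OF ul] unfolding sums_def by blast
  qed
  \<comment> \<open>Differentiation shifts the index: the derivatives of the first
    \<open>Suc n\<close> terms add up to \<open>l t\<close> applied to the sum of the first
    \<open>n\<close> terms. Uniform convergence of the derivatives thus follows from that of the
    series itself.\<close>
  define f' where "f' n t = (case n of 0 \<Rightarrow> 0 | Suc k \<Rightarrow> l t (P k t))" for n t
  have f': "(P n has_vector_derivative f' n t) (at t)" for n t
    by (cases n) (auto simp: f'_def P0 PSd)
  have f'sum: "(\<Sum>i<Suc n. f' i t) = l t (\<Sum>i<n. P i t)" for n t
    using lin[of t] by (simp add: sum.lessThan_Suc_shift f'_def linear_sum o_def del: sum.lessThan_Suc)
  have der: "(x has_vector_derivative l t (x t)) (at t)" for t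
  proof -
    define R where "R = \<bar>t\<bar> + 1"
    have t: "t \<in> {-R<..<R}" by (auto simp: R_def)
    have "\<exists>g. \<forall>s\<in>{-R..R}. (\<lambda>n. P n s) sums g s \<and>
        (g has_derivative (\<lambda>h. h *\<^sub>R l s (x s))) (at s within {-R..R})"
    proof (rule has_derivative_series[where f' = "\<lambda>n s h. h *\<^sub>R f' n s" and x = t])
      show "(P n has_derivative (\<lambda>h. h *\<^sub>R f' n s)) (at s within {-R..R})" for n s
        using f'[of n s] unfolding has_vector_derivative_def by (rule has_derivative_at_withinI)
      show "convex {-R..R}" by simp
      show "t \<in> {-R..R}" using t by simp
      show "(\<lambda>n. P n t) sums x t" by (rule sx)
      fix e :: real assume e: "e > 0"
      \<comment> \<open>The summand 1 covers the case \<open>K = 0\<close>.\<close>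
      define e' where "e' = e / (K + 1)"
      have e': "e' > 0" "K * e' \<le> e" using e K by (auto simp: e'_def field_simps)
      have "\<forall>\<^sub>F n in sequentially. \<forall>s\<in>{-R..R}. norm ((\<Sum>i<n. P i s) - x s) < e'"
        using uniform_limitD[OF ul e'(1)] by (simp add: dist_norm)
      then have "\<forall>\<^sub>F n in sequentially. \<forall>s\<in>{-R..R}. \<forall>h. norm ((\<Sum>i<Suc n. h *\<^sub>R f' i s) - h *\<^sub>R l s (x s)) \<le> e * norm h"
      proof eventually_elim
        case (elim n)
        show ?case
        proof (intro ballI allI)
          fix s h assume s: "s \<in> {-R..R}"
          have "(\<Sum>i<Suc n. h *\<^sub>R f' i s) - h *\<^sub>R l s (x s) = h *\<^sub>R l s ((\<Sum>i<n. P i s) - x s)"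
            unfolding scaleR_sum_right[symmetric] f'sum using lin[of s] by (simp add: linear_diff scaleR_diff_right)
          also have "norm \<dots> \<le> \<bar>h\<bar> * (K * e')"
          proof -
            have "norm ((\<Sum>i<n. P i s) - x s) \<le> e'" using elim s by (simp add: less_imp_le)
            from order_trans[OF bd[of s] mult_left_mono[OF this K]] show ?thesis by (simp add: mult_left_mono)
          qed
          also have "\<dots> \<le> e * norm h" using mult_left_mono[OF e'(2), of "\<bar>h\<bar>"] by (simp add: mult.commute)
          finally show "norm ((\<Sum>i<Suc n. h *\<^sub>R f' i s) - h *\<^sub>R l s (x s)) \<le> e * norm h" .
        qed
      qed
      then show "\<forall>\<^sub>F n in sequentially. \<forall>s\<in>{-R..R}. \<forall>h. norm ((\<Sum>i<n. h *\<^sub>R f' i s) - h *\<^sub>R l s (x s)) \<le> e * norm h"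
        by (rule eventually_sequentially_Suc[THEN iffD1])
    qed
    then obtain g where "\<forall>s\<in>{-R..R}. (\<lambda>n. P n s) sums g s \<and>
        (g has_derivative (\<lambda>h. h *\<^sub>R l s (x s))) (at s within {-R..R})" ..
    then have g: "\<And>s. s \<in> {-R..R} \<Longrightarrow> (\<lambda>n. P n s) sums g s"
       "\<And>s. s \<in> {-R..R} \<Longrightarrow> (g has_derivative (\<lambda>h. h *\<^sub>R l s (x s))) (at s within {-R..R})" by (simp_all del: atLeastAtMost_iff)
    have gx: "g s = x s" if "s \<in> {-R..R}" for s using sums_unique2[OF g(1)[OF that] sx] .
    have "(g has_derivative (\<lambda>h. h *\<^sub>R l t (x t))) (at t)"
      using g(2)[of t] t at_within_interior[of t "{-R..R}"] by simp
    then have "(x has_derivative (\<lambda>h. h *\<^sub>R l t (x t))) (at t)"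
      by (rule has_derivative_transform_within_open[of _ _ _ _ "{-R<..<R}"]) (use t gx in auto)
    thus ?thesis by (simp add: has_vector_derivative_def)
  qed
  have "x 0 = x0"
  proof -
    have "P i 0 = (if i = 0 then x0 else 0)" for i by (cases i) (simp_all add: P0 PS0)
    hence "(\<lambda>i. P i 0) sums x0" using sums_single[of 0 "\<lambda>_. x0"] by simp
    thus ?thesis using sums_unique2[OF sx[of 0]] by blast
  qed
  with der show ?thesis by blast
qed

section \<open>Bilinearity of matrix products, fundamental matrices and uniqueness\<close>

lemma matrix_add_rdistrib: "(A + B) ** C = A ** C + B ** (C :: real^'c^'b)"
  by (vector matrix_matrix_mult_def sum.distrib[symmetric] field_simps)

lemma bounded_bilinear_matrix_matrix_mult:
  "bounded_bilinear ((**) :: real^'b^'a \<Rightarrow> real^'c^'b \<Rightarrow> real^'c^'a)"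
  unfolding bilinear_conv_bounded_bilinear[symmetric] bilinear_def
  by (intro conjI allI linearI matrix_add_ldistrib matrix_add_rdistrib
      matrix_scalar_ac[unfolded scalar_matrix_assoc[symmetric]] scalar_matrix_assoc[symmetric])

lemma bounded_bilinear_matrix_vector_mult:
  "bounded_bilinear ((*v) :: real^'b^'a \<Rightarrow> real^'b \<Rightarrow> real^'a)"
  unfolding bilinear_conv_bounded_bilinear[symmetric] bilinear_def
  by (intro conjI allI linearI matrix_vector_right_distrib matrix_vector_mult_add_rdistrib
      matrix_vector_mult_scaleR scaleR_matrix_vector_assoc[symmetric])

lemmas has_vector_derivative_matrix_mult =
  bounded_bilinear.has_vector_derivative[OF bounded_bilinear_matrix_matrix_mult]
lemmas has_vector_derivative_matrix_vector_mult =
  bounded_bilinear.has_vector_derivative[OF bounded_bilinear_matrix_vector_mult]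
lemmas matrix_mul_minus_left = bounded_bilinear.minus_left[OF bounded_bilinear_matrix_matrix_mult]
lemmas matrix_vector_minus_left = bounded_bilinear.minus_left[OF bounded_bilinear_matrix_vector_mult]

lemma constant_if_derivative_0:
  fixes x :: "real \<Rightarrow> 'a::real_normed_vector"
  assumes "\<And>t. (x has_vector_derivative 0) (at t)"
  shows "x t = x s"
proof -
  obtain c where "\<And>t. t \<in> UNIV \<Longrightarrow> x t = c"
    using has_vector_derivative_zero_constant[of UNIV x] assms by auto
  thus ?thesis by simp
qed

text \<open>The inverse \<open>\<Psi>\<close> is obtained as a solution of the adjoint equation, so
  its derivative is known without differentiating an inverse; the product
  \<open>\<Psi> t ** \<Phi> t\<close> has derivative 0. The pair is also the tool for
  uniqueness.\<close>

lemma fundamental_matrix_pair_exists: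
  fixes A :: "real \<Rightarrow> real^'n^'n"
  assumes A: "continuous_on UNIV A" and bdd: "bounded (range A)"
  shows "\<exists>(\<Phi> :: real \<Rightarrow> real^'n^'n) (\<Psi> :: real \<Rightarrow> real^'n^'n). \<Phi> 0 = mat 1 \<and> (\<forall>t. (\<Phi> has_vector_derivative A t ** \<Phi> t) (at t)) \<and>
    (\<forall>t. (\<Psi> has_vector_derivative - (\<Psi> t ** A t)) (at t)) \<and>
    (\<forall>t. \<Psi> t ** \<Phi> t = mat 1 \<and> \<Phi> t ** \<Psi> t = mat 1)"
proof -
  obtain B where B: "\<And>t. norm (A t) \<le> B" using bdd by (auto simp: bounded_iff)
  interpret mm: bounded_bilinear "(**) :: real^'n^'n \<Rightarrow> real^'n^'n \<Rightarrow> real^'n^'n"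
    by (rule bounded_bilinear_matrix_matrix_mult)
  obtain K where K: "K \<ge> 0" "\<And>(X :: real^'n^'n) (Y :: real^'n^'n). norm (X ** Y) \<le> norm X * norm Y * K"
    using mm.nonneg_bounded by blast
  have "\<exists>\<Phi>. \<Phi> 0 = mat 1 \<and> (\<forall>t. (\<Phi> has_vector_derivative A t ** \<Phi> t) (at t))"
  proof (rule linear_ode_solution_exists[where K = "B * K"])
    show "linear ((**) (A t) :: real^'n^'n \<Rightarrow> _)" for t by (rule bounded_linear.linear[OF mm.bounded_linear_right])
    show "norm (A t ** x) \<le> B * K * norm x" for t and x :: "real^'n^'n"
      using K(2)[of "A t" x] mult_right_mono[OF B[of t], of "K * norm x"] K(1) by (simp add: mult_ac)
    show "continuous_on UNIV (\<lambda>t. A t ** x t)" if "continuous_on UNIV x" for x :: "real \<Rightarrow> real^'n^'n"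
      by (rule mm.continuous_on[OF A that])
  qed
  then obtain \<Phi> where \<Phi>: "\<Phi> 0 = mat 1" "\<And>t. (\<Phi> has_vector_derivative A t ** \<Phi> t) (at t)" by blast
  have "\<exists>\<Psi>. \<Psi> 0 = mat 1 \<and> (\<forall>t. (\<Psi> has_vector_derivative - (\<Psi> t ** A t)) (at t))"
  proof (rule linear_ode_solution_exists[where K = "B * K"])
    show "linear (\<lambda>X :: real^'n^'n. - (X ** A t))" for t
      using bounded_linear.linear[OF mm.bounded_linear_left] linear_compose_neg by blast
    show "norm (- (x ** A t)) \<le> B * K * norm x" for t and x :: "real^'n^'n"
      using K(2)[of x "A t"] mult_right_mono[OF B[of t], of "K * norm x"] K(1) by (simp add: mult_ac)
    show "continuous_on UNIV (\<lambda>t. - (x t ** A t))" if "continuous_on UNIV x" for x :: "real \<Rightarrow> real^'n^'n"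
      by (intro continuous_on_minus mm.continuous_on[OF that A])
  qed
  then obtain \<Psi> where \<Psi>: "\<Psi> 0 = mat 1" "\<And>t. (\<Psi> has_vector_derivative - (\<Psi> t ** A t)) (at t)" by blast
  have "((\<lambda>t. \<Psi> t ** \<Phi> t) has_vector_derivative 0) (at t)" for t
    using has_vector_derivative_matrix_mult[OF \<Psi>(2) \<Phi>(2), of t]
    by (simp add: mm.minus_left matrix_mul_assoc)
  then have inv: "\<Psi> t ** \<Phi> t = mat 1" for t
    using constant_if_derivative_0[of "\<lambda>t. \<Psi> t ** \<Phi> t" t 0] \<Phi>(1) \<Psi>(1) by simp
  then have "\<Phi> t ** \<Psi> t = mat 1" for t
    using matrix_left_right_inverse by blast
  then show ?thesis using \<Phi> \<Psi> inv by blast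
qed

lemma fundamental_matrix_exists:
  fixes A :: "real \<Rightarrow> real^'n^'n"
  assumes A: "continuous_on UNIV A" and bdd: "bounded (range A)"
  shows "\<exists>\<Phi>. fundamental_matrix A \<Phi>"
  using fundamental_matrix_pair_exists[OF A bdd] unfolding fundamental_matrix_def invertible_def by blast

text \<open>Multiplication by the adjoint solution \<open>\<Psi>\<close> turns every solution into a
  constant, which is fixed by its value at \<open>t0\<close>.\<close>

lemma linear_ode_unique_matrix:
  fixes A :: "real \<Rightarrow> real^'n^'n" and X Y :: "real \<Rightarrow> real^'k^'n"
  assumes A: "continuous_on UNIV A" and bdd: "bounded (range A)"
    and X: "\<And>t. (X has_vector_derivative A t ** X t) (at t)"
    and Y: "\<And>t. (Y has_vector_derivative A t ** Y t) (at t)"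
    and eq: "X t0 = Y t0"
  shows "X t = Y t"
proof -
  obtain \<Phi> \<Psi> :: "real \<Rightarrow> real^'n^'n" where \<Psi>: "\<And>t. (\<Psi> has_vector_derivative - (\<Psi> t ** A t)) (at t)"
    "\<And>t. \<Phi> t ** \<Psi> t = mat 1"
    using fundamental_matrix_pair_exists[OF A bdd] by blast
  have d: "((\<lambda>t. \<Psi> t ** X t) has_vector_derivative 0) (at t)"
    if "\<And>t. (X has_vector_derivative A t ** X t) (at t)" for t and X :: "real \<Rightarrow> real^'k^'n"
    using has_vector_derivative_matrix_mult[OF \<Psi>(1) that, of t]
    by (simp add: matrix_mul_minus_left matrix_mul_assoc)
  have "\<Psi> t ** X t = \<Psi> t ** Y t"
    using constant_if_derivative_0[OF d[OF X], of t t0] constant_if_derivative_0[OF d[OF Y], of t t0] eq by simp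
  hence "(\<Phi> t ** \<Psi> t) ** X t = (\<Phi> t ** \<Psi> t) ** Y t" by (simp add: matrix_mul_assoc[symmetric])
  thus ?thesis by (simp add: \<Psi>(2))
qed

lemma linear_ode_unique_vector:
  fixes A :: "real \<Rightarrow> real^'n^'n" and x y :: "real \<Rightarrow> real^'n"
  assumes A: "continuous_on UNIV A" and bdd: "bounded (range A)"
    and X: "\<And>t. (x has_vector_derivative A t *v x t) (at t)"
    and Y: "\<And>t. (y has_vector_derivative A t *v y t) (at t)"
    and eq: "x t0 = y t0"
  shows "x t = y t"
proof -
  obtain \<Phi> \<Psi> :: "real \<Rightarrow> real^'n^'n" where \<Psi>: "\<And>t. (\<Psi> has_vector_derivative - (\<Psi> t ** A t)) (at t)"
    "\<And>t. \<Phi> t ** \<Psi> t = mat 1"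
    using fundamental_matrix_pair_exists[OF A bdd] by blast
  have d: "((\<lambda>t. \<Psi> t *v x t) has_vector_derivative 0) (at t)"
    if "\<And>t. (x has_vector_derivative A t *v x t) (at t)" for t and x :: "real \<Rightarrow> real^'n"
    using has_vector_derivative_matrix_vector_mult[OF \<Psi>(1) that, of t]
    by (simp add: matrix_vector_minus_left matrix_vector_mul_assoc)
  have "\<Psi> t *v x t = \<Psi> t *v y t"
    using constant_if_derivative_0[OF d[OF X], of t t0] constant_if_derivative_0[OF d[OF Y], of t t0] eq by simp
  hence "(\<Phi> t ** \<Psi> t) *v x t = (\<Phi> t ** \<Psi> t) *v y t" by (simp add: matrix_vector_mul_assoc[symmetric])
  thus ?thesis by (simp add: \<Psi>(2))
qed

subsection \<open>Curves of class C^k\<close>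

text \<open>For functions of one real variable this replaces \<open>Cr_on\<close>: the derivative is
  again a curve, so sum, product and chain rules are plain inductions on the order.
  \<open>Cr_on_UNIV_if_Ck_curve\<close> translates back.\<close>

fun Ck_curve :: "nat \<Rightarrow> (real \<Rightarrow> 'a::real_normed_vector) \<Rightarrow> bool" where
  "Ck_curve 0 F \<longleftrightarrow> continuous_on UNIV F"
| "Ck_curve (Suc k) F \<longleftrightarrow> (\<exists>F'. (\<forall>t. (F has_vector_derivative F' t) (at t)) \<and> Ck_curve k F')"

lemma continuous_on_UNIV_if_has_vector_derivative:
  assumes "\<And>t. (F has_vector_derivative F' t) (at t)"
  shows "continuous_on UNIV F"
  using has_vector_derivative_continuous[OF assms] by (simp add: continuous_on_eq_continuous_at)

lemma Ck_curve_SucD: "Ck_curve (Suc k) F \<Longrightarrow> Ck_curve k F"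
proof (induction k arbitrary: F)
  case 0
  then obtain F' where "\<And>t. (F has_vector_derivative F' t) (at t)" by auto
  hence "continuous_on UNIV F" by (rule continuous_on_UNIV_if_has_vector_derivative)
  thus ?case by simp
next
  case (Suc k)
  then obtain F' where F': "\<And>t. (F has_vector_derivative F' t) (at t)" "Ck_curve (Suc k) F'"
    by (auto simp only: Ck_curve.simps(2)[of "Suc k"])
  thus ?case using Suc.IH[OF F'(2)] by auto
qed

lemma Ck_curve_mono: "Ck_curve k F \<Longrightarrow> j \<le> k \<Longrightarrow> Ck_curve j F"
proof (induction k)
  case (Suc k) thus ?case using Ck_curve_SucD le_SucE by blast
qed simp

lemma Ck_curve_continuous: "Ck_curve k F \<Longrightarrow> continuous_on UNIV F"
  using Ck_curve_mono[of k F 0] by simp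

lemma Ck_curve_const: "Ck_curve k (\<lambda>_. c)"
  by (induction k arbitrary: c) (auto intro!: exI[of _ "\<lambda>_. 0"])

lemma Ck_curve_linear:
  assumes h: "bounded_linear h"
  shows "Ck_curve k F \<Longrightarrow> Ck_curve k (\<lambda>t. h (F t))"
proof (induction k arbitrary: F)
  case 0 thus ?case using bounded_linear.continuous_on[OF h] by auto
next
  case (Suc k)
  then obtain F' where "\<And>t. (F has_vector_derivative F' t) (at t)" "Ck_curve k F'" by auto
  with Suc.IH[of F'] bounded_linear.has_vector_derivative[OF h] show ?case
    by (auto intro!: exI[of _ "\<lambda>t. h (F' t)"])
qed

lemma Ck_curve_add:
  "Ck_curve k F \<Longrightarrow> Ck_curve k G \<Longrightarrow> Ck_curve k (\<lambda>t. F t + G t)"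
proof (induction k arbitrary: F G)
  case 0 thus ?case by (auto intro: continuous_intros)
next
  case (Suc k)
  then obtain F' G' where "\<And>t. (F has_vector_derivative F' t) (at t)" "Ck_curve k F'"
    "\<And>t. (G has_vector_derivative G' t) (at t)" "Ck_curve k G'" by auto
  with Suc.IH[of F' G'] show ?case by (auto intro!: exI[of _ "\<lambda>t. F' t + G' t"] has_vector_derivative_add)
qed

lemma Ck_curve_minus: "Ck_curve k F \<Longrightarrow> Ck_curve k (\<lambda>t. - F t)"
  by (rule Ck_curve_linear[OF bounded_linear_minus[OF bounded_linear_ident]])

lemma Ck_curve_sum:
  "(\<And>i. i \<in> S \<Longrightarrow> Ck_curve k (F i)) \<Longrightarrow> Ck_curve k (\<lambda>t. \<Sum>i\<in>S. F i t)"
  by (induction S rule: infinite_finite_induct) (auto intro: Ck_curve_add Ck_curve_const)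

lemma Ck_curve_bilinear:
  assumes h: "bounded_bilinear h"
  shows "Ck_curve k F \<Longrightarrow> Ck_curve k G \<Longrightarrow> Ck_curve k (\<lambda>t. h (F t) (G t))"
proof (induction k arbitrary: F G)
  case 0 thus ?case using bounded_bilinear.continuous_on[OF h] by auto
next
  case (Suc k)
  then obtain F' G' where "\<And>t. (F has_vector_derivative F' t) (at t)" "Ck_curve k F'"
    "\<And>t. (G has_vector_derivative G' t) (at t)" "Ck_curve k G'" by auto
  moreover have "Ck_curve k F" "Ck_curve k G" using Suc.prems Ck_curve_SucD by blast+
  ultimately show ?case
    using Suc.IH[of F G'] Suc.IH[of F' G] bounded_bilinear.has_vector_derivative[OF h, of F _ _ UNIV G]
    by (auto intro!: exI[of _ "\<lambda>t. h (F t) (G' t) + h (F' t) (G t)"] Ck_curve_add)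
qed

lemma iter_dderiv_append:
  "iter_dderiv S (us @ vs) f = iter_dderiv S us (iter_dderiv S vs f)"
  by (induction us) auto

text \<open>In \<open>iter_dderiv\<close> the derivative taken first stands last in the list, so
  iterating after a derivative along \<open>v\<close> means appending \<open>v\<close> at the
  end.\<close>

lemma Cr_on_dderiv:
  assumes "Cr_on (Suc k) S f"
  shows "Cr_on k S (\<lambda>x. frechet_derivative f (at x within S) v)"
proof -
  have "(\<lambda>x. frechet_derivative f (at x within S) v) = iter_dderiv S [v] f" by simp
  hence "iter_dderiv S vs (\<lambda>x. frechet_derivative f (at x within S) v) = iter_dderiv S (vs @ [v]) f" for vs
    by (simp add: iter_dderiv_append)
  moreover have "length (vs @ [v]) = Suc (length vs)" for vs by simp
  ultimately show ?thesis using assms unfolding Cr_on_def by simp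
qed

lemma Cr_on_Suc_differentiable: "Cr_on (Suc k) S f \<Longrightarrow> x \<in> S \<Longrightarrow> f differentiable (at x within S)"
  unfolding Cr_on_def by (drule conjunct1, drule spec[of _ "[]"]) simp

lemma Cr_on_mono: "Cr_on k S f \<Longrightarrow> j \<le> k \<Longrightarrow> Cr_on j S f"
  unfolding Cr_on_def by simp

text \<open>The chain rule is expanded over \<open>Basis\<close>, because \<open>Cr_on\<close>
  controls derivatives in fixed directions only, whereas \<open>\<gamma>' t\<close> varies with
  \<open>t\<close>. Each directional derivative is one order less regular and falls under the
  induction hypothesis.\<close>

lemma Ck_curve_compose:
  fixes f :: "'a::euclidean_space \<Rightarrow> 'b::real_normed_vector"
  assumes D: "open D" and \<gamma>D: "\<And>t. \<gamma> t \<in> D"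
  shows "Cr_on k D f \<Longrightarrow> Ck_curve k \<gamma> \<Longrightarrow> Ck_curve k (\<lambda>t. f (\<gamma> t))"
proof (induction k arbitrary: f)
  case 0
  hence "continuous_on D f" unfolding Cr_on_def by (drule_tac conjunct2, drule_tac x = "[]" in spec) simp
  with 0 \<gamma>D show ?case by (auto intro: continuous_on_compose2)
next
  case (Suc k)
  from Suc.prems obtain \<gamma>' where \<gamma>': "\<And>t. (\<gamma> has_vector_derivative \<gamma>' t) (at t)" "Ck_curve k \<gamma>'" by auto
  define df where "df b x = frechet_derivative f (at x within D) b" for b x
  have df: "Ck_curve k (\<lambda>t. df b (\<gamma> t))" for b
    unfolding df_def by (rule Suc.IH[OF Cr_on_dderiv[OF Suc.prems(1)] Ck_curve_SucD[OF Suc.prems(2)]])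
  have "((\<lambda>t. f (\<gamma> t)) has_vector_derivative (\<Sum>b\<in>Basis. (\<gamma>' t \<bullet> b) *\<^sub>R df b (\<gamma> t))) (at t)" for t
  proof -
    have fd: "(f has_derivative frechet_derivative f (at (\<gamma> t) within D)) (at (\<gamma> t))"
      using Cr_on_Suc_differentiable[OF Suc.prems(1) \<gamma>D[of t]] frechet_derivative_works at_within_open[OF \<gamma>D D] by metis
    have "((\<lambda>t. f (\<gamma> t)) has_vector_derivative frechet_derivative f (at (\<gamma> t) within D) (\<gamma>' t)) (at t)"
      using vector_derivative_diff_chain_within[OF \<gamma>'(1)[of t] has_derivative_at_withinI[OF fd]] by (simp add: o_def)
    moreover have "frechet_derivative f (at (\<gamma> t) within D) (\<gamma>' t) = (\<Sum>b\<in>Basis. (\<gamma>' t \<bullet> b) *\<^sub>R df b (\<gamma> t))"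
    proof -
      have lin: "linear (frechet_derivative f (at (\<gamma> t) within D))" using fd has_derivative_linear by blast
      show ?thesis unfolding df_def
        by (subst euclidean_representation[of "\<gamma>' t", symmetric])
           (simp only: linear_sum[OF lin] linear_cmul[OF lin])
    qed
    ultimately show ?thesis by simp
  qed
  moreover have "Ck_curve k (\<lambda>t. \<Sum>b\<in>Basis. (\<gamma>' t \<bullet> b) *\<^sub>R df b (\<gamma> t))"
    by (intro Ck_curve_sum Ck_curve_bilinear[OF bounded_bilinear_scaleR] df
        Ck_curve_linear[OF bounded_linear_inner_left] \<gamma>'(2))
  ultimately show ?case
    by (auto intro!: exI[of _ "\<lambda>t. \<Sum>b\<in>Basis. (\<gamma>' t \<bullet> b) *\<^sub>R df b (\<gamma> t)"])
qed

text \<open>On the real line a derivative in direction \<open>v\<close> is \<open>v\<close> times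
  the ordinary derivative, so each list entry costs exactly one order.\<close>

lemma Cr_on_UNIV_if_Ck_curve:
  assumes "Ck_curve r F"
  shows "Cr_on r UNIV F"
proof -
  have *: "Ck_curve (r - length vs) (iter_dderiv UNIV vs F)" if "length vs \<le> r" for vs
    using that
  proof (induction vs)
    case Nil thus ?case using assms by simp
  next
    case (Cons v vs)
    have "Ck_curve (Suc (r - length (v # vs))) (iter_dderiv UNIV vs F)"
    proof -
      have "Suc (r - length (v # vs)) = r - length vs" using Cons.prems by (simp add: Suc_diff_Suc)
      moreover have "Ck_curve (r - length vs) (iter_dderiv UNIV vs F)" using Cons.prems by (intro Cons.IH) simp
      ultimately show ?thesis by (simp only:)
    qed
    then obtain G' where G': "\<And>t. (iter_dderiv UNIV vs F has_vector_derivative G' t) (at t)"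
       "Ck_curve (r - length (v # vs)) G'" by auto
    have "iter_dderiv UNIV (v # vs) F = (\<lambda>t. v *\<^sub>R G' t)"
    proof
      fix t
      have "(\<lambda>h. h *\<^sub>R G' t) = frechet_derivative (iter_dderiv UNIV vs F) (at t)"
        using G'(1)[of t] unfolding has_vector_derivative_def by (rule frechet_derivative_at)
      from fun_cong[OF this, of v] show "iter_dderiv UNIV (v # vs) F t = v *\<^sub>R G' t" by simp
    qed
    thus ?case using Ck_curve_linear[OF bounded_linear_scaleR_right G'(2), of v] by (simp only:)
  qed
  show ?thesis unfolding Cr_on_def
  proof (intro conjI allI impI ballI)
    fix vs :: "real list" and x :: real assume "length vs < r"
    then obtain j where "r - length vs = Suc j" by (cases "r - length vs") auto
    then have "Ck_curve (Suc j) (iter_dderiv UNIV vs F)" using *[of vs] \<open>length vs < r\<close> by simp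
    then obtain G' where "(iter_dderiv UNIV vs F has_vector_derivative G' x) (at x)" by auto
    then show "iter_dderiv UNIV vs F differentiable at x" by (rule differentiableI_vector)
  next
    fix vs :: "real list" assume "length vs \<le> r"
    then show "continuous_on UNIV (iter_dderiv UNIV vs F)" using * Ck_curve_continuous by blast
  qed
qed

subsection \<open>Direct sums and uniqueness of Jordan normal forms\<close>

definition oplus_mat :: "'a::zero Matrix.mat \<Rightarrow> 'a Matrix.mat \<Rightarrow> 'a Matrix.mat" where
  "oplus_mat A B = four_block_mat A (0\<^sub>m (dim_row A) (dim_col B)) (0\<^sub>m (dim_row B) (dim_col A)) B"

lemma oplus_mat_carrier: "A \<in> carrier_mat n n \<Longrightarrow> B \<in> carrier_mat m m \<Longrightarrow> oplus_mat A B \<in> carrier_mat (n + m) (n + m)"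
  unfolding oplus_mat_def by auto

lemma oplus_mat_index:
  assumes "A \<in> carrier_mat n n" "B \<in> carrier_mat m m" "i < n + m" "j < n + m"
  shows "oplus_mat A B $$ (i, j) = (if i < n then if j < n then A $$ (i, j) else 0
     else if j < n then 0 else B $$ (i - n, j - n))"
  using assms unfolding oplus_mat_def by auto

lemma oplus_mat_mult:
  assumes "A \<in> carrier_mat n n" "B \<in> carrier_mat m m" "A' \<in> carrier_mat n n" "B' \<in> carrier_mat m m"
  shows "oplus_mat A B * oplus_mat A' B' = oplus_mat (A * A') (B * B')"
  using assms unfolding oplus_mat_def by (subst mult_four_block_mat[of _ n n _ m _ m _ _ n _ m]) auto

lemma oplus_mat_one: "oplus_mat (1\<^sub>m n) (1\<^sub>m m) = 1\<^sub>m (n + m)"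
  unfolding oplus_mat_def by (intro eq_matI) auto

lemma map_mat_oplus_mat:
  assumes "h 0 = 0"
  shows "map_mat h (oplus_mat A B) = oplus_mat (map_mat h A) (map_mat h B)"
  using assms unfolding oplus_mat_def by (intro eq_matI) auto

lemma jordan_matrix_append: "jordan_matrix (xs @ ys) = oplus_mat (jordan_matrix xs) (jordan_matrix ys)"
  unfolding jordan_matrix_def oplus_mat_def by (simp add: diag_block_mat_append Let_def)

lemma similar_mat_oplus_mat:
  assumes "similar_mat A A'" "similar_mat B B'"
  shows "similar_mat (oplus_mat A B) (oplus_mat A' B')"
proof -
  obtain n m where c: "A \<in> carrier_mat n n" "A' \<in> carrier_mat n n" "B \<in> carrier_mat m m" "B' \<in> carrier_mat m m"
    using similar_matD[OF assms(1)] similar_matD[OF assms(2)] by auto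
  show ?thesis using similar_mat_four_block_0_0[OF assms c(1) c(3)] c unfolding oplus_mat_def by auto
qed

lemma jordan_nf_oplus_mat:
  assumes "jordan_nf A xs" "jordan_nf B ys"
  shows "jordan_nf (oplus_mat A B) (xs @ ys)"
  using assms similar_mat_oplus_mat unfolding jordan_nf_def jordan_matrix_append by (auto simp: image_Un)

lemma similar_mat_oplus_mat_swap:
  fixes A B :: "'a::comm_ring_1 Matrix.mat"
  assumes A: "A \<in> carrier_mat n n" and B: "B \<in> carrier_mat m m"
  shows "similar_mat (oplus_mat A B) (oplus_mat B A)"
proof -
  let ?P = "four_block_mat (0\<^sub>m n m) (1\<^sub>m n) (1\<^sub>m m) (0\<^sub>m m n) :: 'a Matrix.mat"
  let ?Q = "four_block_mat (0\<^sub>m m n) (1\<^sub>m m) (1\<^sub>m n) (0\<^sub>m n m) :: 'a Matrix.mat"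
  have PQ: "?P * ?Q = 1\<^sub>m (n + m)"
    by (subst mult_four_block_mat[of _ n m _ n _ m _ _ n _ m]) auto
  have QP: "?Q * ?P = 1\<^sub>m (m + n)"
    by (subst mult_four_block_mat[of _ m n _ m _ n _ _ m _ n]) auto
  have dBA: "oplus_mat B A = four_block_mat B (0\<^sub>m m n) (0\<^sub>m n m) A" using A B unfolding oplus_mat_def by auto
  have 1: "?P * oplus_mat B A = four_block_mat (0\<^sub>m n m) A B (0\<^sub>m m n)"
    unfolding dBA by (subst mult_four_block_mat[of _ n m _ n _ m _ _ m _ n]) (use A B in auto)
  have 2: "?P * oplus_mat B A * ?Q = oplus_mat A B"
    unfolding 1 by (subst mult_four_block_mat[of _ n m _ n _ m _ _ n _ m]) (use A B in \<open>auto simp: oplus_mat_def\<close>)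
  show ?thesis
    by (rule similar_matI[of _ _ ?P ?Q "n + m"]) (use A B PQ QP 2 in \<open>auto simp: add.commute oplus_mat_def\<close>)
qed

text \<open>The leading block is moved to its place in the other list by one swap of adjacent
  summands. Afterwards Jordan forms can be handled as multisets.\<close>

lemma similar_jordan_matrix_mset:
  fixes xs ys :: "(nat \<times> 'a::comm_ring_1) list"
  assumes "mset xs = mset ys"
  shows "similar_mat (jordan_matrix xs) (jordan_matrix ys)"
  using assms
proof (induction xs arbitrary: ys)
  case Nil thus ?case by (auto intro: similar_mat_refl[OF jordan_matrix_carrier])
next
  note [trans] = similar_mat_trans
  case (Cons x xs)
  have "x \<in> set ys" using mset_eq_setD[OF Cons.prems] by auto
  then obtain us vs where ys: "ys = us @ x # vs" by (meson split_list)
  have "mset xs = mset (us @ vs)" using Cons.prems ys by simp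
  then have 1: "similar_mat (jordan_matrix xs) (jordan_matrix (us @ vs))" by (rule Cons.IH)
  have refl: "similar_mat (jordan_matrix zs) (jordan_matrix zs)" for zs :: "(nat \<times> 'a) list"
    by (rule similar_mat_refl[OF jordan_matrix_carrier])
  have "similar_mat (jordan_matrix (x # xs)) (jordan_matrix ([x] @ us @ vs))"
    using similar_mat_oplus_mat[OF refl[of "[x]"] 1] jordan_matrix_append[of "[x]" xs] jordan_matrix_append[of "[x]" "us @ vs"]
    by (simp only: append.simps)
  also have "jordan_matrix ([x] @ us @ vs) = oplus_mat (jordan_matrix ([x] @ us)) (jordan_matrix vs)"
    by (simp only: append_assoc[symmetric] jordan_matrix_append[of "[x] @ us"])
  also have "similar_mat \<dots> (oplus_mat (jordan_matrix (us @ [x])) (jordan_matrix vs))"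
    unfolding jordan_matrix_append[of "[x]"] jordan_matrix_append[of us]
    by (rule similar_mat_oplus_mat[OF similar_mat_oplus_mat_swap[OF jordan_matrix_carrier jordan_matrix_carrier] refl])
  also have "\<dots> = jordan_matrix ys"
    unfolding ys jordan_matrix_append[symmetric] by simp
  finally show ?case by simp
qed

lemma jordan_nf_mset:
  fixes A :: "'a::comm_ring_1 Matrix.mat"
  assumes "jordan_nf A xs" "mset xs = mset ys"
  shows "jordan_nf A ys"
  using assms(1) similar_mat_trans[OF _ similar_jordan_matrix_mset[OF assms(2)]] mset_eq_setD[OF assms(2)]
  unfolding jordan_nf_def by simp

text \<open>The number of blocks of given positive size and eigenvalue is computed from
  \<open>A\<close> alone; blocks of size 0 are excluded by \<open>jordan_nf\<close>. Hence the
  arbitrary choice in \<open>jordan_blocks\<close> does no harm.\<close>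

lemma jordan_nf_mset_unique:
  fixes A :: "'a::field Matrix.mat"
  assumes "jordan_nf A xs" "jordan_nf A ys"
  shows "mset xs = mset ys"
proof (rule multiset_eqI)
  fix x :: "nat \<times> 'a"
  obtain k a where x: "x = (k, a)" by force
  have len: "length (filter ((=) x) zs) = count (mset zs) x" for zs
    by (induction zs) auto
  show "count (mset xs) x = count (mset ys) x"
  proof (cases "k = 0")
    case True
    with assms x have "x \<notin> set xs" "x \<notin> set ys" unfolding jordan_nf_def by force+
    thus ?thesis by (simp add: count_mset_0_iff[THEN iffD2])
  next
    case False
    from compute_nr_of_jordan_blocks[OF assms(1) False, of a] compute_nr_of_jordan_blocks[OF assms(2) False, of a]
    show ?thesis unfolding x[symmetric] len by simp
  qed
qed

text \<open>Needed for two embeddings: \<open>complex_of_real\<close>, to complexify real forms, and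
  \<open>cnj\<close>, to conjugate complex ones.\<close>

lemma jordan_nf_map_hom:
  assumes "inj_comm_ring_hom h" "jordan_nf A xs"
  shows "jordan_nf (map_mat h A) (map (\<lambda>(k, a). (k, h a)) xs)"
proof -
  interpret inj_comm_ring_hom h by fact
  obtain n P Q where c: "{A, jordan_matrix xs, P, Q} \<subseteq> carrier_mat n n" and e: "P * Q = 1\<^sub>m n" "Q * P = 1\<^sub>m n" "A = P * jordan_matrix xs * Q"
    using similar_matD assms(2) unfolding jordan_nf_def by blast
  have J: "map_mat h (jordan_matrix ys) = jordan_matrix (map (\<lambda>(k, a). (k, h a)) ys)" for ys
  proof (induction ys)
    case Nil thus ?case by (auto simp: jordan_matrix_def)
  next
    case (Cons y ys)
    obtain k a where y: "y = (k, a)" by force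
    have b: "map_mat h (jordan_matrix [y]) = jordan_matrix [(k, h a)]"
      unfolding y jordan_matrix_def by (intro eq_matI) auto
    have "map_mat h (jordan_matrix ([y] @ ys)) = jordan_matrix ([(k, h a)] @ map (\<lambda>(k, a). (k, h a)) ys)"
      unfolding jordan_matrix_append map_mat_oplus_mat[where h = h, OF hom_zero] b Cons ..
    thus ?case by (simp add: y)
  qed
  have "similar_mat (map_mat h A) (map_mat h (jordan_matrix xs))"
  proof (rule similar_matI[of _ _ "map_mat h P" "map_mat h Q" n])
    show "{map_mat h A, map_mat h (jordan_matrix xs), map_mat h P, map_mat h Q} \<subseteq> carrier_mat n n" using c by auto
    have c': "P \<in> carrier_mat n n" "Q \<in> carrier_mat n n" "jordan_matrix xs \<in> carrier_mat n n" using c by auto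
    show "map_mat h P * map_mat h Q = 1\<^sub>m n" "map_mat h Q * map_mat h P = 1\<^sub>m n"
      using mat_hom_mult[OF c'(1,2)] mat_hom_mult[OF c'(2,1)] e mat_hom_one by metis+
    show "map_mat h A = map_mat h P * map_mat h (jordan_matrix xs) * map_mat h Q"
      unfolding e(3) mat_hom_mult[OF mult_carrier_mat[OF c'(1,3)] c'(2)] mat_hom_mult[OF c'(1,3)] ..
  qed
  moreover have "fst ` set (map (\<lambda>(k, a). (k, h a)) xs) = fst ` set xs" by (auto simp: image_image case_prod_beta)
  ultimately show ?thesis using assms(2) unfolding jordan_nf_def J by simp
qed

subsection \<open>Real matrices whose exponential has prescribed Jordan blocks\<close>

lemma det_nonzero_inverse:
  fixes A :: "'a::field Matrix.mat"
  assumes A: "A \<in> carrier_mat n n" and d: "Determinant.det A \<noteq> 0"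
  obtains B where "B \<in> carrier_mat n n" "A * B = 1\<^sub>m n" "B * A = 1\<^sub>m n"
  using det_non_zero_imp_unit[OF A d, of "()"] unfolding Units_def ring_mat_def by auto

text \<open>The last unit vector generates a Jordan chain.\<close>
lemma jordan_nf_one_block:
  fixes A :: "'a::field Matrix.mat"
  assumes A: "A \<in> carrier_mat k k" and k: "k \<noteq> 0"
    and lower: "\<And>i j. i < k \<Longrightarrow> j < i \<Longrightarrow> A $$ (i, j) = 0"
    and diag: "\<And>i. i < k \<Longrightarrow> A $$ (i, i) = a"
    and super: "\<And>i. Suc i < k \<Longrightarrow> A $$ (i, Suc i) \<noteq> 0"
  shows "jordan_nf A [(k, a)]"
proof -
  \<comment> \<open>\<open>N\<close> is the strictly upper triangular part of \<open>A\<close>, and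
    \<open>v j\<close> is its \<open>j\<close>-th power applied to the last unit vector.\<close>
  define N where "N i l = (if i = l then 0 else A $$ (i, l))" for i l
  define v where "v = rec_nat (\<lambda>i. if i = k - 1 then 1 else 0) (\<lambda>_ w i. \<Sum>l<k. N i l * w l)"
  have v0: "v 0 i = (if i = k - 1 then 1 else 0)" for i by (simp add: v_def)
  have vS: "v (Suc j) i = (\<Sum>l<k. N i l * v j l)" for i j by (simp add: v_def)
  have Nlow: "N i l = 0" if "i < k" "l \<le> i" for i l using that lower[of i l] by (auto simp: N_def)
  have vz: "v j i = 0" if "i < k" "i + j \<ge> k" for i j using that
  proof (induction j arbitrary: i)
    case 0 thus ?case by simp
  next
    case (Suc j)
    have "N i l * v j l = 0" if "l < k" for l
    proof (cases "l \<le> i")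
      case True thus ?thesis using Nlow Suc.prems by simp
    next
      case False
      have "v j l = 0" using Suc.IH[of l] Suc.prems False that by simp
      thus ?thesis by simp
    qed
    thus ?case unfolding vS by (intro sum.neutral) auto
  qed
  \<comment> \<open>This entry is a product of \<open>j\<close> superdiagonal entries of
    \<open>A\<close>: for \<open>l\<close> beyond the diagonal only \<open>l = k - 1 - j\<close>
    meets a nonzero entry of \<open>v j\<close>.\<close>
  have vnz: "v j (k - 1 - j) \<noteq> 0" if "j < k" for j using that
  proof (induction j)
    case 0 thus ?case by (simp add: v0)
  next
    case (Suc j)
    let ?i = "k - 1 - Suc j" let ?l = "k - 1 - j"
    have l: "?l = Suc ?i" "?l < k" using Suc.prems by auto
    have "v (Suc j) ?i = (\<Sum>l\<in>{?l}. N ?i l * v j l)" unfolding vS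
    proof (rule sum.mono_neutral_right)
      show "\<forall>i\<in>{..<k} - {k - 1 - j}. N (k - 1 - Suc j) i * v j i = 0"
      proof
        fix m assume m: "m \<in> {..<k} - {?l}"
        show "N ?i m * v j m = 0"
        proof (cases "m \<le> ?i")
          case True thus ?thesis using Nlow[of ?i m] Suc.prems by simp
        next
          case False
          hence "v j m = 0" using m l by (intro vz) auto
          thus ?thesis by simp
        qed
      qed
    qed (use l in auto)
    also have "\<dots> \<noteq> 0" using Suc super[of ?i] l by (auto simp: N_def)
    finally show ?case .
  qed
  \<comment> \<open>The chain is listed in reverse: this makes \<open>P\<close> upper triangular
    with nonzero diagonal and matches a Jordan block with ones above the diagonal.\<close>
  define P where "P = Matrix.mat k k (\<lambda>(i, j). v (k - 1 - j) i)"
  have P: "P \<in> carrier_mat k k" by (simp add: P_def)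
  have "upper_triangular P" unfolding P_def upper_triangular_def by (auto intro!: vz)
  hence "Determinant.det P = prod_list (diag_mat P)" using det_upper_triangular P by blast
  also have "\<dots> \<noteq> 0"
  proof -
    have "v (k - Suc i) i \<noteq> 0" if "i < k" for i
      using vnz[of "k - Suc i"] that by (simp add: diff_diff_cancel Suc_diff_Suc)
    thus ?thesis by (auto simp: prod_list_zero_iff diag_mat_def P_def)
  qed
  finally obtain Q where Q: "Q \<in> carrier_mat k k" "P * Q = 1\<^sub>m k" "Q * P = 1\<^sub>m k"
    using det_nonzero_inverse[OF P] by blast
  let ?J = "jordan_block k a"
  have AP: "A * P = P * ?J"
  proof (rule eq_matI)
    fix i j assume "i < dim_row (P * ?J)" "j < dim_col (P * ?J)"
    hence i: "i < k" and j: "j < k" using P by auto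
    have "(A * P) $$ (i, j) = (\<Sum>l<k. A $$ (i, l) * v (k - 1 - j) l)"
      using i j A unfolding P_def by (simp add: scalar_prod_def atLeast0LessThan)
    also have "\<dots> = (\<Sum>l<k. (if i = l then a * v (k - 1 - j) l else 0) + N i l * v (k - 1 - j) l)"
      by (rule sum.cong) (auto simp: N_def diag i)
    also have "\<dots> = a * v (k - 1 - j) i + v (Suc (k - 1 - j)) i"
      unfolding vS sum.distrib using i by simp
    finally have 1: "(A * P) $$ (i, j) = a * v (k - 1 - j) i + v (k - j) i" using j by (simp add: Suc_diff_Suc)
    have "(P * ?J) $$ (i, j) = (\<Sum>l<k. v (k - 1 - l) i * (if l = j then a else if Suc l = j then 1 else 0))"
      using i j unfolding P_def by (simp add: scalar_prod_def atLeast0LessThan)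
    also have "\<dots> = (\<Sum>l<k. (if l = j then v (k - 1 - l) i * a else 0) + (if Suc l = j then v (k - 1 - l) i else 0))"
      by (rule sum.cong) auto
    also have "\<dots> = v (k - 1 - j) i * a + (\<Sum>l<k. if Suc l = j then v (k - 1 - l) i else 0)"
      unfolding sum.distrib using j by simp
    also have "(\<Sum>l<k. if Suc l = j then v (k - 1 - l) i else 0) = v (k - j) i"
    proof (cases j)
      case 0 thus ?thesis using vz[of i k] i by simp
    next
      case (Suc j')
      have "(\<Sum>l<k. if Suc l = j then v (k - 1 - l) i else 0) = (\<Sum>l<k. if l = j' then v (k - 1 - l) i else 0)"
        by (rule sum.cong) (auto simp: Suc)
      thus ?thesis using j Suc by simp
    qed
    finally show "(A * P) $$ (i, j) = (P * ?J) $$ (i, j)" using 1 by (simp add: mult.commute)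
  qed (use A P in auto)
  have "A = A * (P * Q)" using A Q by simp
  also have "\<dots> = P * ?J * Q" using A P Q AP by (metis assoc_mult_mat)
  finally have "similar_mat A ?J" by (intro similar_matI[of _ _ P Q k]) (use A P Q in auto)
  moreover have "jordan_matrix [(k, a)] = ?J" unfolding jordan_matrix_def by (intro eq_matI) auto
  ultimately show ?thesis using k unfolding jordan_nf_def by simp
qed

text \<open>The flow \<open>exp (t H)\<close>, characterised by its differential equation.
  Derivatives are taken entrywise because the matrices of all sizes together form no vector
  space.\<close>

definition mat_flow :: "nat \<Rightarrow> 'a::real_normed_field Matrix.mat \<Rightarrow> (real \<Rightarrow> 'a Matrix.mat) \<Rightarrow> bool" where
  "mat_flow n H E \<longleftrightarrow> H \<in> carrier_mat n n \<and> (\<forall>t. E t \<in> carrier_mat n n) \<and> E 0 = 1\<^sub>m n \<and>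
     (\<forall>i<n. \<forall>j<n. \<forall>t. ((\<lambda>t. E t $$ (i, j)) has_vector_derivative (H * E t) $$ (i, j)) (at t))"

text \<open>Closed form of the exponential of \<open>t\<close> times a Jordan block:
  \<open>exp (t \<mu>)\<close> times the finite exponential series of the nilpotent part.\<close>

definition jordan_block_exp :: "nat \<Rightarrow> 'a::{real_normed_field,banach} \<Rightarrow> real \<Rightarrow> 'a Matrix.mat" where
  "jordan_block_exp k \<mu> t = Matrix.mat k k (\<lambda>(i, j).
     if i \<le> j then exp (of_real t * \<mu>) * (of_real t ^ (j - i) / fact (j - i)) else 0)"

text \<open>Row \<open>i\<close> of a Jordan block combines rows \<open>i\<close> and
  \<open>Suc i\<close>. The product rule for \<open>exp (t \<mu>) * t ^ m / fact m\<close> gives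
  just these two entries, one from each factor.\<close>

lemma mat_flow_jordan_block_exp:
  "mat_flow k (jordan_block k \<mu>) (jordan_block_exp k \<mu>)"
proof -
  have "((\<lambda>t. jordan_block_exp k \<mu> t $$ (i, j)) has_vector_derivative
      (jordan_block k \<mu> * jordan_block_exp k \<mu> t) $$ (i, j)) (at t)" if i: "i < k" and j: "j < k" for i j t
  proof -
    let ?F = "\<lambda>i. jordan_block_exp k \<mu> t $$ (i, j)"
    have "(jordan_block k \<mu> * jordan_block_exp k \<mu> t) $$ (i, j) =
       (\<Sum>l<k. (if i = l then \<mu> else if Suc i = l then 1 else 0) * ?F l)"
      using i j by (simp add: scalar_prod_def atLeast0LessThan jordan_block_exp_def)
    also have "\<dots> = (\<Sum>l<k. (if l = i then \<mu> * ?F l else 0) + (if l = Suc i then ?F l else 0))"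
      by (rule sum.cong) auto
    also have "\<dots> = \<mu> * ?F i + (if Suc i < k then ?F (Suc i) else 0)"
      unfolding sum.distrib using i by simp
    finally have eq: "(jordan_block k \<mu> * jordan_block_exp k \<mu> t) $$ (i, j) =
      \<mu> * ?F i + (if Suc i < k then ?F (Suc i) else 0)" .
    show ?thesis
    proof (cases "i \<le> j")
      case False
      thus ?thesis using i j unfolding eq by (auto simp: jordan_block_exp_def)
    next
      case True
      have E: "((\<lambda>t. exp (of_real t * \<mu>)) has_vector_derivative \<mu> * exp (of_real t * \<mu>)) (at t)"
      proof -
        have "((\<lambda>t. exp (t *\<^sub>R \<mu>)) has_vector_derivative \<mu> * exp (t *\<^sub>R \<mu>)) (at t)"
          using exp_scaleR_has_vector_derivative_left by blast
        thus ?thesis by (simp add: scaleR_conv_of_real)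
      qed
      have Pd: "((\<lambda>t. (of_real t :: 'a) ^ Suc m / fact (Suc m)) has_vector_derivative of_real t ^ m / fact m) (at t)" for m
      proof -
        have "((\<lambda>t. t ^ Suc m / fact (Suc m)) has_real_derivative t ^ m / fact m) (at t)"
        proof -
          have "((\<lambda>t. t ^ Suc m / fact (Suc m)) has_real_derivative (real (Suc m) * t ^ m) / fact (Suc m)) (at t)"
            by (rule DERIV_cdivide) (use DERIV_pow[of "Suc m" t] in simp)
          moreover have "(real (Suc m) * t ^ m) / fact (Suc m) = t ^ m / fact m"
            unfolding fact_Suc by (rule mult_divide_mult_cancel_left) simp
          ultimately show ?thesis by (simp only:)
        qed
        from has_vector_derivative_of_real[OF this, where ?'a = 'a]
        show ?thesis by (simp del: power_Suc fact_Suc)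
      qed
      show ?thesis
      proof (cases "j = i")
        case True
        thus ?thesis using E i unfolding eq by (simp add: jordan_block_exp_def)
      next
        case False
        with True obtain m where m: "j - i = Suc m" by (metis Suc_diff_Suc le_neq_implies_less)
        have "((\<lambda>t. exp (of_real t * \<mu>) * ((of_real t :: 'a) ^ Suc m / fact (Suc m))) has_vector_derivative
          exp (of_real t * \<mu>) * (of_real t ^ m / fact m) + \<mu> * exp (of_real t * \<mu>) * (of_real t ^ Suc m / fact (Suc m))) (at t)"
          by (rule has_vector_derivative_mult[OF E Pd])
        moreover have "j - Suc i = m" "Suc i \<le> j" "Suc i < k" using m j by auto
        ultimately show ?thesis using i j True unfolding eq
          by (simp add: jordan_block_exp_def m add.commute mult.assoc del: power_Suc fact_Suc)
      qed
    qed
  qed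
  moreover have "jordan_block_exp k \<mu> 0 = 1\<^sub>m k"
    by (intro eq_matI) (auto simp: jordan_block_exp_def)
  ultimately show ?thesis unfolding mat_flow_def by (auto simp: jordan_block_exp_def)
qed

text \<open>The usual embedding of complex matrices into real matrices of twice the size,
  \<open>a + \<i> b\<close> becoming the rotation-scaling block. It makes a real flow out of a
  complex logarithm.\<close>

definition realify :: "complex Matrix.mat \<Rightarrow> real Matrix.mat" where
  "realify C = four_block_mat (map_mat Re C) (map_mat (\<lambda>z. - Im z) C) (map_mat Im C) (map_mat Re C)"

lemma realify_carrier: "C \<in> carrier_mat n n \<Longrightarrow> realify C \<in> carrier_mat (n + n) (n + n)"
  unfolding realify_def by auto

lemma realify_one: "realify (1\<^sub>m n) = 1\<^sub>m (n + n)"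
  unfolding realify_def by (intro eq_matI) auto

lemma realify_mult:
  assumes C: "C \<in> carrier_mat n n" and D: "D \<in> carrier_mat n n"
  shows "realify C * realify D = realify (C * D)"
proof -
  have re: "map_mat Re C * map_mat Re D + map_mat (\<lambda>z. - Im z) C * map_mat Im D = map_mat Re (C * D)"
    using C D by (intro eq_matI) (auto simp: scalar_prod_def sum_subtractf sum_negf)
  have im: "map_mat Im C * map_mat Re D + map_mat Re C * map_mat Im D = map_mat Im (C * D)"
    using C D by (intro eq_matI) (auto simp: scalar_prod_def sum.distrib add.commute)
  have im': "map_mat Re C * map_mat (\<lambda>z. - Im z) D + map_mat (\<lambda>z. - Im z) C * map_mat Re D = map_mat (\<lambda>z. - Im z) (C * D)"
    using C D by (intro eq_matI) (auto simp: scalar_prod_def sum.distrib sum_negf)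
  have re': "map_mat Im C * map_mat (\<lambda>z. - Im z) D + map_mat Re C * map_mat Re D = map_mat Re (C * D)"
    using C D by (intro eq_matI) (auto simp: scalar_prod_def sum_subtractf sum_negf)
  show ?thesis unfolding realify_def
    by (subst mult_four_block_mat[of _ n n _ n _ n _ _ n _ n]) (use C D re im re' im' in auto)
qed

lemma mat_flow_realify:
  assumes "mat_flow n H E"
  shows "mat_flow (n + n) (realify H) (\<lambda>t. realify (E t))"
  unfolding mat_flow_def
proof (intro conjI allI impI)
  have H: "H \<in> carrier_mat n n" and E: "E t \<in> carrier_mat n n" and E0: "E 0 = 1\<^sub>m n"
    and d: "i < n \<Longrightarrow> j < n \<Longrightarrow> ((\<lambda>t. E t $$ (i, j)) has_vector_derivative (H * E t) $$ (i, j)) (at t)" for t i j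
    using assms unfolding mat_flow_def by auto
  show "realify H \<in> carrier_mat (n + n) (n + n)" "realify (E t) \<in> carrier_mat (n + n) (n + n)"  for t
    using H E realify_carrier by auto
  show "realify (E 0) = 1\<^sub>m (n + n)" by (simp add: E0 realify_one)
  fix i j t assume i: "i < n + n" and j: "j < n + n"
  have e: "realify C $$ (i, j) = (if i < n then if j < n then Re (C $$ (i, j)) else - Im (C $$ (i, j - n))
      else if j < n then Im (C $$ (i - n, j)) else Re (C $$ (i - n, j - n)))" if "C \<in> carrier_mat n n" for C
    using that i j unfolding realify_def by auto
  have HE: "H * E t \<in> carrier_mat n n" using H E by auto
  have re: "((\<lambda>t. Re (E t $$ (p, q))) has_vector_derivative Re ((H * E t) $$ (p, q))) (at t)"
    and im: "((\<lambda>t. Im (E t $$ (p, q))) has_vector_derivative Im ((H * E t) $$ (p, q))) (at t)" if "p < n" "q < n" for p q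
    using bounded_linear.has_vector_derivative[OF bounded_linear_Re d[OF that]] bounded_linear.has_vector_derivative[OF bounded_linear_Im d[OF that]] by auto
  have im': "((\<lambda>t. - Im (E t $$ (p, q))) has_vector_derivative - Im ((H * E t) $$ (p, q))) (at t)" if "p < n" "q < n" for p q
    using has_vector_derivative_minus[OF im[OF that]] .
  show "((\<lambda>t. realify (E t) $$ (i, j)) has_vector_derivative (realify H * realify (E t)) $$ (i, j)) (at t)"
    unfolding realify_mult[OF H E] e[OF HE] e[OF E] using i j by (auto intro: re im im')
qed

text \<open>The first half of the columns of \<open>S\<close> spans the eigenspace for
  \<open>\<i>\<close> of the realified multiplication by \<open>\<i>\<close>, where the realified
  matrix acts as \<open>C\<close>; the second half spans that for \<open>- \<i>\<close>, where it
  acts as the conjugate of \<open>C\<close>.\<close>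

lemma similar_realify:
  assumes C: "C \<in> carrier_mat n n"
  shows "similar_mat (map_mat complex_of_real (realify C)) (oplus_mat C (map_mat cnj C))"
proof -
  let ?I = "1\<^sub>m n :: complex Matrix.mat"
  define R where "R = four_block_mat (map_mat (\<lambda>z. complex_of_real (Re z)) C) (map_mat (\<lambda>z. - complex_of_real (Im z)) C)
     (map_mat (\<lambda>z. complex_of_real (Im z)) C) (map_mat (\<lambda>z. complex_of_real (Re z)) C)"
  have R: "map_mat complex_of_real (realify C) = R"
    unfolding realify_def R_def using C by (intro eq_matI) auto
  define S where "S = four_block_mat ?I ?I ((- \<i>) \<cdot>\<^sub>m ?I) (\<i> \<cdot>\<^sub>m ?I)"
  define Q where "Q = four_block_mat ((1/2) \<cdot>\<^sub>m ?I) ((\<i>/2) \<cdot>\<^sub>m ?I) ((1/2) \<cdot>\<^sub>m ?I) ((- \<i>/2) \<cdot>\<^sub>m ?I)"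
  have c: "S \<in> carrier_mat (n + n) (n + n)" "Q \<in> carrier_mat (n + n) (n + n)" "R \<in> carrier_mat (n + n) (n + n)"
    "oplus_mat C (map_mat cnj C) \<in> carrier_mat (n + n) (n + n)"
    using C by (auto simp: S_def Q_def R_def oplus_mat_def)
  have 1: "(a \<cdot>\<^sub>m ?I) * (b \<cdot>\<^sub>m ?I) = (a * b) \<cdot>\<^sub>m ?I" for a b
    by (subst mult_smult_assoc_mat[of _ n n _ n]) (auto intro!: eq_matI)
  have X: "X * (a \<cdot>\<^sub>m ?I) = a \<cdot>\<^sub>m X" "(a \<cdot>\<^sub>m ?I) * X = a \<cdot>\<^sub>m X" if "X \<in> carrier_mat n n" for a X
    using that mult_smult_distrib[OF that one_carrier_mat, of a] mult_smult_assoc_mat[OF one_carrier_mat that, of a] by auto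
  have SQ: "S * Q = 1\<^sub>m (n + n)" unfolding S_def Q_def
    by (subst mult_four_block_mat[of _ n n _ n _ n _ _ n _ n]) (auto simp: 1 X intro!: eq_matI)
  have QS: "Q * S = 1\<^sub>m (n + n)"
    using mat_mult_left_right_inverse[OF c(1,2) SQ] .
  have cb: "oplus_mat C (map_mat cnj C) = four_block_mat C (0\<^sub>m n n) (0\<^sub>m n n) (map_mat cnj C)"
    using C unfolding oplus_mat_def by auto
  have RS: "R * S = four_block_mat C (map_mat cnj C) ((- \<i>) \<cdot>\<^sub>m C) (\<i> \<cdot>\<^sub>m map_mat cnj C)"
    unfolding R_def S_def by (subst mult_four_block_mat[of _ n n _ n _ n _ _ n _ n])
      (use C in \<open>auto simp: X intro!: eq_matI complex_eqI\<close>)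
  have SC: "S * oplus_mat C (map_mat cnj C) = four_block_mat C (map_mat cnj C) ((- \<i>) \<cdot>\<^sub>m C) (\<i> \<cdot>\<^sub>m map_mat cnj C)"
    unfolding cb S_def by (subst mult_four_block_mat[of _ n n _ n _ n _ _ n _ n]) (use C in \<open>auto simp: X\<close>)
  have "R = R * (S * Q)" using c SQ by simp
  also have "\<dots> = S * oplus_mat C (map_mat cnj C) * Q" using c RS SC by (metis assoc_mult_mat)
  finally show ?thesis unfolding R
    by (intro similar_matI[of _ _ S Q "n + n"]) (use c SQ QS in auto)
qed

text \<open>\<open>realizes T n as H E ms\<close>: \<open>E\<close> is the real flow \<open>t \<mapsto> exp (t H)\<close>, its time-\<open>T\<close> map has the Jordan
  blocks \<open>as\<close>, and the Jordan blocks \<open>ms\<close> of \<open>H\<close> have the same sizes, with real parts \<open>ln \<bar>a\<bar> / T\<close>.\<close>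
definition realizes :: "real \<Rightarrow> nat \<Rightarrow> (nat \<times> complex) list \<Rightarrow> real Matrix.mat \<Rightarrow> (real \<Rightarrow> real Matrix.mat) \<Rightarrow> (nat \<times> complex) list \<Rightarrow> bool" where
  "realizes T n as H E ms \<longleftrightarrow> mat_flow n H E \<and>
     jordan_nf (map_mat complex_of_real (E T)) as \<and> jordan_nf (map_mat complex_of_real H) ms \<and>
     map (\<lambda>(k, \<mu>). (k, Re \<mu>)) ms = map (\<lambda>(k, a). (k, ln (cmod a) / T)) as"

lemma jordan_nf_similar: "similar_mat A B \<Longrightarrow> jordan_nf B xs \<Longrightarrow> jordan_nf A xs"
  unfolding jordan_nf_def using similar_mat_trans by blast

lemma jordan_nf_jordan_block: "k \<noteq> 0 \<Longrightarrow> jordan_nf (jordan_block k (a :: 'a::field)) [(k, a)]"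
  by (rule jordan_nf_one_block) auto

lemma jordan_nf_jordan_block_exp:
  fixes \<mu> :: "'a::{real_normed_field,banach}"
  assumes "k \<noteq> 0" "T \<noteq> 0"
  shows "jordan_nf (jordan_block_exp k \<mu> T) [(k, exp (of_real T * \<mu>))]"
  by (rule jordan_nf_one_block) (use assms in \<open>auto simp: jordan_block_exp_def\<close>)

lemma inj_comm_ring_hom_of_real: "inj_comm_ring_hom complex_of_real"
  by unfold_locales auto

lemma inj_comm_ring_hom_cnj: "inj_comm_ring_hom cnj"
  by unfold_locales auto

lemma realizes_Nil: "\<exists>H E ms. realizes T 0 [] H E ms"
proof -
  have "jordan_nf (map_mat complex_of_real (0\<^sub>m 0 0)) []"
  proof -
    have "map_mat complex_of_real (0\<^sub>m 0 0) = 0\<^sub>m 0 0" by (intro eq_matI) auto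
    thus ?thesis unfolding jordan_nf_def jordan_matrix_def by (simp add: similar_mat_refl[of _ 0])
  qed
  thus ?thesis unfolding realizes_def mat_flow_def
    by (intro exI[of _ "0\<^sub>m 0 0"] exI[of _ "\<lambda>_. 0\<^sub>m 0 0"] exI[of _ "[]"]) auto
qed

lemma realizes_positive:
  assumes "k \<noteq> 0" "T \<noteq> 0" "a > 0"
  shows "\<exists>H E ms. realizes T k [(k, complex_of_real a)] H E ms"
proof -
  let ?\<mu> = "ln a / T"
  have "realizes T k [(k, complex_of_real a)] (jordan_block k ?\<mu>) (jordan_block_exp k ?\<mu>) [(k, complex_of_real ?\<mu>)]"
    unfolding realizes_def
    using mat_flow_jordan_block_exp[of k ?\<mu>]
      jordan_nf_map_hom[OF inj_comm_ring_hom_of_real jordan_nf_jordan_block_exp[OF assms(1,2), of ?\<mu>]]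
      jordan_nf_map_hom[OF inj_comm_ring_hom_of_real jordan_nf_jordan_block[OF assms(1), of ?\<mu>]] assms
    by simp
  thus ?thesis by blast
qed

text \<open>The principal logarithm \<open>Ln a\<close> exists for every nonzero \<open>a\<close>.
  For negative \<open>a\<close> the pair consists of two equal blocks, which is how negative blocks
  of even multiplicity get a real logarithm.\<close>

lemma realizes_conj_pair:
  assumes k: "k \<noteq> 0" and T: "T \<noteq> 0" and a: "a \<noteq> 0"
  shows "\<exists>H E ms. realizes T (k + k) [(k, a), (k, cnj a)] H E ms"
proof -
  let ?\<mu> = "Ln a / complex_of_real T"
  have c: "jordan_block k ?\<mu> \<in> carrier_mat k k" "jordan_block_exp k ?\<mu> T \<in> carrier_mat k k"
    by (auto simp: jordan_block_exp_def)
  have e: "exp (complex_of_real T * ?\<mu>) = a" using T a by simp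
  have 1: "jordan_nf (oplus_mat C (map_mat cnj C)) [(k, b), (k, cnj b)]" if "jordan_nf C [(k, b)]" for C b
    using jordan_nf_oplus_mat[OF that jordan_nf_map_hom[OF inj_comm_ring_hom_cnj that]] by simp
  have 2: "jordan_nf (map_mat complex_of_real (realify (jordan_block_exp k ?\<mu> T))) [(k, a), (k, cnj a)]"
    by (rule jordan_nf_similar[OF similar_realify[OF c(2)] 1]) (metis jordan_nf_jordan_block_exp[OF k T] e)
  have 3: "jordan_nf (map_mat complex_of_real (realify (jordan_block k ?\<mu>))) [(k, ?\<mu>), (k, cnj ?\<mu>)]"
    by (rule jordan_nf_similar[OF similar_realify[OF c(1)] 1[OF jordan_nf_jordan_block[OF k]]])
  have "realizes T (k + k) [(k, a), (k, cnj a)] (realify (jordan_block k ?\<mu>)) (\<lambda>t. realify (jordan_block_exp k ?\<mu> t)) [(k, ?\<mu>), (k, cnj ?\<mu>)]"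
    unfolding realizes_def using mat_flow_realify[OF mat_flow_jordan_block_exp] 2 3 a by simp
  thus ?thesis by blast
qed

lemma mat_flow_oplus_mat:
  assumes "mat_flow n H E" "mat_flow m H' E'"
  shows "mat_flow (n + m) (oplus_mat H H') (\<lambda>t. oplus_mat (E t) (E' t))"
  unfolding mat_flow_def
proof (intro conjI allI impI)
  have H: "H \<in> carrier_mat n n" "H' \<in> carrier_mat m m" and E: "E t \<in> carrier_mat n n" "E' t \<in> carrier_mat m m"
    and E0: "E 0 = 1\<^sub>m n" "E' 0 = 1\<^sub>m m"
    and d: "i < n \<Longrightarrow> j < n \<Longrightarrow> ((\<lambda>t. E t $$ (i, j)) has_vector_derivative (H * E t) $$ (i, j)) (at t)"
    and d': "i < m \<Longrightarrow> j < m \<Longrightarrow> ((\<lambda>t. E' t $$ (i, j)) has_vector_derivative (H' * E' t) $$ (i, j)) (at t)" for t i j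
    using assms unfolding mat_flow_def by auto
  show "oplus_mat H H' \<in> carrier_mat (n + m) (n + m)" "oplus_mat (E t) (E' t) \<in> carrier_mat (n + m) (n + m)" for t
    using oplus_mat_carrier H E by blast+
  show "oplus_mat (E 0) (E' 0) = 1\<^sub>m (n + m)" unfolding E0 by (rule oplus_mat_one)
  fix i j t assume ij: "i < n + m" "j < n + m"
  have HE: "H * E t \<in> carrier_mat n n" "H' * E' t \<in> carrier_mat m m" using H E by auto
  show "((\<lambda>t. oplus_mat (E t) (E' t) $$ (i, j)) has_vector_derivative (oplus_mat H H' * oplus_mat (E t) (E' t)) $$ (i, j)) (at t)"
    unfolding oplus_mat_mult[OF H E] oplus_mat_index[OF HE ij] oplus_mat_index[OF E ij]
    using ij by (auto intro: d d')
qed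

lemma realizes_append:
  assumes "realizes T n as H E ms" "realizes T m bs H' E' ms'"
  shows "realizes T (n + m) (as @ bs) (oplus_mat H H') (\<lambda>t. oplus_mat (E t) (E' t)) (ms @ ms')"
  using assms mat_flow_oplus_mat[of n H E m H' E']
  unfolding realizes_def by (auto simp: map_mat_oplus_mat[where h = complex_of_real, OF of_real_0] intro!: jordan_nf_oplus_mat)

lemma realizes_list:
  assumes T: "T \<noteq> 0"
    and pos: "\<And>k a. (k, a) \<in> set xs \<Longrightarrow> k \<noteq> 0 \<and> Im a = 0 \<and> Re a > 0"
    and pairs: "\<And>k a. (k, a) \<in> set ys \<Longrightarrow> k \<noteq> 0 \<and> a \<noteq> 0"
  shows "\<exists>n H E ms. realizes T n (xs @ concat (map (\<lambda>(k, a). [(k, a), (k, cnj a)]) ys)) H E ms"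
proof -
  have ys: "\<exists>n H E ms. realizes T n (concat (map (\<lambda>(k, a). [(k, a), (k, cnj a)]) ys)) H E ms"
    using pairs
  proof (induction ys)
    case Nil show ?case using realizes_Nil by fastforce
  next
    case (Cons y ys)
    obtain k a where y: "y = (k, a)" by force
    obtain H E ms where 1: "realizes T (k + k) [(k, a), (k, cnj a)] H E ms"
      using realizes_conj_pair[OF _ T, of k a] Cons.prems[of k a] y by auto
    obtain n H' E' ms' where 2: "realizes T n (concat (map (\<lambda>(k, a). [(k, a), (k, cnj a)]) ys)) H' E' ms'"
      using Cons by force
    show ?case using realizes_append[OF 1 2] unfolding y by fastforce
  qed
  show ?thesis using pos
  proof (induction xs)
    case Nil show ?case using ys by simp
  next
    case (Cons x xs)
    obtain k a where x: "x = (k, a)" by force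
    have "a = complex_of_real (Re a)" using Cons.prems[of k a] x by (auto intro: complex_eqI)
    then obtain H E ms where 1: "realizes T k [(k, a)] H E ms"
      using realizes_positive[OF _ T, of k "Re a"] Cons.prems[of k a] x by auto
    obtain n H' E' ms' where 2: "realizes T n (xs @ concat (map (\<lambda>(k, a). [(k, a), (k, cnj a)]) ys)) H' E' ms'"
      using Cons by force
    show ?case using realizes_append[OF 1 2] unfolding x by fastforce
  qed
qed

text \<open>A negative eigenvalue occurring an even number of times is treated like a conjugate pair; only the
  blocks that occur an odd number of times leave one copy over.\<close>
lemma conj_symmetric_mset_split:
  fixes B :: "(nat \<times> complex) multiset"
  defines "cj \<equiv> \<lambda>(k :: nat, a). (k, cnj a)"
  assumes sym: "image_mset cj B = B" and nz: "\<And>k. (k, 0) \<notin># B"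
  shows "\<exists>Y. set_mset Y \<subseteq> set_mset B \<and> B = filter_mset (\<lambda>(k, a). Im a = 0 \<and> Re a > 0) B + (Y + image_mset cj Y) +
     mset_set {(k, a) \<in> set_mset B. Im a = 0 \<and> Re a < 0 \<and> odd (count B (k, a))}"
proof -
  have cj: "cj (cj x) = x" for x by (cases x) (auto simp: cj_def)
  have cnt: "count (image_mset cj M) x = count M (cj x)" for M x
    by (induction M) (use cj in auto)
  have sym': "count B (cj x) = count B x" for x using cnt[of B x] sym by simp
  define neg where "neg = (\<lambda>(k :: nat, a). Im a = 0 \<and> Re a < 0)"
  \<comment> \<open>One representative of each pair: all blocks with eigenvalue in the upper half
    plane, and half, rounded down, of the copies of each negative block. The rounding loses one copy
    exactly when the multiplicity is odd.\<close>
  define Y where "Y = filter_mset (\<lambda>(k, a). Im a > 0) B +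
     (\<Sum>x\<in>{x \<in> set_mset B. neg x}. replicate_mset (count B x div 2) x)"
  have cY: "count Y x = (if Im (snd x) > 0 then count B x else if neg x then count B x div 2 else 0)" for x
  proof -
    have "count (\<Sum>x\<in>{x \<in> set_mset B. neg x}. replicate_mset (count B x div 2) x) x =
      (\<Sum>y\<in>{x \<in> set_mset B. neg x}. if y = x then count B y div 2 else 0)"
      by (simp add: count_sum)
    also have "\<dots> = (if x \<in># B \<and> neg x then count B x div 2 else 0)" by simp
    finally show ?thesis by (auto simp: Y_def neg_def not_in_iff split: prod.splits)
  qed
  have "count B x = count (filter_mset (\<lambda>(k, a). Im a = 0 \<and> Re a > 0) B + (Y + image_mset cj Y) +
     mset_set {(k, a) \<in> set_mset B. Im a = 0 \<and> Re a < 0 \<and> odd (count B (k, a))}) x" for x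
  proof -
    obtain k a where x: "x = (k, a)" by force
    have 0: "count B (k, a) = 0" if "a = 0" using nz[of k] that by (simp add: not_in_iff)
    have cjx: "cj x = (k, cnj a)" by (simp add: x cj_def)
    have o: "count B x = 2 * (count B x div 2) + (if odd (count B x) then 1 else 0)" by presburger
    have "finite {(k, a) \<in> set_mset B. Im a = 0 \<and> Re a < 0 \<and> odd (count B (k, a))}"
      by (rule finite_subset[of _ "set_mset B"]) auto
    moreover have "x \<in># B" if "odd (count B x)" using that by (metis count_eq_zero_iff even_zero)
    ultimately have odd: "count (mset_set {(k, a) \<in> set_mset B. Im a = 0 \<and> Re a < 0 \<and> odd (count B (k, a))}) x =
      (if neg x \<and> odd (count B x) then 1 else 0)"
      by (auto simp: count_mset_set' neg_def x)
    have cr: "cnj a = a" if "Im a = 0" using that by (simp add: complex_eq_iff)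
    have rhs: "count (filter_mset (\<lambda>(k, a). Im a = 0 \<and> Re a > 0) B + (Y + image_mset cj Y) +
      mset_set {(k, a) \<in> set_mset B. Im a = 0 \<and> Re a < 0 \<and> odd (count B (k, a))}) x =
      (if Im a = 0 \<and> Re a > 0 then count B x else 0) + (count Y x + count Y (k, cnj a)) +
      (if neg x \<and> odd (count B x) then 1 else 0)"
      unfolding count_union odd cnt cjx by (simp add: x)
    consider "a = 0" | "Im a = 0" "Re a > 0" | "Im a = 0" "Re a < 0" | "Im a > 0" | "Im a < 0"
      by (metis complex_eq_iff linorder_neqE_linordered_idom zero_complex.sel)
    thus ?thesis
    proof cases
      case 3
      hence "count Y x = count B x div 2" "count Y (k, cnj a) = count B x div 2" "neg x"
        using cr by (auto simp: cY neg_def x)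
      thus ?thesis unfolding rhs using o 3 by (simp only:) simp
    qed (use 0 sym'[of x] cjx cr in \<open>auto simp: rhs cnt cY x neg_def\<close>)
  qed
  moreover have "set_mset Y \<subseteq> set_mset B"
  proof
    fix x assume "x \<in># Y"
    hence "count Y x \<noteq> 0" by simp
    hence "count B x \<noteq> 0" by (rule contrapos_nn) (simp add: cY)
    thus "x \<in># B" by (simp add: not_in_iff[symmetric])
  qed
  ultimately show ?thesis by (intro exI[of _ Y] conjI multiset_eqI) auto
qed

subsection \<open>Normal form of the monodromy matrix\<close>

text \<open>If \<open>X + \<i> Y\<close> intertwines two real matrices, so does \<open>X + t Y\<close> for real \<open>t\<close>, and its determinant is a
  polynomial in \<open>t\<close> that does not vanish at \<open>\<i>\<close>.\<close>
lemma real_similar_if_complex_similar: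
  fixes A B :: "real Matrix.mat"
  assumes A: "A \<in> carrier_mat n n" and B: "B \<in> carrier_mat n n"
    and sim: "similar_mat (map_mat complex_of_real A) (map_mat complex_of_real B)"
  shows "\<exists>P Q. P \<in> carrier_mat n n \<and> Q \<in> carrier_mat n n \<and> P * Q = 1\<^sub>m n \<and> Q * P = 1\<^sub>m n \<and> A * P = P * B"
proof -
  interpret cr: inj_comm_ring_hom complex_of_real by (rule inj_comm_ring_hom_of_real)
  let ?c = "map_mat complex_of_real"
  obtain P Q where P: "P \<in> carrier_mat n n" and Q: "Q \<in> carrier_mat n n" and PQ: "P * Q = 1\<^sub>m n" "Q * P = 1\<^sub>m n"
    and AB: "?c A = P * ?c B * Q"
    using similar_matD[OF sim] A by auto
  have cA: "?c A \<in> carrier_mat n n" and cB: "?c B \<in> carrier_mat n n" using A B by auto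
  have "?c A * P = P * ?c B * (Q * P)" unfolding AB using P Q cB by (simp add: assoc_mult_mat[of _ n n _ n _ n])
  hence AP: "?c A * P = P * ?c B" using P cB by (simp add: PQ)
  define X where "X = map_mat Re P"
  define Y where "Y = map_mat Im P"
  have X: "X \<in> carrier_mat n n" and Y: "Y \<in> carrier_mat n n" using P by (auto simp: X_def Y_def)
  have eqs: "(\<Sum>l<n. A $$ (i, l) * h (P $$ (l, j))) = (\<Sum>l<n. h (P $$ (i, l)) * B $$ (l, j))"
    if i: "i < n" and j: "j < n" and h: "h = Re \<or> h = Im" for i j and h :: "complex \<Rightarrow> real"
  proof -
    have "(?c A * P) $$ (i, j) = (\<Sum>l<n. complex_of_real (A $$ (i, l)) * P $$ (l, j))"
      using A P i j by (simp add: scalar_prod_def atLeast0LessThan)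
    moreover have "(P * ?c B) $$ (i, j) = (\<Sum>l<n. P $$ (i, l) * complex_of_real (B $$ (l, j)))"
      using B P i j by (simp add: scalar_prod_def atLeast0LessThan)
    ultimately have "h (\<Sum>l<n. complex_of_real (A $$ (i, l)) * P $$ (l, j)) = h (\<Sum>l<n. P $$ (i, l) * complex_of_real (B $$ (l, j)))"
      using AP by simp
    thus ?thesis using h by auto
  qed
  define N where "N t = Matrix.mat n n (\<lambda>(i, j). X $$ (i, j) + t * Y $$ (i, j))" for t
  have N: "N t \<in> carrier_mat n n" for t by (simp add: N_def)
  have AN: "A * N t = N t * B" for t
  proof (rule eq_matI)
    fix i j assume "i < dim_row (N t * B)" "j < dim_col (N t * B)"
    hence i: "i < n" and j: "j < n" using N[of t] B by auto
    have "(A * N t) $$ (i, j) = (\<Sum>l<n. A $$ (i, l) * Re (P $$ (l, j))) + t * (\<Sum>l<n. A $$ (i, l) * Im (P $$ (l, j)))"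
      using A P i j unfolding N_def X_def Y_def
      by (simp add: scalar_prod_def atLeast0LessThan distrib_left sum.distrib sum_distrib_left mult.left_commute)
    also have "\<dots> = (\<Sum>l<n. Re (P $$ (i, l)) * B $$ (l, j)) + t * (\<Sum>l<n. Im (P $$ (i, l)) * B $$ (l, j))"
      using eqs[OF i j, of Re] eqs[OF i j, of Im] by simp
    also have "\<dots> = (N t * B) $$ (i, j)"
      using B P i j unfolding N_def X_def Y_def
      by (simp add: scalar_prod_def atLeast0LessThan distrib_right sum.distrib sum_distrib_left mult.assoc)
    finally show "(A * N t) $$ (i, j) = (N t * B) $$ (i, j)" .
  qed (use A B N[of t] in auto)
  have "\<exists>t. Determinant.det (N t) \<noteq> 0"
  proof (rule ccontr)
    assume neg: "\<not> ?thesis"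
    \<comment> \<open>The pencil \<open>X + z Y\<close> with polynomial entries: its determinant
      specialises to that of \<open>N t\<close> at real \<open>t\<close> and to that of
      \<open>P\<close> at \<open>\<i>\<close>.\<close>
    define M where "M = Matrix.mat n n (\<lambda>(i, j). [:complex_of_real (X $$ (i, j)), complex_of_real (Y $$ (i, j)):])"
    have ev: "map_mat (\<lambda>p. poly p z) M = Matrix.mat n n (\<lambda>(i, j). complex_of_real (X $$ (i, j)) + z * complex_of_real (Y $$ (i, j)))" for z
      by (intro eq_matI) (auto simp: M_def)
    have dev: "poly (Determinant.det M) z = Determinant.det (map_mat (\<lambda>p. poly p z) M)" for z
      by (rule comm_ring_hom.hom_det[symmetric], unfold_locales) auto
    have "poly (Determinant.det M) (complex_of_real t) = 0" for t
    proof -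
      have "map_mat (\<lambda>p. poly p (complex_of_real t)) M = ?c (N t)"
        unfolding ev N_def by (intro eq_matI) auto
      thus ?thesis unfolding dev using neg by simp
    qed
    hence "range complex_of_real \<subseteq> {z. poly (Determinant.det M) z = 0}" by auto
    moreover have "infinite (range complex_of_real)"
      using range_inj_infinite finite_imageD infinite_UNIV_char_0 inj_of_real by blast
    ultimately have "Determinant.det M = 0" using poly_roots_finite finite_subset by blast
    hence "Determinant.det (map_mat (\<lambda>p. poly p \<i>) M) = 0" using dev[of \<i>] by simp
    moreover have "map_mat (\<lambda>p. poly p \<i>) M = P"
      unfolding ev X_def Y_def using P by (intro eq_matI) (auto simp: complex_eq_iff)
    ultimately have "Determinant.det P = 0" by simp
    moreover have "Determinant.det P * Determinant.det Q = 1"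
      using Determinant.det_mult[OF P Q] PQ by simp
    ultimately show False by simp
  qed
  then obtain t where t: "Determinant.det (N t) \<noteq> 0" by blast
  obtain R where "R \<in> carrier_mat n n" "N t * R = 1\<^sub>m n" "R * N t = 1\<^sub>m n" using det_nonzero_inverse[OF N t] .
  thus ?thesis using N AN by blast
qed

section \<open>Transfer between matrices indexed by a finite type and matrices indexed by
  numbers\<close>

definition idx_of :: "'n::finite \<Rightarrow> nat" where
  "idx_of = the_inv_into {..<CARD('n)} idx_enum"

lemma bij_betw_idx_enum: "bij_betw idx_enum {..<CARD('n)} (UNIV :: 'n::finite set)"
proof -
  have "\<exists>h. bij_betw h {..<CARD('n)} (UNIV :: 'n set)"
    using ex_bij_betw_nat_finite[of "UNIV :: 'n set"] by (auto simp: atLeast0LessThan)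
  thus ?thesis unfolding idx_enum_def by (rule someI_ex)
qed

lemma idx_of_less: "idx_of (i :: 'n::finite) < CARD('n)"
  and idx_enum_idx_of [simp]: "idx_enum (idx_of i) = i"
  and idx_of_idx_enum [simp]: "k < CARD('n) \<Longrightarrow> idx_of (idx_enum k :: 'n) = k"
proof -
  have inj: "inj_on (idx_enum :: nat \<Rightarrow> 'n) {..<CARD('n)}" and img: "idx_enum ` {..<CARD('n)} = (UNIV :: 'n set)"
    using bij_betw_idx_enum[where 'n = 'n] by (auto simp: bij_betw_def)
  show "idx_of i < CARD('n)" using the_inv_into_into[OF inj, of i] img unfolding idx_of_def by auto
  show "idx_enum (idx_of i) = i" unfolding idx_of_def using f_the_inv_into_f[OF inj] img by auto
  show "k < CARD('n) \<Longrightarrow> idx_of (idx_enum k :: 'n) = k" unfolding idx_of_def using the_inv_into_f_f[OF inj] by auto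
qed

lemma sum_idx_of: "(\<Sum>i\<in>(UNIV :: 'n::finite set). h (idx_of i)) = (\<Sum>k<CARD('n). h k)"
  using sum.reindex_bij_betw[OF bij_betw_idx_enum[where 'n = 'n], of "\<lambda>i. h (idx_of i)"] by simp

definition from_mat :: "real Matrix.mat \<Rightarrow> real^'m^'n" where
  "from_mat A = (\<chi> i j. A $$ (idx_of i, idx_of j))"

definition to_mat :: "real^'m^'n \<Rightarrow> real Matrix.mat" where
  "to_mat M = Matrix.mat CARD('n) CARD('m) (\<lambda>(i, j). M $ idx_enum i $ idx_enum j)"

lemma to_mat_carrier: "to_mat (M :: real^'m^'n) \<in> carrier_mat CARD('n) CARD('m)"
  by (simp add: to_mat_def)

lemma from_to_mat: "from_mat (to_mat M) = (M :: real^'m^'n)"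
  by (simp add: from_mat_def to_mat_def Finite_Cartesian_Product.vec_eq_iff idx_of_less)

lemma to_from_mat: "A \<in> carrier_mat CARD('n) CARD('m) \<Longrightarrow> to_mat (from_mat A :: real^'m^'n) = A"
  by (intro eq_matI) (auto simp: from_mat_def to_mat_def)

lemma to_cmat_conv: "to_cmat M = map_mat complex_of_real (to_mat M)"
  by (intro eq_matI) (auto simp: to_cmat_def to_mat_def)

lemma from_mat_mult:
  assumes "A \<in> carrier_mat CARD('n) CARD('k)" "B \<in> carrier_mat CARD('k) CARD('m)"
  shows "(from_mat (A * B) :: real^'m^'n) = from_mat A ** (from_mat B :: real^'m^'k)"
proof -
  have "(A * B) $$ (idx_of i, idx_of j) = (\<Sum>k\<in>(UNIV :: 'k set). A $$ (idx_of i, idx_of k) * B $$ (idx_of k, idx_of j))"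
    for i :: 'n and j :: 'm
    using assms sum_idx_of[where 'n = 'k, of "\<lambda>k. A $$ (idx_of i, k) * B $$ (k, idx_of j)"]
    by (simp add: idx_of_less scalar_prod_def atLeast0LessThan)
  thus ?thesis by (simp add: Finite_Cartesian_Product.vec_eq_iff from_mat_def matrix_matrix_mult_def)
qed

lemma from_mat_one: "from_mat (1\<^sub>m CARD('n)) = (mat 1 :: real^'n^'n)"
proof -
  have "idx_of i = idx_of j \<longleftrightarrow> i = j" for i j :: 'n by (metis idx_enum_idx_of)
  thus ?thesis by (simp add: from_mat_def Finite_Cartesian_Product.mat_def Finite_Cartesian_Product.vec_eq_iff idx_of_less)
qed

lemma to_mat_one: "to_mat (mat 1 :: real^'n^'n) = 1\<^sub>m CARD('n)"
  unfolding from_mat_one[symmetric] by (simp add: to_from_mat)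

lemma to_mat_mult: "to_mat (A ** B) = to_mat A * to_mat (B :: real^'m^'k)" for A :: "real^'k^'n"
proof -
  have "A ** B = from_mat (to_mat A * to_mat B)"
    by (simp add: from_mat_mult[OF to_mat_carrier to_mat_carrier] from_to_mat)
  thus ?thesis by (simp add: to_from_mat mult_carrier_mat[OF to_mat_carrier to_mat_carrier])
qed

lemma matrix_expansion:
  fixes X :: "real^'m^'n"
  shows "X = (\<Sum>i\<in>UNIV. \<Sum>j\<in>UNIV. (X $ i $ j) *\<^sub>R axis i (axis j 1))"
  by (auto simp: Finite_Cartesian_Product.vec_eq_iff axis_def if_distrib if_distribR sum.If_cases cong: if_cong)

lemma has_vector_derivative_matrix:
  fixes F :: "real \<Rightarrow> real^'m^'n"
  assumes "\<And>i j. ((\<lambda>t. F t $ i $ j) has_vector_derivative F' $ i $ j) (at t)"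
  shows "(F has_vector_derivative F') (at t)"
proof -
  have "((\<lambda>t. \<Sum>i\<in>UNIV. \<Sum>j\<in>UNIV. (F t $ i $ j) *\<^sub>R axis i (axis j 1)) has_vector_derivative
     (\<Sum>i\<in>UNIV. \<Sum>j\<in>UNIV. (F' $ i $ j) *\<^sub>R axis i (axis j 1 :: real^'m))) (at t)"
    by (intro has_vector_derivative_sum bounded_linear.has_vector_derivative[OF bounded_linear_scaleR_left] assms)
  thus ?thesis unfolding matrix_expansion[symmetric] .
qed

section \<open>Spectra read off from Jordan blocks\<close>

definition block_eigs :: "(nat \<times> 'a) list \<Rightarrow> 'a multiset" where
  "block_eigs xs = (\<Sum>(k, a)\<leftarrow>xs. replicate_mset k a)"

lemma block_eigs_simps [simp]: "block_eigs [] = {#}" "block_eigs ((k, a) # xs) = replicate_mset k a + block_eigs xs"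
  "block_eigs (xs @ ys) = block_eigs xs + block_eigs ys"
  by (auto simp: block_eigs_def)

lemma block_eigs_mset: "mset xs = mset ys \<Longrightarrow> block_eigs xs = block_eigs ys"
  unfolding block_eigs_def by (metis mset_map sum_mset_sum_list)

lemma image_block_eigs: "image_mset h (block_eigs xs) = block_eigs (map (\<lambda>(k, a). (k, h a)) xs)"
  by (induction xs) auto

lemma proots_char_poly_jordan:
  fixes A :: "'a::field Matrix.mat"
  assumes "jordan_nf A xs"
  shows "proots (char_poly A) = block_eigs xs"
proof -
  have "(\<Prod>(k, a)\<leftarrow>ys. [:- a, 1:] ^ k) \<noteq> (0 :: 'a poly) \<and> proots (\<Prod>(k, a)\<leftarrow>ys. [:- a, 1:] ^ k) = block_eigs ys" for ys :: "(nat \<times> 'a) list"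
  proof (induction ys)
    case (Cons y ys)
    thus ?case by (cases y) (auto simp: proots_mult proots_power)
  qed simp
  thus ?thesis unfolding jordan_nf_char_poly[OF assms] by blast
qed

lemma jordan_nf_complex_exists: "(A :: complex Matrix.mat) \<in> carrier_mat n n \<Longrightarrow> \<exists>xs. jordan_nf A xs"
  using char_poly_factorized jordan_nf_exists by blast

lemma jordan_nf_eigenvalue:
  fixes A :: "'a::field Matrix.mat"
  assumes A: "A \<in> carrier_mat n n" and nf: "jordan_nf A xs"
  shows "Determinant.det (char_matrix A a) = 0 \<longleftrightarrow> a \<in> snd ` set xs"
proof -
  have "Determinant.det (char_matrix A a) = 0 \<longleftrightarrow> poly (\<Prod>(k, a)\<leftarrow>xs. [:- a, 1:] ^ k) a = 0"
    using eigenvalue_det[OF A, of a] eigenvalue_root_char_poly[OF A, of a] unfolding jordan_nf_char_poly[OF nf] by simp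
  moreover have "poly (\<Prod>(k, a)\<leftarrow>ys. [:- a, 1:] ^ k) a = 0 \<longleftrightarrow> a \<in> snd ` set ys" if "0 \<notin> fst ` set ys" for ys
    using that by (induction ys) (auto simp: poly_power)
  ultimately show ?thesis using nf unfolding jordan_nf_def by simp
qed

lemma realizes_dim: "realizes T n as H E ms \<Longrightarrow> n = sum_list (map fst as)"
proof -
  assume r: "realizes T n as H E ms"
  hence "similar_mat (map_mat complex_of_real (E T)) (jordan_matrix as)" "E T \<in> carrier_mat n n"
    unfolding realizes_def jordan_nf_def mat_flow_def by auto
  with similar_matD[of "map_mat complex_of_real (E T)" "jordan_matrix as"] show ?thesis
    using jordan_matrix_dim(1)[of as] by (metis carrier_matD(1) index_map_mat(2) insert_subset)
qed

lemma jordan_nf_dim: "jordan_nf A xs \<Longrightarrow> A \<in> carrier_mat n n \<Longrightarrow> n = sum_list (map fst xs)"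
  using similar_matD[of A "jordan_matrix xs"] unfolding jordan_nf_def
  by (metis carrier_matD(1) jordan_matrix_dim(1) insert_subset)

lemma jordan_blocks_nf: "jordan_nf (to_cmat (M :: real^'n^'n)) (jordan_blocks M)"
proof -
  have "to_cmat M \<in> carrier_mat CARD('n) CARD('n)" by (simp add: to_cmat_def)
  from jordan_nf_complex_exists[OF this] show ?thesis unfolding jordan_blocks_def by (rule someI_ex)
qed

text \<open>Entrywise conjugation fixes a real matrix but conjugates its Jordan form; uniqueness
  does the rest.\<close>

lemma jordan_nf_real_conj:
  assumes "jordan_nf (map_mat complex_of_real A) xs"
  shows "image_mset (\<lambda>(k, a). (k, cnj a)) (mset xs) = mset xs"
proof -
  have "map_mat cnj (map_mat complex_of_real A) = map_mat complex_of_real A" by (intro eq_matI) auto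
  with jordan_nf_map_hom[OF inj_comm_ring_hom_cnj assms]
  have "jordan_nf (map_mat complex_of_real A) (map (\<lambda>(k, a). (k, cnj a)) xs)" by simp
  from jordan_nf_mset_unique[OF this assms] show ?thesis by simp
qed

text \<open>A block \<open>(k, c)\<close> contributes \<open>k\<close> copies of \<open>c\<close>,
  so total multiplicity 1 leaves room for a single block, of size 1.\<close>

lemma simple_eigenvalue_block:
  assumes pos: "0 \<notin> fst ` set bs" and one: "count (block_eigs bs) c = 1"
  obtains bs' where "mset bs = add_mset (1, c) (mset bs')" "c \<notin> snd ` set bs'"
proof -
  have z: "count (block_eigs xs) c = 0 \<longleftrightarrow> c \<notin> snd ` set xs" if "0 \<notin> fst ` set xs" for xs
  proof -
    have "c \<in># block_eigs xs \<longleftrightarrow> c \<in> snd ` set xs" using that by (induction xs) auto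
    thus ?thesis by (simp add: not_in_iff[symmetric])
  qed
  from z[OF pos] one obtain k where "(k, c) \<in> set bs" by auto
  then obtain us vs where bs: "bs = us @ (k, c) # vs" by (meson split_list)
  have "k \<noteq> 0" using pos bs by auto
  hence "k = 1" "count (block_eigs (us @ vs)) c = 0" using one unfolding bs by auto
  moreover have "0 \<notin> fst ` set (us @ vs)" using pos bs by auto
  ultimately show ?thesis using that[of "us @ vs"] z bs by auto
qed

lemma flip_mat_conv:
  assumes "n1 + d = CARD('m::finite)"
  shows "flip_mat {i :: 'm. idx_of i \<ge> n1} = from_mat (oplus_mat (1\<^sub>m n1) ((- 1) \<cdot>\<^sub>m 1\<^sub>m d))"
proof -
  have inj: "idx_of i = idx_of j \<longleftrightarrow> i = j" for i j :: 'm by (metis idx_enum_idx_of)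
  have ix: "oplus_mat (1\<^sub>m n1) ((- 1) \<cdot>\<^sub>m 1\<^sub>m d) $$ (idx_of i, idx_of j) =
    (if idx_of i < n1 then if idx_of j < n1 then 1\<^sub>m n1 $$ (idx_of i, idx_of j) else 0
     else if idx_of j < n1 then 0 else ((- 1) \<cdot>\<^sub>m 1\<^sub>m d) $$ (idx_of i - n1, idx_of j - n1))" for i j :: 'm
    by (rule oplus_mat_index[of _ n1 _ d]) (use idx_of_less[of i] idx_of_less[of j] assms in auto)
  have "oplus_mat (1\<^sub>m n1) ((- 1) \<cdot>\<^sub>m 1\<^sub>m d) $$ (idx_of i, idx_of j) =
     (if i = j then if n1 \<le> idx_of i then - 1 else 1 else (0 :: real))" for i j :: 'm
    unfolding ix using inj[of i j] idx_of_less[of i] idx_of_less[of j] assms by auto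
  thus ?thesis by (simp add: flip_mat_def from_mat_def Finite_Cartesian_Product.vec_eq_iff)
qed

lemma mset_conj_pairs:
  "mset (concat (map (\<lambda>(k, a). [(k, a), (k, cnj a)]) ys)) = mset ys + image_mset (\<lambda>(k, a). (k, cnj a)) (mset ys)"
  by (induction ys) auto

text \<open>The list \<open>os\<close> holds one copy of each odd negative block; its negatives have
  positive eigenvalues and therefore real logarithms. As each such block is counted once, the total
  size of \<open>os\<close> is the A-index.\<close>

lemma floquet_blocks:
  fixes M :: "real^'n^'n"
  assumes T: "T \<noteq> 0" and inv: "invertible M" and one: "count (eigs_mult M) 1 = 1"
  shows "\<exists>n1 d H1 E1 ms1 H2 E2 ms2 as os.
    realizes T n1 as H1 E1 ms1 \<and> realizes T d (map (\<lambda>(k, a). (k, - a)) os) H2 E2 ms2 \<and>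
    mset (jordan_blocks M) = add_mset (1, 1) (mset (as @ os)) \<and> 1 \<notin> snd ` set (as @ os) \<and> d = A_index_mat M"
proof -
  define bs where "bs = jordan_blocks M"
  have nf: "jordan_nf (to_cmat M) bs" unfolding bs_def by (rule jordan_blocks_nf)
  have c: "to_cmat M \<in> carrier_mat CARD('n) CARD('n)" by (simp add: to_cmat_def)
  have pos: "0 \<notin> fst ` set bs" using nf unfolding jordan_nf_def by simp
  \<comment> \<open>Invertibility excludes the eigenvalue 0, which has no logarithm.\<close>
  have "Determinant.det (to_cmat M) \<noteq> 0"
  proof -
    obtain N where "M ** N = mat 1" using inv unfolding invertible_def by blast
    hence "to_mat M * to_mat N = 1\<^sub>m CARD('n)"
      using to_mat_mult[of M N] by (simp add: to_mat_one)
    hence "Determinant.det (to_mat M) * Determinant.det (to_mat N) = 1"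
      using Determinant.det_mult[OF to_mat_carrier[of M] to_mat_carrier[of N]] by simp
    hence "Determinant.det (to_mat M) \<noteq> 0" by auto
    moreover have "Determinant.det (to_cmat M) = complex_of_real (Determinant.det (to_mat M))"
      unfolding to_cmat_conv by (rule of_real_hom.hom_det)
    ultimately show ?thesis by simp
  qed
  moreover have "char_matrix (to_cmat M) 0 = to_cmat M" unfolding char_matrix_def using c by (intro eq_matI) auto
  ultimately have nz: "0 \<notin> snd ` set bs" using jordan_nf_eigenvalue[OF c nf, of 0] by simp
  have "count (block_eigs bs) 1 = 1" using one proots_char_poly_jordan[OF nf] unfolding eigs_mult_def by simp
  then obtain bs' where bs': "mset bs = add_mset (1, 1) (mset bs')" "1 \<notin> snd ` set bs'"
    using simple_eigenvalue_block[OF pos] by metis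
  have set: "set bs = insert (1, 1) (set bs')" using arg_cong[OF bs'(1), of set_mset] by simp
  have "image_mset (\<lambda>(k, a). (k, cnj a)) (mset bs) = mset bs"
    using jordan_nf_real_conj nf unfolding to_cmat_conv by blast
  hence sym: "image_mset (\<lambda>(k, a). (k, cnj a)) (mset bs') = mset bs'" unfolding bs' by simp
  define O' where "O' = {(k, a) \<in> set bs'. Im a = 0 \<and> Re a < 0 \<and> odd (count (mset bs') (k, a))}"
  have finO: "finite O'" unfolding O'_def by (rule finite_subset[of _ "set bs'"]) auto
  have nz': "(k, 0) \<notin># mset bs'" for k using nz set by force
  have "\<exists>Y. set_mset Y \<subseteq> set_mset (mset bs') \<and> mset bs' = filter_mset (\<lambda>(k, a). Im a = 0 \<and> Re a > 0) (mset bs') +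
     (Y + image_mset (\<lambda>(k, a). (k, cnj a)) Y) + mset_set O'"
    using conj_symmetric_mset_split[OF sym nz'] unfolding O'_def by (simp only: set_mset_mset)
  then obtain Y where Y: "set_mset Y \<subseteq> set bs'" "mset bs' = filter_mset (\<lambda>(k, a). Im a = 0 \<and> Re a > 0) (mset bs') +
     (Y + image_mset (\<lambda>(k, a). (k, cnj a)) Y) + mset_set O'" by auto
  obtain ys where ys: "mset ys = Y" using ex_mset by blast
  obtain os where os: "mset os = mset_set O'" using ex_mset by blast
  define xs where "xs = filter (\<lambda>(k, a). Im a = 0 \<and> Re a > 0) bs'"
  define as where "as = xs @ concat (map (\<lambda>(k, a). [(k, a), (k, cnj a)]) ys)"
  have "mset (as @ os) = filter_mset (\<lambda>(k, a). Im a = 0 \<and> Re a > 0) (mset bs') +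
     (Y + image_mset (\<lambda>(k, a). (k, cnj a)) Y) + mset_set O'"
    unfolding as_def by (simp add: mset_conj_pairs ys os xs_def)
  hence "mset (as @ os) = mset bs'" by (rule trans[OF _ Y(2)[symmetric]])
  note mo = this
  have m: "mset bs = add_mset (1, 1) (mset (as @ os))" unfolding mo by (rule bs'(1))
  have so: "set (as @ os) = set bs'" by (rule mset_eq_setD[OF mo])
  have pos': "k \<noteq> 0" "a \<noteq> 0" if "(k, a) \<in> set bs'" for k a
  proof -
    have "(k, a) \<in> set bs" using that set by simp
    thus "k \<noteq> 0" "a \<noteq> 0" using pos nz by (metis fst_conv image_eqI, metis snd_conv image_eqI)
  qed
  have "\<exists>n H E ms. realizes T n as H E ms" unfolding as_def
  proof (rule realizes_list[OF T])
    show "k \<noteq> 0 \<and> Im a = 0 \<and> Re a > 0" if "(k, a) \<in> set xs" for k a using that pos' unfolding xs_def by auto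
    show "k \<noteq> 0 \<and> a \<noteq> 0" if "(k, a) \<in> set ys" for k a
    proof -
      have "(k, a) \<in> set bs'" using that Y(1) arg_cong[OF ys, of set_mset] by auto
      thus ?thesis using pos' by blast
    qed
  qed
  then obtain n1 H1 E1 ms1 where r1: "realizes T n1 as H1 E1 ms1" by blast
  have seto: "set os = O'" using arg_cong[OF os, of set_mset] finO by simp
  let ?ns = "map (\<lambda>(k, a). (k, - a)) os"
  have "\<exists>n H E ms. realizes T n (?ns @ concat (map (\<lambda>(k, a). [(k, a), (k, cnj a)]) [])) H E ms"
  proof (rule realizes_list[OF T])
    show "k \<noteq> 0 \<and> Im a = 0 \<and> Re a > 0" if "(k, a) \<in> set ?ns" for k a
      using that pos' seto unfolding O'_def by auto
  qed simp
  then obtain d H2 E2 ms2 where r2: "realizes T d ?ns H2 E2 ms2" by auto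
  have dA: "d = A_index_mat M"
  proof -
    have "map fst ?ns = map fst os" by auto
    hence d1: "d = sum_list (map fst os)" using realizes_dim[OF r2] by (simp only:)
    have d2: "sum_list (map fst os) = sum_mset (image_mset fst (mset os))" by (simp add: sum_mset_sum_list[symmetric])
    have d3: "sum_mset (image_mset fst (mset_set O')) = (\<Sum>x\<in>O'. fst x)" by (simp add: sum_unfold_sum_mset)
    have d: "d = (\<Sum>(k, a)\<in>O'. k)" unfolding d1 d2 os d3 by (simp add: case_prod_beta)
    \<comment> \<open>The removed block has the positive eigenvalue 1 and so does not affect the odd
      negative blocks.\<close>
    have eqO: "{(k, a) \<in> set bs. Im a = 0 \<and> Re a < 0 \<and> odd (count (mset bs) (k, a))} = O'"
      unfolding O'_def bs'(1) set by auto
    show ?thesis unfolding A_index_mat_def Let_def bs_def[symmetric] eqO by (rule d)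
  qed
  have "1 \<notin> snd ` set (as @ os)" unfolding so by (rule bs'(2))
  hence "realizes T n1 as H1 E1 ms1 \<and> realizes T d ?ns H2 E2 ms2 \<and>
    mset (jordan_blocks M) = add_mset (1, 1) (mset (as @ os)) \<and> 1 \<notin> snd ` set (as @ os) \<and> d = A_index_mat M"
    by (intro conjI r1 r2 m[unfolded bs_def] dA)
  thus ?thesis by - (rule exI)+
qed

text \<open>\<open>L\<close> consists of the rows of the inverse conjugating matrix that belong to
  the columns in \<open>P\<close>; it records that \<open>P\<close> is injective. The clause on
  fixed vectors says that 1 is not a multiplier of the complement and later keeps the velocity of
  the cycle out of the range of \<open>P\<close>.\<close>

lemma floquet_normal_form:
  fixes M :: "real^'n^'n"
  assumes dim: "CARD('n) = Suc CARD('m::finite)"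
    and T: "T \<noteq> 0" and inv: "invertible M" and one: "count (eigs_mult M) 1 = 1"
  shows "\<exists>(P :: real^'m^'n) (L :: real^'n^'m) (W :: 'm set) (H :: real^'m^'m) E.
    card W = A_index_mat M \<and> block_diag_wrt W H \<and>
    E 0 = mat 1 \<and> (\<forall>t. (E has_vector_derivative H ** E t) (at t)) \<and>
    M ** P = P ** (E T ** flip_mat W) \<and> L ** P = mat 1 \<and>
    (\<forall>b. (E T ** flip_mat W) *v b = b \<longrightarrow> b = 0) \<and>
    image_mset Re (eigs_mult H) = image_mset (\<lambda>\<mu>. ln (cmod \<mu>) / T) (eigs_mult M - {#1#})"
proof -
  obtain n1 d H1 E1 ms1 H2 E2 ms2 as os where
    r1: "realizes T n1 as H1 E1 ms1" and r2: "realizes T d (map (\<lambda>(k, a). (k, - a)) os) H2 E2 ms2"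
    and bs: "mset (jordan_blocks M) = add_mset (1, 1) (mset (as @ os))"
    and n1: "1 \<notin> snd ` set (as @ os)" and d: "d = A_index_mat M"
    using floquet_blocks[OF T inv one] by (elim exE conjE)
  let ?c = "map_mat complex_of_real"
  let ?n = "CARD('n)" and ?m = "CARD('m)"
  have f1: "mat_flow n1 H1 E1" and f2: "mat_flow d H2 E2" and j1: "jordan_nf (?c (E1 T)) as"
    and j2: "jordan_nf (?c (E2 T)) (map (\<lambda>(k, a). (k, - a)) os)"
    and h1: "jordan_nf (?c H1) ms1" and h2: "jordan_nf (?c H2) ms2"
    and m1: "map (\<lambda>(k, \<mu>). (k, Re \<mu>)) ms1 = map (\<lambda>(k, a). (k, ln (cmod a) / T)) as"
    and m2: "map (\<lambda>(k, \<mu>). (k, Re \<mu>)) ms2 = map (\<lambda>(k, a). (k, ln (cmod a) / T)) (map (\<lambda>(k, a). (k, - a)) os)"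
    using r1 r2 unfolding realizes_def by auto
  have E1c: "E1 t \<in> carrier_mat n1 n1" and E2c: "E2 t \<in> carrier_mat d d" for t using f1 f2 unfolding mat_flow_def by auto
  have nfM: "jordan_nf (to_cmat M) (jordan_blocks M)" by (rule jordan_blocks_nf)
  have cM: "to_cmat M \<in> carrier_mat ?n ?n" by (simp add: to_cmat_def)
  define Q where "Q = oplus_mat (E1 T) ((- 1) \<cdot>\<^sub>m E2 T)"
  have Q: "Q \<in> carrier_mat (n1 + d) (n1 + d)" unfolding Q_def using E1c E2c by (intro oplus_mat_carrier) auto
  have "?c ((- 1) \<cdot>\<^sub>m E2 T) = (- 1) \<cdot>\<^sub>m ?c (E2 T)" by (intro eq_matI) auto
  moreover have "map (\<lambda>(k, a). (k, (- 1) * a)) (map (\<lambda>(k, a). (k, - a)) os) = os"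
    by (induction os) auto
  ultimately have "jordan_nf (?c ((- 1) \<cdot>\<^sub>m E2 T)) os"
    using jordan_nf_smult[OF j2, of "- 1"] by simp
  hence jQ: "jordan_nf (?c Q) (as @ os)"
    unfolding Q_def map_mat_oplus_mat[where h = complex_of_real, OF of_real_0] using j1 by (intro jordan_nf_oplus_mat)
  define B where "B = oplus_mat (1\<^sub>m 1) Q"
  have jB: "jordan_nf (?c B) (jordan_blocks M)"
  proof (rule jordan_nf_mset)
    have "?c (1\<^sub>m 1) = jordan_block 1 1" by (intro eq_matI) auto
    hence "jordan_nf (?c (1\<^sub>m 1)) [(1, 1)]" using jordan_nf_jordan_block[of 1 "1 :: complex"] by simp
    thus "jordan_nf (?c B) ([(1, 1)] @ (as @ os))"
      unfolding B_def map_mat_oplus_mat[where h = complex_of_real, OF of_real_0] using jQ by (rule jordan_nf_oplus_mat)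
    show "mset ([(1, 1)] @ (as @ os)) = mset (jordan_blocks M)" using bs by simp
  qed
  have B: "B \<in> carrier_mat (1 + (n1 + d)) (1 + (n1 + d))" unfolding B_def using Q by (intro oplus_mat_carrier) auto
  have "1 + (n1 + d) = ?n"
    using jordan_nf_dim[OF jB, of "1 + (n1 + d)"] jordan_nf_dim[OF nfM cM] B by simp
  hence nd: "n1 + d = ?m" and Bn: "B \<in> carrier_mat ?n ?n" and Qm: "Q \<in> carrier_mat ?m ?m" using dim B Q by auto
  have "similar_mat (to_cmat M) (?c B)"
    using nfM jB similar_mat_trans similar_mat_sym unfolding jordan_nf_def by blast
  then obtain P0 Q0 where P0: "P0 \<in> carrier_mat ?n ?n" and Q0: "Q0 \<in> carrier_mat ?n ?n"
    and PQ: "P0 * Q0 = 1\<^sub>m ?n" "Q0 * P0 = 1\<^sub>m ?n" and MP: "to_mat M * P0 = P0 * B"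
    using real_similar_if_complex_similar[OF to_mat_carrier[of M] Bn] unfolding to_cmat_conv by blast
  define Pm where "Pm = Matrix.mat ?n ?m (\<lambda>(i, j). P0 $$ (i, Suc j))"
  define Lm where "Lm = Matrix.mat ?m ?n (\<lambda>(i, j). Q0 $$ (Suc i, j))"
  have Pm: "Pm \<in> carrier_mat ?n ?m" and Lm: "Lm \<in> carrier_mat ?m ?n" by (auto simp: Pm_def Lm_def)
  \<comment> \<open>Every column of \<open>B\<close> after the first vanishes in the first row, so
    the first column of \<open>P0\<close> drops out of the product.\<close>
  have MPm: "to_mat M * Pm = Pm * Q"
  proof (rule eq_matI)
    fix i j assume "i < dim_row (Pm * Q)" "j < dim_col (Pm * Q)"
    hence i: "i < ?n" and j: "j < ?m" using Pm Qm by auto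
    have Mc: "to_mat M \<in> carrier_mat ?n ?n" by (rule to_mat_carrier)
    have Bix: "B $$ (l, Suc j) = (if l < 1 then 0 else Q $$ (l - 1, j))" if "l < ?n" for l
      unfolding B_def using oplus_mat_index[OF one_carrier_mat[of 1] Qm, of l "Suc j"] that j dim by auto
    have "(to_mat M * Pm) $$ (i, j) = (to_mat M * P0) $$ (i, Suc j)"
      using i j Mc P0 dim by (simp add: Pm_def scalar_prod_def)
    also have "\<dots> = (\<Sum>l<?n. P0 $$ (i, l) * B $$ (l, Suc j))"
      unfolding MP using i j Bn P0 dim by (simp add: scalar_prod_def atLeast0LessThan)
    also have "\<dots> = (\<Sum>l<?n. P0 $$ (i, l) * (if l < 1 then 0 else Q $$ (l - 1, j)))"
      by (intro sum.cong) (auto simp: Bix)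
    also have "\<dots> = (\<Sum>l<?m. P0 $$ (i, Suc l) * Q $$ (l, j))"
      unfolding dim sum.lessThan_Suc_shift by simp
    also have "\<dots> = (Pm * Q) $$ (i, j)"
      using i j Qm by (simp add: Pm_def scalar_prod_def atLeast0LessThan)
    finally show "(to_mat M * Pm) $$ (i, j) = (Pm * Q) $$ (i, j)" .
  qed (use Pm Qm to_mat_carrier[of M] in auto)
  have LPm: "Lm * Pm = 1\<^sub>m ?m"
  proof (rule eq_matI)
    fix i j assume "i < dim_row (1\<^sub>m ?m :: real Matrix.mat)" "j < dim_col (1\<^sub>m ?m :: real Matrix.mat)"
    hence i: "i < ?m" and j: "j < ?m" by auto
    have "(Lm * Pm) $$ (i, j) = (Q0 * P0) $$ (Suc i, Suc j)"
      using i j P0 Q0 dim by (simp add: Pm_def Lm_def scalar_prod_def)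
    thus "(Lm * Pm) $$ (i, j) = 1\<^sub>m ?m $$ (i, j)" unfolding PQ using i j dim by simp
  qed (use Pm Lm in auto)
  \<comment> \<open>The w-coordinates are the last \<open>d\<close> indices in the enumeration,
    where \<open>Q\<close> carries the minus sign.\<close>
  define W where "W = {i :: 'm. idx_of i \<ge> n1}"
  define Hm where "Hm = oplus_mat H1 H2"
  define Em where "Em t = oplus_mat (E1 t) (E2 t)" for t
  have fl: "mat_flow ?m Hm Em" unfolding Hm_def Em_def using mat_flow_oplus_mat[OF f1 f2] nd by simp
  have Hm: "Hm \<in> carrier_mat ?m ?m" and Em: "Em t \<in> carrier_mat ?m ?m" for t using fl unfolding mat_flow_def by auto
  define P :: "real^'m^'n" where "P = from_mat Pm"
  define L :: "real^'n^'m" where "L = from_mat Lm"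
  define H :: "real^'m^'m" where "H = from_mat Hm"
  define E :: "real \<Rightarrow> real^'m^'m" where "E t = from_mat (Em t)" for t
  have "card W = A_index_mat M"
  proof -
    have "bij_betw idx_enum {n1..<?m} W"
      unfolding bij_betw_def
    proof
      show "inj_on (idx_enum :: nat \<Rightarrow> 'm) {n1..<?m}"
        using bij_betw_idx_enum[where 'n = 'm] unfolding bij_betw_def by (rule conjunct1[THEN inj_on_subset]) auto
      show "idx_enum ` {n1..<?m} = W"
      proof (intro equalityI subsetI)
        fix i assume "i \<in> W"
        hence "idx_of i \<in> {n1..<?m}" using idx_of_less[of i] by (simp add: W_def)
        thus "i \<in> idx_enum ` {n1..<?m}" using idx_enum_idx_of[of i] by (metis imageI)
      qed (auto simp: W_def)
    qed
    hence "card {n1..<?m} = card W" by (rule bij_betw_same_card)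
    thus ?thesis using nd d by simp
  qed
  moreover have "block_diag_wrt W H"
  proof -
    have c: "H1 \<in> carrier_mat n1 n1" "H2 \<in> carrier_mat d d" using f1 f2 unfolding mat_flow_def by auto
    have "Hm $$ (idx_of i, idx_of j) = 0" if "(i \<in> W) \<noteq> (j \<in> W)" for i j
      unfolding Hm_def using oplus_mat_index[OF c, of "idx_of i" "idx_of j"] idx_of_less[of i] idx_of_less[of j] nd that
      by (auto simp: W_def)
    thus ?thesis unfolding block_diag_wrt_def H_def from_mat_def by simp
  qed
  moreover have "E 0 = mat 1" using fl from_mat_one unfolding E_def mat_flow_def by metis
  moreover have "(E has_vector_derivative H ** E t) (at t)" for t
  proof (rule has_vector_derivative_matrix)
    fix i j
    have "H ** E t = from_mat (Hm * Em t)" unfolding H_def E_def by (rule from_mat_mult[OF Hm Em, symmetric])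
    thus "((\<lambda>t. E t $ i $ j) has_vector_derivative (H ** E t) $ i $ j) (at t)"
      using fl idx_of_less[of i] idx_of_less[of j] unfolding mat_flow_def E_def by (simp add: from_mat_def)
  qed
  moreover have ETf: "E T ** flip_mat W = from_mat Q"
  proof -
    have "from_mat (Em T) ** flip_mat W = (from_mat (Em T * oplus_mat (1\<^sub>m n1) ((- 1) \<cdot>\<^sub>m 1\<^sub>m d)) :: real^'m^'m)"
      unfolding W_def flip_mat_conv[OF nd]
      by (rule from_mat_mult[OF Em, symmetric]) (use nd oplus_mat_carrier[of "1\<^sub>m n1" n1 "(- 1) \<cdot>\<^sub>m 1\<^sub>m d" d] in auto)
    also have "Em T * oplus_mat (1\<^sub>m n1) ((- 1) \<cdot>\<^sub>m 1\<^sub>m d) = Q"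
    proof -
      have "E2 T * ((- 1) \<cdot>\<^sub>m 1\<^sub>m d) = (- 1) \<cdot>\<^sub>m E2 T"
        using mult_smult_distrib[OF E2c[of T] one_carrier_mat, of "- 1"] E2c[of T] by simp
      moreover have "E1 T * 1\<^sub>m n1 = E1 T" using E1c[of T] by simp
      ultimately show ?thesis unfolding Em_def Q_def
        using oplus_mat_mult[OF E1c[of T] E2c[of T] one_carrier_mat, of "(- 1) \<cdot>\<^sub>m 1\<^sub>m d"] by simp
    qed
    finally show ?thesis unfolding E_def .
  qed
  moreover have "M ** P = P ** from_mat Q"
  proof -
    have "M ** P = from_mat (to_mat M * Pm)"
      unfolding P_def using from_mat_mult[OF to_mat_carrier[of M] Pm] by (simp add: from_to_mat)
    thus ?thesis unfolding MPm P_def using from_mat_mult[OF Pm Qm] by simp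
  qed
  moreover have "L ** P = mat 1"
    unfolding L_def P_def using from_mat_mult[OF Lm Pm] LPm by (simp add: from_mat_one)
  moreover have "from_mat Q *v b = b \<longrightarrow> b = 0" for b :: "real^'m"
  proof
    assume b: "from_mat Q *v b = b"
    \<comment> \<open>No block in \<open>as @ os\<close> has eigenvalue 1, so \<open>Q - 1\<close>
      is invertible.\<close>
    have Qd: "Determinant.det (char_matrix (?c Q) 1) \<noteq> 0"
      using jordan_nf_eigenvalue[OF _ jQ, of ?m 1] Qm n1 by auto
    have "char_matrix (?c Q) 1 = ?c (char_matrix Q 1)"
      unfolding char_matrix_def using Qm by (intro eq_matI) auto
    hence "Determinant.det (char_matrix Q 1) \<noteq> 0" using Qd of_real_hom.hom_det[of "char_matrix Q 1"] by auto
    then obtain X where X: "X \<in> carrier_mat ?m ?m" "X * char_matrix Q 1 = 1\<^sub>m ?m"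
      using det_nonzero_inverse[of "char_matrix Q 1" ?m] Qm by auto
    have "from_mat X ** (from_mat (char_matrix Q 1) :: real^'m^'m) = (mat 1 :: real^'m^'m)"
      using from_mat_mult[OF X(1) char_matrix_closed[OF Qm, of 1]]
      unfolding X(2) from_mat_one by (rule sym)
    moreover have "(from_mat (char_matrix Q 1) :: real^'m^'m) = from_mat Q - mat 1"
    proof -
      have "(idx_of i = idx_of j) = (i = j)" for i j :: 'm by (metis idx_enum_idx_of)
      thus ?thesis using Qm unfolding char_matrix_def
        by (auto simp: from_mat_def Finite_Cartesian_Product.vec_eq_iff Finite_Cartesian_Product.mat_def idx_of_less)
    qed
    ultimately have "from_mat X *v ((from_mat Q - mat 1) *v b) = b"
      by (simp add: matrix_vector_mul_assoc)
    moreover have "(from_mat Q - mat 1) *v b = 0" using b by (simp add: matrix_vector_mult_diff_rdistrib)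
    ultimately show "b = 0" by simp
  qed
  moreover have "image_mset Re (eigs_mult H) = image_mset (\<lambda>\<mu>. ln (cmod \<mu>) / T) (eigs_mult M - {#1#})"
  proof -
    have "to_cmat H = oplus_mat (?c H1) (?c H2)"
      unfolding to_cmat_conv H_def to_from_mat[OF Hm] unfolding Hm_def by (rule map_mat_oplus_mat) simp
    hence "jordan_nf (to_cmat H) (ms1 @ ms2)" using jordan_nf_oplus_mat[OF h1 h2] by simp
    hence eH: "eigs_mult H = block_eigs (ms1 @ ms2)" unfolding eigs_mult_def by (rule proots_char_poly_jordan)
    have "eigs_mult M = block_eigs (jordan_blocks M)" unfolding eigs_mult_def by (rule proots_char_poly_jordan[OF nfM])
    also have "\<dots> = block_eigs ([(1, 1)] @ (as @ os))" by (rule block_eigs_mset) (use bs in simp)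
    finally have eM: "eigs_mult M - {#1#} = block_eigs (as @ os)" by simp
    \<comment> \<open>Negating an eigenvalue keeps its modulus, so passing from \<open>os\<close> to
      its negatives does not alter the real parts of the logarithms.\<close>
    have m3: "map (\<lambda>(k, a). (k, ln (cmod a) / T)) (map (\<lambda>(k, a). (k, - a)) os) = map (\<lambda>(k, a). (k, ln (cmod a) / T)) os"
      by (induction os) auto
    show ?thesis unfolding eH eM image_block_eigs map_append m1 m2 m3 ..
  qed
  ultimately have "card W = A_index_mat M \<and> block_diag_wrt W H \<and>
    E 0 = mat 1 \<and> (\<forall>t. (E has_vector_derivative H ** E t) (at t)) \<and>
    M ** P = P ** (E T ** flip_mat W) \<and> L ** P = mat 1 \<and>
    (\<forall>b. (E T ** flip_mat W) *v b = b \<longrightarrow> b = 0) \<and>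
    image_mset Re (eigs_mult H) = image_mset (\<lambda>\<mu>. ln (cmod \<mu>) / T) (eigs_mult M - {#1#})"
    unfolding ETf by (intro conjI allI)
  thus ?thesis by - (rule exI)+
qed

subsection \<open>The Floquet frame\<close>

lemma periodic_reduce:
  fixes h :: "real \<Rightarrow> 'a"
  assumes p: "p > 0" and per: "\<And>t. h (t + p) = h t"
  obtains s where "s \<in> {0..p}" "h s = h t"
proof -
  interpret periodic_fun_simple h p by unfold_locales (rule per)
  define s where "s = t + of_int (- \<lfloor>t / p\<rfloor>) * p"
  have "of_int \<lfloor>t / p\<rfloor> \<le> t / p" "t / p \<le> of_int \<lfloor>t / p\<rfloor> + 1" by linarith+
  hence "of_int \<lfloor>t / p\<rfloor> * p \<le> t" "t \<le> (of_int \<lfloor>t / p\<rfloor> + 1) * p"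
    using p by (simp_all only: pos_le_divide_eq pos_divide_le_eq)
  hence "s \<in> {0..p}" by (simp add: s_def algebra_simps)
  moreover have "h s = h t" unfolding s_def by (rule plus_of_int)
  ultimately show ?thesis using that by blast
qed

lemma periodic_range:
  assumes "p > 0" "\<And>t. h (t + p) = h t"
  shows "range h = h ` {0..p :: real}"
  proof
  show "range h \<subseteq> h ` {0..p}"
  proof
    fix x assume "x \<in> range h"
    then obtain t where "x = h t" by blast
    moreover obtain s where "s \<in> {0..p}" "h s = h t" using periodic_reduce[where h = h, OF assms] .
    ultimately show "x \<in> h ` {0..p}" by (metis imageI)
  qed
qed auto

lemma bounded_range_periodic:
  fixes h :: "real \<Rightarrow> 'a::real_normed_vector"
  assumes "p > 0" "\<And>t. h (t + p) = h t" "continuous_on UNIV h"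
  shows "bounded (range h)"
  unfolding periodic_range[where h = h, OF assms(1,2)]
  using compact_imp_bounded[OF compact_continuous_image[OF continuous_on_subset[OF assms(3)] compact_Icc]] by simp

text \<open>Columns are derivatives in fixed directions, the form in which the regularity of
  \<open>f\<close> is available.\<close>

lemma Ck_curve_matrix:
  fixes F :: "real \<Rightarrow> real^'m^'n"
  assumes "\<And>j. Ck_curve k (\<lambda>t. F t *v axis j 1)"
  shows "Ck_curve k F"
proof -
  have e: "F t $ i $ j = (F t *v axis j 1) $ i" for t i j
    by (simp add: matrix_vector_mult_basis column_def)
  have "Ck_curve k (\<lambda>t. \<Sum>i\<in>UNIV. \<Sum>j\<in>UNIV. ((F t *v axis j 1) $ i) *\<^sub>R axis i (axis j 1 :: real^'m) :: real^'m^'n)"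
    by (intro Ck_curve_sum Ck_curve_linear[OF bounded_linear_scaleR_left] Ck_curve_linear[OF bounded_linear_vec_nth] assms)
  moreover have "F = (\<lambda>t. \<Sum>i\<in>UNIV. \<Sum>j\<in>UNIV. ((F t *v axis j 1) $ i) *\<^sub>R axis i (axis j 1 :: real^'m))"
    unfolding e[symmetric] using matrix_expansion by blast
  ultimately show ?thesis by (simp only:)
qed

lemma sum_mult_delta:
  "(\<Sum>j\<in>(UNIV :: 'a::finite set). (if i = j then c j else 0) * y j) = (c i * y i :: real)"
  "(\<Sum>j\<in>(UNIV :: 'a::finite set). y j * (if j = i then c j else 0)) = (y i * c i :: real)"
proof -
  have "(\<Sum>j\<in>UNIV. (if i = j then c j else 0) * y j) = (\<Sum>j\<in>UNIV. if i = j then c j * y j else 0)"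
    by (rule sum.cong) auto
  thus "(\<Sum>j\<in>UNIV. (if i = j then c j else 0) * y j) = c i * y i" by simp
  have "(\<Sum>j\<in>UNIV. y j * (if j = i then c j else 0)) = (\<Sum>j\<in>UNIV. if j = i then y j * c j else 0)"
    by (rule sum.cong) auto
  thus "(\<Sum>j\<in>UNIV. y j * (if j = i then c j else 0)) = y i * c i" by simp
qed

lemma flip_mat_mult_vector: "flip_mat W *v y = flip_w W y"
  by (simp add: flip_mat_def flip_w_def matrix_vector_mult_def Finite_Cartesian_Product.vec_eq_iff sum_mult_delta)

lemma flip_mat_involution: "flip_mat W ** flip_mat W = mat 1"
proof -
  have "flip_mat W *v (flip_mat W *v x) = x" for x :: "real^'a"
    unfolding flip_mat_mult_vector by (simp add: flip_w_def Finite_Cartesian_Product.vec_eq_iff)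
  thus ?thesis by (simp add: matrix_eq matrix_vector_mul_assoc)
qed

lemma flip_mat_commute:
  assumes "block_diag_wrt W H"
  shows "flip_mat W ** H = H ** flip_mat W"
proof -
  have 1: "(flip_mat W ** H) $ i $ j = (if i \<in> W then -1 else 1) * H $ i $ j" for i j
    by (simp add: flip_mat_def matrix_matrix_mult_def sum_mult_delta)
  have 2: "(H ** flip_mat W) $ i $ j = H $ i $ j * (if j \<in> W then -1 else 1)" for i j
    by (simp add: flip_mat_def matrix_matrix_mult_def sum_mult_delta)
  have "H $ i $ j = 0 \<or> (i \<in> W) = (j \<in> W)" for i j using assms unfolding block_diag_wrt_def by blast
  hence "(flip_mat W ** H) $ i $ j = (H ** flip_mat W) $ i $ j" for i j
    unfolding 1 2 by (cases "i \<in> W"; cases "j \<in> W") force+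
  thus ?thesis by (simp add: Finite_Cartesian_Product.vec_eq_iff)
qed

section \<open>The one-parameter group generated by a real matrix\<close>

context
  fixes H :: "real^'m^'m" and E :: "real \<Rightarrow> real^'m^'m"
  assumes E0: "E 0 = mat 1" and E': "\<And>t. (E has_vector_derivative H ** E t) (at t)"
begin

lemma exp_matrix_unique:
  fixes X Y :: "real \<Rightarrow> real^'k^'m"
  assumes "\<And>t. (X has_vector_derivative H ** X t) (at t)" "\<And>t. (Y has_vector_derivative H ** Y t) (at t)" "X 0 = Y 0"
  shows "X t = Y t"
  by (rule linear_ode_unique_matrix[where A = "\<lambda>_. H" and X = X and Y = Y]) (use assms in auto)

lemma exp_matrix_add: "E (t + s) = E t ** E s"
proof (rule exp_matrix_unique[where X = "\<lambda>t. E (t + s)"])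
  fix t
  have "((\<lambda>t. t + s) has_vector_derivative 1) (at t)" by (auto intro!: derivative_eq_intros)
  from vector_diff_chain_at[OF this E'[of "t + s"]]
  show "((\<lambda>t. E (t + s)) has_vector_derivative H ** E (t + s)) (at t)" by (simp add: o_def)
  show "((\<lambda>t. E t ** E s) has_vector_derivative H ** (E t ** E s)) (at t)"
    using has_vector_derivative_matrix_mult[OF E'[of t] has_vector_derivative_const[of "E s"]]
    by (simp add: matrix_mul_assoc bounded_bilinear.zero_right[OF bounded_bilinear_matrix_matrix_mult])
qed (simp add: E0)

lemma exp_matrix_commute:
  assumes "F ** H = H ** F"
  shows "F ** E t = E t ** F"
proof (rule exp_matrix_unique[where X = "\<lambda>t. F ** E t"])
  fix t
  show "((\<lambda>t. F ** E t) has_vector_derivative H ** (F ** E t)) (at t)"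
    using has_vector_derivative_matrix_mult[OF has_vector_derivative_const[of F] E'[of t]] assms
    by (simp add: matrix_mul_assoc bounded_bilinear.zero_left[OF bounded_bilinear_matrix_matrix_mult])
  show "((\<lambda>t. E t ** F) has_vector_derivative H ** (E t ** F)) (at t)"
    using has_vector_derivative_matrix_mult[OF E'[of t] has_vector_derivative_const[of F]]
    by (simp add: matrix_mul_assoc bounded_bilinear.zero_right[OF bounded_bilinear_matrix_matrix_mult])
qed (simp add: E0)

lemma exp_matrix_uminus: "E t ** E (- t) = mat 1"
  using exp_matrix_add[of t "- t"] by (simp add: E0)

lemma exp_matrix_uminus_derivative:
  "((\<lambda>t. E (- t)) has_vector_derivative - (E (- t) ** H)) (at t)"
proof -
  have "(uminus has_vector_derivative (-1 :: real)) (at t)" by (auto intro!: derivative_eq_intros)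
  from vector_diff_chain_at[OF this E'[of "- t"]]
  show ?thesis using exp_matrix_commute[OF refl, of "- t"] by (simp add: o_def)
qed

end

text \<open>The independence clause says that velocity and frame together span the whole space at
  every point of the cycle. The further conclusions on \<open>A\<close> and \<open>\<phi>\<close>
  are the data for the uniform estimates in the new coordinates.\<close>

lemma floquet_frame:
  fixes f :: "real^'n \<Rightarrow> real^'n" and \<phi> :: "real \<Rightarrow> real^'n" and T :: real
  defines "A \<equiv> variational_matrix f \<phi>"
  assumes dim: "CARD('n) = Suc CARD('m::finite)"
    and D: "open D" and f: "Cr_on (Suc k) D f"
    and cycle: "periodic_orbit f D \<phi> T"
    and simple: "count (char_multipliers f \<phi> T) 1 = 1"
  shows "\<exists>(U :: real \<Rightarrow> real^'m^'n) (W :: 'm set) (H :: real^'m^'m).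
     Cr_on (Suc k) UNIV U \<and> card W = A_index A T \<and> (\<forall>t. U (t + T) = U t ** flip_mat W) \<and> block_diag_wrt W H \<and>
     (\<forall>t. (U has_vector_derivative (A t ** U t - U t ** H)) (at t)) \<and>
     (\<forall>s a b. a *\<^sub>R f (\<phi> s) + U s *v b = 0 \<longrightarrow> a = 0 \<and> b = 0) \<and>
     image_mset Re (eigs_mult H) = image_mset (\<lambda>\<mu>. ln (cmod \<mu>) / T) (poincare_multipliers f \<phi> T)"
    and "continuous_on UNIV A" and "\<And>t. A (t + T) = A t" and "continuous_on UNIV \<phi>" and "continuous_on UNIV (\<lambda>t. f (\<phi> t))"
    and "\<And>t. (f has_derivative (\<lambda>x. A t *v x)) (at (\<phi> t))"
proof -
  have T: "T > 0" and \<phi>D: "\<And>t. \<phi> t \<in> D" and \<phi>': "\<And>t. (\<phi> has_vector_derivative f (\<phi> t)) (at t)"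
    and per: "\<And>t. \<phi> (t + T) = \<phi> t" and "\<forall>\<tau>. 0 < \<tau> \<and> \<tau> < T \<longrightarrow> (\<exists>t. \<phi> (t + \<tau>) \<noteq> \<phi> t)"
    using cycle unfolding periodic_orbit_def is_solution_def by auto
  \<comment> \<open>Minimality of the period, tested at \<open>T / 2\<close>, shows that the orbit
    is not an equilibrium; this gives \<open>c \<noteq> 0\<close> below.\<close>
  then obtain t1 where nonconst: "\<phi> (t1 + T / 2) \<noteq> \<phi> t1" using half_gt_zero by fastforce
  have Df: "(f has_derivative frechet_derivative f (at (\<phi> t))) (at (\<phi> t))" for t
    using Cr_on_Suc_differentiable[OF f \<phi>D[of t]] unfolding at_within_open[OF \<phi>D D] frechet_derivative_works[symmetric] .
  have A_apply: "A t *v x = frechet_derivative f (at (\<phi> t)) x" for t x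
    unfolding A_def variational_matrix_def by (rule fun_cong[OF matrix_vector_mul(2)[OF has_derivative_linear[OF Df]]])
  show fA: "(f has_derivative (\<lambda>x. A t *v x)) (at (\<phi> t))" for t unfolding A_apply by (rule Df)
  have \<phi>Ck: "Ck_curve j \<phi>" if "j \<le> Suc (Suc k)" for j using that
  proof (induction j)
    case 0 show ?case using continuous_on_UNIV_if_has_vector_derivative[OF \<phi>'] by simp
  next
    case (Suc j)
    have "Ck_curve j (\<lambda>t. f (\<phi> t))" using Suc by (intro Ck_curve_compose[OF D \<phi>D Cr_on_mono[OF f]]) auto
    thus ?case using \<phi>' by (auto intro!: exI[of _ "\<lambda>t. f (\<phi> t)"])
  qed
  show cont\<phi>: "continuous_on UNIV \<phi>" using \<phi>Ck[of 0] by simp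
  show "continuous_on UNIV (\<lambda>t. f (\<phi> t))"
    using Ck_curve_continuous[OF Ck_curve_compose[OF D \<phi>D f \<phi>Ck]] by simp
  have ACk: "Ck_curve k A"
  proof (rule Ck_curve_matrix)
    fix j
    have "Ck_curve k (\<lambda>t. frechet_derivative f (at (\<phi> t) within D) (axis j 1))"
      by (rule Ck_curve_compose[OF D \<phi>D Cr_on_dderiv[OF f] \<phi>Ck]) auto
    thus "Ck_curve k (\<lambda>t. A t *v axis j 1)" unfolding A_apply at_within_open[OF \<phi>D D] .
  qed
  show contA: "continuous_on UNIV A" by (rule Ck_curve_continuous[OF ACk])
  show perA: "A (t + T) = A t" for t unfolding A_def variational_matrix_def per ..
  have bddA: "bounded (range A)" by (rule bounded_range_periodic[OF T perA contA])
  \<comment> \<open>The same choice as inside \<open>monodromy\<close>, so that \<open>M\<close> is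
    expressed by this very \<open>\<Phi>\<close>.\<close>
  define \<Phi> where "\<Phi> = (SOME \<Phi>. fundamental_matrix A \<Phi>)"
  have "fundamental_matrix A \<Phi>" unfolding \<Phi>_def by (rule someI_ex[OF fundamental_matrix_exists[OF contA bddA]])
  hence \<Phi>': "(\<Phi> has_vector_derivative A t ** \<Phi> t) (at t)" and \<Phi>inv: "invertible (\<Phi> t)" for t
    unfolding fundamental_matrix_def by auto
  define M where "M = monodromy A T"
  have M_eq: "M = matrix_inv (\<Phi> 0) ** \<Phi> T" unfolding M_def monodromy_def Let_def \<Phi>_def ..
  have \<Phi>_inv1: "\<Phi> t ** matrix_inv (\<Phi> t) = mat 1" and \<Phi>_inv2: "matrix_inv (\<Phi> t) ** \<Phi> t = mat 1" for t
    using someI_ex[OF \<Phi>inv[of t, unfolded invertible_def]] unfolding matrix_inv_def by auto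
  have Minv: "invertible M" unfolding M_eq using \<Phi>inv \<Phi>_inv1 \<Phi>_inv2
    by (intro invertible_mult) (auto simp: invertible_def)
  have \<Phi>T: "\<Phi> (t + T) = \<Phi> t ** M" for t
  proof (rule linear_ode_unique_matrix[OF contA bddA, where X = "\<lambda>t. \<Phi> (t + T)" and Y = "\<lambda>t. \<Phi> t ** M" and ?t0.0 = 0])
    fix t
    have "((\<lambda>t. t + T) has_vector_derivative 1) (at t)" by (auto intro!: derivative_eq_intros)
    from vector_diff_chain_at[OF this \<Phi>'[of "t + T"]]
    show "((\<lambda>t. \<Phi> (t + T)) has_vector_derivative A t ** \<Phi> (t + T)) (at t)" by (simp add: o_def perA)
    show "((\<lambda>t. \<Phi> t ** M) has_vector_derivative A t ** (\<Phi> t ** M)) (at t)"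
      using has_vector_derivative_matrix_mult[OF \<Phi>'[of t] has_vector_derivative_const[of M]]
      by (simp add: matrix_mul_assoc bounded_bilinear.zero_right[OF bounded_bilinear_matrix_matrix_mult])
  next
    show "\<Phi> (0 + T) = \<Phi> 0 ** M" unfolding M_eq by (simp add: matrix_mul_assoc \<Phi>_inv1)
  qed
  \<comment> \<open>The velocity \<open>f (\<phi> t)\<close> solves the variational equation;
    \<open>c\<close> holds its coordinates with respect to \<open>\<Phi>\<close>, and periodicity
    makes \<open>c\<close> an eigenvector of \<open>M\<close> for the multiplier 1.\<close>
  define c where "c = matrix_inv (\<Phi> 0) *v f (\<phi> 0)"
  have f\<phi>: "f (\<phi> t) = \<Phi> t *v c" for t
  proof (rule linear_ode_unique_vector[OF contA bddA, where x = "\<lambda>t. f (\<phi> t)" and y = "\<lambda>t. \<Phi> t *v c" and ?t0.0 = 0])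
    fix t
    show "((\<lambda>t. f (\<phi> t)) has_vector_derivative A t *v f (\<phi> t)) (at t)"
      using vector_derivative_diff_chain_within[OF \<phi>'[of t] has_derivative_at_withinI[OF fA]] by (simp add: o_def)
    show "((\<lambda>t. \<Phi> t *v c) has_vector_derivative A t *v (\<Phi> t *v c)) (at t)"
      using has_vector_derivative_matrix_vector_mult[OF \<Phi>'[of t] has_vector_derivative_const[of c]]
      by (simp add: matrix_vector_mul_assoc)
  next
    show "f (\<phi> 0) = \<Phi> 0 *v c" unfolding c_def by (simp add: matrix_vector_mul_assoc \<Phi>_inv1)
  qed
  have c0: "c \<noteq> 0"
  proof
    assume "c = 0"
    hence "(\<phi> has_vector_derivative 0) (at t)" for t using \<phi>'[of t] f\<phi>[of t] by simp
    from constant_if_derivative_0[OF this] nonconst show False by blast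
  qed
  have Mc: "M *v c = c"
  proof -
    have "\<Phi> 0 *v (M *v c) = \<Phi> 0 *v c"
      using f\<phi>[of T] f\<phi>[of 0] per[of 0] \<Phi>T[of 0] by (simp add: matrix_vector_mul_assoc)
    hence "matrix_inv (\<Phi> 0) *v (\<Phi> 0 *v (M *v c)) = matrix_inv (\<Phi> 0) *v (\<Phi> 0 *v c)" by simp
    thus ?thesis by (simp only: matrix_vector_mul_assoc[of "matrix_inv (\<Phi> 0)"] \<Phi>_inv2 matrix_vector_mul_lid)
  qed
  have eM: "char_multipliers f \<phi> T = eigs_mult M" unfolding char_multipliers_def M_def A_def ..
  have "count (eigs_mult M) 1 = 1" using simple eM by simp
  note nf = floquet_normal_form[OF dim less_imp_neq[OF T, symmetric] Minv this]
  obtain P :: "real^'m^'n" and L :: "real^'n^'m" and W :: "'m set" and H :: "real^'m^'m" and E where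
    W: "card W = A_index_mat M" and bd: "block_diag_wrt W H" and E0: "E 0 = mat 1"
    and E': "\<forall>t. (E has_vector_derivative H ** E t) (at t)" and MP: "M ** P = P ** (E T ** flip_mat W)"
    and LP: "L ** P = mat 1" and nofix: "\<forall>b. (E T ** flip_mat W) *v b = b \<longrightarrow> b = 0"
    and eig: "image_mset Re (eigs_mult H) = image_mset (\<lambda>\<mu>. ln (cmod \<mu>) / T) (eigs_mult M - {#1#})"
    using nf by (elim exE conjE)
  note E'' = spec[OF E']
  note Eadd = exp_matrix_add[OF E0 E''] and Ecomm = exp_matrix_commute[OF E0 E''] and Einv = exp_matrix_uminus[OF E0 E'']
    and Eneg = exp_matrix_uminus_derivative[OF E0 E'']
  define U where "U t = \<Phi> t ** (P ** E (- t))" for t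
  have U': "(U has_vector_derivative (A t ** U t - U t ** H)) (at t)" for t
  proof -
    have "((\<lambda>t. P ** E (- t)) has_vector_derivative P ** (- (E (- t) ** H))) (at t)"
      using has_vector_derivative_matrix_mult[OF has_vector_derivative_const[of P] Eneg[of t]]
      by (simp add: bounded_bilinear.zero_left[OF bounded_bilinear_matrix_matrix_mult])
    from has_vector_derivative_matrix_mult[OF \<Phi>'[of t] this]
    show ?thesis unfolding U_def
      by (simp add: bounded_bilinear.minus_right[OF bounded_bilinear_matrix_matrix_mult] matrix_mul_assoc)
  qed
  have UT: "U (t + T) = U t ** flip_mat W" for t
  proof -
    have fE: "flip_mat W ** E s = E s ** flip_mat W" for s by (rule Ecomm[OF flip_mat_commute[OF bd]])
    have "E (- (t + T)) = E (- T) ** E (- t)" unfolding Eadd[symmetric] by (simp add: add.commute)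
    hence "U (t + T) = \<Phi> t ** ((M ** P) ** (E (- T) ** E (- t)))"
      unfolding U_def \<Phi>T by (simp add: matrix_mul_assoc)
    also have "(M ** P) ** (E (- T) ** E (- t)) = P ** ((E T ** (flip_mat W ** E (- T))) ** E (- t))"
      unfolding MP by (simp add: matrix_mul_assoc)
    \<comment> \<open>The factor \<open>E T\<close> supplied by the monodromy cancels
      \<open>E (- T)\<close>; only the sign flip survives.\<close>
    also have "E T ** (flip_mat W ** E (- T)) = flip_mat W"
      unfolding fE by (simp add: matrix_mul_assoc Einv)
    also have "P ** (flip_mat W ** E (- t)) = P ** E (- t) ** flip_mat W"
      unfolding fE by (simp add: matrix_mul_assoc)
    finally show ?thesis unfolding U_def by (simp add: matrix_mul_assoc)
  qed
  have indep: "a = 0 \<and> b = 0" if eq: "a *\<^sub>R f (\<phi> s) + U s *v b = 0" for s a b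
  proof -
    define b' where "b' = E (- s) *v b"
    have "\<Phi> s *v (a *\<^sub>R c + P *v b') = 0"
      using eq unfolding f\<phi> U_def b'_def
      by (simp add: matrix_vector_right_distrib matrix_vector_mult_scaleR matrix_vector_mul_assoc matrix_mul_assoc)
    hence "matrix_inv (\<Phi> s) *v (\<Phi> s *v (a *\<^sub>R c + P *v b')) = 0" by simp
    hence cb: "a *\<^sub>R c + P *v b' = 0"
      by (simp only: matrix_vector_mul_assoc[of "matrix_inv (\<Phi> s)"] \<Phi>_inv2 matrix_vector_mul_lid)
    have Pinj: "x = y" if "P *v x = P *v y" for x y
    proof -
      have "L *v (P *v x) = L *v (P *v y)" using that by simp
      thus ?thesis by (simp add: matrix_vector_mul_assoc LP)
    qed
    have a0: "a = 0"
    proof (rule ccontr)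
      assume a: "a \<noteq> 0"
      \<comment> \<open>If the velocity were in the range of \<open>P\<close>, its preimage
        \<open>b''\<close> would be fixed by the complementary block, since \<open>M\<close> fixes
        \<open>c\<close> and \<open>P\<close> is injective. Then \<open>b''\<close> and
        \<open>c\<close> would vanish.\<close>
      define b'' where "b'' = (- inverse a) *\<^sub>R b'"
      have "inverse a *\<^sub>R (a *\<^sub>R c + P *v b') = 0" using cb by simp
      hence cP: "c = P *v b''" unfolding b''_def using a
        by (simp add: scaleR_add_right matrix_vector_mult_scaleR add_eq_0_iff
            bounded_bilinear.minus_right[OF bounded_bilinear_matrix_vector_mult])
      have "P *v ((E T ** flip_mat W) *v b'') = P *v b''"
        using Mc unfolding cP by (simp add: matrix_vector_mul_assoc MP)
      from Pinj[OF this] nofix have "b'' = 0" by blast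
      thus False using cP c0 by simp
    qed
    hence "P *v b' = P *v 0" using cb by simp
    hence "b' = 0" by (rule Pinj)
    hence "E s *v (E (- s) *v b) = 0" unfolding b'_def by simp
    hence "b = 0" by (simp add: matrix_vector_mul_assoc Einv)
    with a0 show ?thesis by simp
  qed
  \<comment> \<open>Bootstrapping: if \<open>U\<close> is of order \<open>j\<close> then so is
    \<open>A U - U H\<close>, hence \<open>U\<close> is of order \<open>Suc j\<close>. The order
    \<open>k\<close> of \<open>A\<close> stops this at \<open>Suc k\<close>.\<close>
  have UCk: "Ck_curve j U" if "j \<le> Suc k" for j using that
  proof (induction j)
    case 0 show ?case using continuous_on_UNIV_if_has_vector_derivative[OF U'] by simp
  next
    case (Suc j)
    have "Ck_curve j (\<lambda>t. A t ** U t + - (U t ** H))"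
      using Suc by (intro Ck_curve_add Ck_curve_minus Ck_curve_bilinear[OF bounded_bilinear_matrix_matrix_mult] Ck_curve_const Ck_curve_mono[OF ACk]) auto
    thus ?case using U' by (auto intro!: exI[of _ "\<lambda>t. A t ** U t - U t ** H"])
  qed
  have "Cr_on (Suc k) UNIV U" by (rule Cr_on_UNIV_if_Ck_curve[OF UCk]) simp
  moreover have "card W = A_index A T" unfolding A_index_def M_def[symmetric] by (rule W)
  moreover have "image_mset Re (eigs_mult H) = image_mset (\<lambda>\<mu>. ln (cmod \<mu>) / T) (poincare_multipliers f \<phi> T)"
    unfolding poincare_multipliers_def eM by (rule eig)
  ultimately have "Cr_on (Suc k) UNIV U \<and> card W = A_index A T \<and> (\<forall>t. U (t + T) = U t ** flip_mat W) \<and> block_diag_wrt W H \<and>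
     (\<forall>t. (U has_vector_derivative (A t ** U t - U t ** H)) (at t)) \<and>
     (\<forall>s a b. a *\<^sub>R f (\<phi> s) + U s *v b = 0 \<longrightarrow> a = 0 \<and> b = 0) \<and>
     image_mset Re (eigs_mult H) = image_mset (\<lambda>\<mu>. ln (cmod \<mu>) / T) (poincare_multipliers f \<phi> T)"
    using UT bd U' indep by (intro conjI allI impI) auto
  thus "\<exists>(U :: real \<Rightarrow> real^'m^'n) (W :: 'm set) (H :: real^'m^'m).
     Cr_on (Suc k) UNIV U \<and> card W = A_index A T \<and> (\<forall>t. U (t + T) = U t ** flip_mat W) \<and> block_diag_wrt W H \<and>
     (\<forall>t. (U has_vector_derivative (A t ** U t - U t ** H)) (at t)) \<and>
     (\<forall>s a b. a *\<^sub>R f (\<phi> s) + U s *v b = 0 \<longrightarrow> a = 0 \<and> b = 0) \<and>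
     image_mset Re (eigs_mult H) = image_mset (\<lambda>\<mu>. ln (cmod \<mu>) / T) (poincare_multipliers f \<phi> T)"
    by - (rule exI)+
qed

subsection \<open>Coordinates along the cycle\<close>

lemma norm_flip_w: "norm (flip_w W y) = norm y"
  unfolding norm_vec_def L2_set_def flip_w_def by (intro arg_cong[where f = sqrt] sum.cong) auto

lemma norm_proj_on_le: "norm (proj_on S y) \<le> norm y"
  by (rule norm_le_componentwise_cart) (auto simp: proj_on_def)

text \<open>The derivative of \<open>(s, y) \<mapsto> \<phi> s + U s y\<close>, where \<open>F = \<phi>'\<close> and \<open>V = U'\<close>.\<close>
definition frame_map :: "(real \<Rightarrow> real^'n) \<Rightarrow> (real \<Rightarrow> real^'m^'n) \<Rightarrow> (real \<Rightarrow> real^'m^'n) \<Rightarrow> real \<Rightarrow> real^'m \<Rightarrow> real \<times> (real^'m) \<Rightarrow> real^'n" where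
  "frame_map F U V s y x = fst x *\<^sub>R (F s + V s *v y) + U s *v snd x"

lemma linear_frame_map: "linear (frame_map F U V s y)"
  unfolding frame_map_def
  by (rule linearI) (auto simp: matrix_vector_right_distrib matrix_vector_mult_scaleR scaleR_add_left scaleR_add_right)

text \<open>For \<open>y = 0\<close> independence and compactness of a period times the unit sphere
  give a positive minimum. The \<open>y\<close>-dependent term is bounded uniformly in
  \<open>s\<close> and costs at most half of it when \<open>y\<close> is small.\<close>

lemma frame_map_lower_bound:
  fixes F :: "real \<Rightarrow> real^'n" and U V :: "real \<Rightarrow> real^'m^'n"
  assumes p: "p > 0" and per: "\<And>s. F (s + p) = F s" "\<And>s. U (s + p) = U s" "\<And>s. V (s + p) = V s"
    and cont: "continuous_on UNIV F" "continuous_on UNIV U" "continuous_on UNIV V"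
    and indep: "\<And>s a b. a *\<^sub>R F s + U s *v b = 0 \<Longrightarrow> a = 0 \<and> b = 0"
  shows "\<exists>c>0. \<exists>\<epsilon>>0. \<forall>s. \<forall>y\<in>ball 0 \<epsilon>. \<forall>x. c * norm x \<le> norm (frame_map F U V s y x)"
proof -
  let ?N = "\<lambda>q :: real \<times> real \<times> (real^'m). norm (fst (snd q) *\<^sub>R F (fst q) + U (fst q) *v snd (snd q))"
  let ?S = "{0..p} \<times> sphere (0 :: real \<times> (real^'m)) 1"
  have contN: "continuous_on ?S ?N"
    by (intro continuous_intros bounded_bilinear.continuous_on[OF bounded_bilinear_matrix_vector_mult]
        continuous_on_compose2[OF cont(1)] continuous_on_compose2[OF cont(2)]) auto
  have "sphere (0 :: real \<times> (real^'m)) 1 \<noteq> {}" by simp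
  hence ne: "?S \<noteq> {}" using p by auto
  have "compact ?S" by (intro compact_Times compact_Icc compact_sphere)
  from continuous_attains_inf[OF this ne contN] obtain q where q: "q \<in> ?S" and min: "\<And>x. x \<in> ?S \<Longrightarrow> ?N q \<le> ?N x" by blast
  define c where "c = ?N q"
  have c: "c > 0"
  proof (rule ccontr)
    assume "\<not> c > 0"
    hence "fst (snd q) *\<^sub>R F (fst q) + U (fst q) *v snd (snd q) = 0" unfolding c_def by simp
    from indep[OF this] have "snd q = 0" by (simp add: prod_eq_iff)
    thus False using q by (cases q) auto
  qed
  have lb0: "c * norm x \<le> norm (frame_map F U V s 0 x)" for s x
  proof (cases "x = 0")
    case True thus ?thesis by simp
  next
    case False
    \<comment> \<open>Both functions are reduced as one pair, so that the same \<open>s'\<close>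
      serves for \<open>F\<close> and \<open>U\<close>.\<close>
    obtain s' where s': "s' \<in> {0..p}" "(F s', U s') = (F s, U s)"
      by (rule periodic_reduce[OF p, where h = "\<lambda>s. (F s, U s)"]) (auto simp: per)
    define u where "u = inverse (norm x) *\<^sub>R x"
    have "norm u = 1" unfolding u_def using False by simp
    hence "(s', u) \<in> ?S" using s' by simp
    from min[OF this] have "c \<le> norm (frame_map F U V s 0 u)" unfolding c_def frame_map_def using s' by simp
    hence "c * norm x \<le> norm (frame_map F U V s 0 u) * norm x" by (simp add: mult_right_mono)
    also have "\<dots> = norm (norm x *\<^sub>R frame_map F U V s 0 u)" by (simp add: mult.commute)
    also have "norm x *\<^sub>R frame_map F U V s 0 u = frame_map F U V s 0 (norm x *\<^sub>R u)"
      by (simp only: linear_cmul[OF linear_frame_map])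
    also have "norm x *\<^sub>R u = x" unfolding u_def using False by simp
    finally show ?thesis .
  qed
  obtain B where B: "\<And>s. norm (V s) \<le> B" using bounded_range_periodic[OF p per(3) cont(3)] by (auto simp: bounded_iff)
  obtain K where K: "K \<ge> 0" "\<And>(X :: real^'m^'n) y. norm (X *v y) \<le> norm X * norm y * K"
    using bounded_bilinear.nonneg_bounded[OF bounded_bilinear_matrix_vector_mult] by blast
  have B0: "B \<ge> 0" using B[of 0] norm_ge_zero order_trans by blast
  have VB: "norm (V s *v y) \<le> B * K * norm y" for s y
    using K(2)[of "V s" y] mult_right_mono[OF B[of s], of "K * norm y"] K(1) by (simp add: mult_ac)
  \<comment> \<open>Chosen to make the \<open>V\<close>-term at most \<open>c / 2\<close>; the
    summand 1 avoids a zero denominator.\<close>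
  define \<epsilon> where "\<epsilon> = c / (2 * (B * K + 1))"
  have BK: "B * K \<ge> 0" using B0 K(1) by simp
  have \<epsilon>: "\<epsilon> > 0" "B * K * \<epsilon> \<le> c / 2" unfolding \<epsilon>_def using c BK by (auto simp: field_simps)
  have "c / 2 * norm x \<le> norm (frame_map F U V s y x)" if y: "y \<in> ball 0 \<epsilon>" for s y x
  proof -
    have "norm (V s *v y) \<le> B * K * \<epsilon>"
      using order_trans[OF VB[of s y] mult_left_mono[OF _ BK, of "norm y" \<epsilon>]] y by simp
    hence "norm (V s *v y) \<le> c / 2" using \<epsilon>(2) by simp
    hence "norm (fst x *\<^sub>R (V s *v y)) \<le> norm x * (c / 2)"
      using mult_mono[OF norm_fst_le[of "fst x" "snd x"], of "norm (V s *v y)" "c / 2"] by simp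
    moreover have "frame_map F U V s y x = frame_map F U V s 0 x + fst x *\<^sub>R (V s *v y)"
      unfolding frame_map_def by (simp add: scaleR_add_right)
    ultimately show ?thesis using lb0[of x s] norm_diff_ineq[of "frame_map F U V s 0 x" "fst x *\<^sub>R (V s *v y)"]
      by (simp add: mult.commute)
  qed
  thus ?thesis using c \<epsilon>(1) by (intro exI[of _ "c / 2"] conjI exI[of _ \<epsilon>]) auto
qed

lemma frame_map_bij:
  fixes F :: "real \<Rightarrow> real^'n" and U V :: "real \<Rightarrow> real^'m^'n"
  assumes dim: "CARD('n) = Suc CARD('m)" and c: "c > 0" "\<And>x. c * norm x \<le> norm (frame_map F U V s y x)"
  shows "bij (frame_map F U V s y)"
proof -
  have "inj (frame_map F U V s y)"
    unfolding linear_injective_0[OF linear_frame_map]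
  proof (intro allI impI)
    fix x assume "frame_map F U V s y x = 0"
    hence "c * norm x \<le> 0" using c(2)[of x] by simp
    thus "x = 0" using c(1) by (simp add: mult_le_0_iff)
  qed
  moreover from this have "surj (frame_map F U V s y)"
    by (intro linear_injective_imp_surjective[OF linear_frame_map]) (simp_all add: dim)
  ultimately show ?thesis by (simp add: bij_def)
qed

text \<open>The coordinates v and w are kept in one vector \<open>y\<close>, with \<open>W\<close>
  the set of w-indices, so \<open>flip_w W\<close> applied to a value leaves the v-part and negates
  the w-part: the symmetries (iii) and (iv) for the vector components become one equation. The
  transformed system is stated by substituting it into the coordinate map, whose derivative is
  injective on the domain.\<close>

theorem theoremB:
  fixes f :: "real^'n \<Rightarrow> real^'n" and g :: "real \<Rightarrow> real^'n \<Rightarrow> real^'n"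
    and D :: "(real^'n) set" and I :: "real set" and r :: nat
    and \<phi> :: "real \<Rightarrow> real^'n" and T :: real
  assumes dim: "CARD('n) = Suc CARD('m::finite)"
    and D_open: "open D" and I_int: "is_interval I"
    and r_ge: "r \<ge> 2"
    and f_Cr: "Cr_on r D f"
    and g_Cr: "Cr_on r (I \<times> D) (\<lambda>(t, z). g t z)"
    and cycle: "hyperbolic_limit_cycle f D \<phi> T"
  shows "\<exists>(U :: real \<Rightarrow> real^'m^'n) (W :: 'm set) (H :: real^'m^'m)
           (\<Lambda>0 :: real \<Rightarrow> real^'m \<Rightarrow> real) (\<Lambda> :: real \<Rightarrow> real^'m \<Rightarrow> real^'m)
           (\<Lambda>t0 :: real \<Rightarrow> real \<Rightarrow> real^'m \<Rightarrow> real) (\<Lambda>t :: real \<Rightarrow> real \<Rightarrow> real^'m \<Rightarrow> real^'m)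
           (\<epsilon> :: real).
     \<comment> \<open>U is C^r, d = card W is the A-index, and U(t+T) = U(t) [I_{n-d-1} \<oplus> (-I_d)]\<close>
     Cr_on r UNIV U \<and>
     card W = A_index (variational_matrix f \<phi>) T \<and>
     (\<forall>t. U (t + T) = U t ** flip_mat W) \<and>
     \<comment> \<open>H = H1 \<oplus> H2 (block diagonal w.r.t. the v/w splitting)\<close>
     block_diag_wrt W H \<and>
     \<comment> \<open>neighbourhood of the cycle where the new coordinates are defined\<close>
     \<epsilon> > 0 \<and>
     (\<forall>s. \<forall>y \<in> ball 0 \<epsilon>. \<phi> s + U s *v y \<in> D) \<and>
     \<comment> \<open>(s,v,w) \<mapsto> \<phi>(s) + U(s)[v;w] is a local change of variables (invertible derivative)\<close>
     (\<forall>s. \<forall>y \<in> ball 0 \<epsilon>. \<forall>a b.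
        a *\<^sub>R (f (\<phi> s) + vector_derivative U (at s) *v y) + U s *v b = 0 \<longrightarrow> a = 0 \<and> b = 0) \<and>
     \<comment> \<open>the perturbed system is transformed into the new system\<close>
     (\<forall>t \<in> I. \<forall>s. \<forall>y \<in> ball 0 \<epsilon>.
        (let z = \<phi> s + U s *v y;
             sdot = 1 + \<Lambda>0 s y + \<Lambda>t0 t s y;
             ydot = H *v y + \<Lambda> s y + \<Lambda>t t s y
         in sdot *\<^sub>R (f (\<phi> s) + vector_derivative U (at s) *v y) + U s *v ydot = f z + g t z)) \<and>
     \<comment> \<open>(i)\<close>
     image_mset Re (eigs_mult H) =
       image_mset (\<lambda>\<mu>. ln (cmod \<mu>) / T) (poincare_multipliers f \<phi> T) \<and>
     \<comment> \<open>(ii)\<close>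
     (\<forall>s. \<Lambda>0 s 0 = 0 \<and> \<Lambda> s 0 = 0 \<and>
          ((\<Lambda>0 s) has_derivative (\<lambda>_. 0)) (at 0) \<and> ((\<Lambda> s) has_derivative (\<lambda>_. 0)) (at 0)) \<and>
     \<comment> \<open>(iii) and (iv)\<close>
     (\<forall>s. \<forall>y \<in> ball 0 \<epsilon>.
        \<Lambda>0 (s + T) y = \<Lambda>0 s (flip_w W y) \<and>
        \<Lambda> (s + T) y = flip_w W (\<Lambda> s (flip_w W y)) \<and>
        (\<forall>t \<in> I. \<Lambda>t0 t (s + T) y = \<Lambda>t0 t s (flip_w W y) \<and>
                 \<Lambda>t t (s + T) y = flip_w W (\<Lambda>t t s (flip_w W y)))) \<and>
     \<comment> \<open>(v)\<close>
     (\<exists>C > 0. \<forall>t \<in> I. \<forall>s. \<forall>y \<in> ball 0 \<epsilon>.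
        \<bar>\<Lambda>t0 t s y\<bar> \<le> C * norm (g t (\<phi> s + U s *v y)) \<and>
        norm (proj_on (- W) (\<Lambda>t t s y)) \<le> C * norm (g t (\<phi> s + U s *v y)) \<and>
        norm (proj_on W (\<Lambda>t t s y)) \<le> C * norm (g t (\<phi> s + U s *v y)))"
proof -
  define A where "A = variational_matrix f \<phi>"
  have lc: "periodic_orbit f D \<phi> T" and simple: "count (char_multipliers f \<phi> T) 1 = 1"
    using cycle unfolding hyperbolic_limit_cycle_def limit_cycle_def by auto
  have T: "T > 0" and \<phi>D: "\<And>t. \<phi> t \<in> D" and per: "\<And>t. \<phi> (t + T) = \<phi> t"
    using lc unfolding periodic_orbit_def is_solution_def by auto
  obtain k where r: "r = Suc k" using r_ge by (cases r) auto
  note ff = floquet_frame[OF dim D_open f_Cr[unfolded r] lc simple, folded A_def]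
  note contA = ff(2) and perA = ff(3) and cont\<phi> = ff(4) and contf\<phi> = ff(5) and fA = ff(6)
  obtain U :: "real \<Rightarrow> real^'m^'n" and W :: "'m set" and H :: "real^'m^'m" where
    UCr: "Cr_on (Suc k) UNIV U" and W: "card W = A_index A T" and UT: "\<forall>t. U (t + T) = U t ** flip_mat W"
    and bd: "block_diag_wrt W H" and U': "\<forall>t. (U has_vector_derivative (A t ** U t - U t ** H)) (at t)"
    and indep: "\<forall>s a b. a *\<^sub>R f (\<phi> s) + U s *v b = 0 \<longrightarrow> a = 0 \<and> b = 0"
    and eig: "image_mset Re (eigs_mult H) = image_mset (\<lambda>\<mu>. ln (cmod \<mu>) / T) (poincare_multipliers f \<phi> T)"
    using ff(1) by (elim exE conjE)
  define V where "V t = A t ** U t - U t ** H" for t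
  have Vd: "vector_derivative U (at s) = V s" for s
    unfolding V_def by (rule vector_derivative_at[OF spec[OF U']])
  have flipH: "flip_mat W ** H = H ** flip_mat W" by (rule flip_mat_commute[OF bd])
  have VT: "V (t + T) = V t ** flip_mat W" for t
    unfolding V_def perA spec[OF UT] using flipH
    by (simp add: matrix_mul_assoc[symmetric] bounded_bilinear.diff_left[OF bounded_bilinear_matrix_matrix_mult])
  have flip2: "X ** flip_mat W ** flip_mat W = X" for X :: "real^'m^'n"
    by (simp add: matrix_mul_assoc[symmetric] flip_mat_involution)
  \<comment> \<open>Two flips cancel, so \<open>2 * T\<close> is a common period of all the
    data.\<close>
  have U2T: "U (t + 2 * T) = U t" and V2T: "V (t + 2 * T) = V t" and f2T: "f (\<phi> (t + 2 * T)) = f (\<phi> t)" for t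
    using UT VT[of "t + T"] VT[of t] per[of "t + T"] per[of t] spec[OF UT, of "t + T"] spec[OF UT, of t]
    by (simp_all add: add.assoc flip2)
  have contU: "continuous_on UNIV U" using continuous_on_UNIV_if_has_vector_derivative[OF spec[OF U']] .
  have contV: "continuous_on UNIV V" unfolding V_def
    by (intro continuous_intros bounded_bilinear.continuous_on[OF bounded_bilinear_matrix_matrix_mult] contA contU)
  let ?N = "frame_map (\<lambda>s. f (\<phi> s)) U V"
  have "\<exists>c>0. \<exists>\<epsilon>>0. \<forall>s. \<forall>y\<in>ball 0 \<epsilon>. \<forall>x. c * norm x \<le> norm (?N s y x)"
    by (rule frame_map_lower_bound[where p = "2 * T"]) (use T f2T U2T V2T contf\<phi> contU contV indep in auto)
  then obtain c \<epsilon>1 where c: "c > 0" and \<epsilon>1: "\<epsilon>1 > 0" and lb: "\<And>s y x. y \<in> ball 0 \<epsilon>1 \<Longrightarrow> c * norm x \<le> norm (?N s y x)"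
    by blast
  obtain B where B: "\<And>s. norm (U s) \<le> B"
    using bounded_range_periodic[of "2 * T" U] U2T contU T by (auto simp: bounded_iff)
  obtain K where K: "K \<ge> 0" "\<And>(X :: real^'m^'n) y. norm (X *v y) \<le> norm X * norm y * K"
    using bounded_bilinear.nonneg_bounded[OF bounded_bilinear_matrix_vector_mult] by blast
  have BK: "B * K \<ge> 0" using order_trans[OF norm_ge_zero B[of 0]] K(1) by simp
  have UB: "norm (U s *v y) \<le> B * K * norm y" for s y
    using K(2)[of "U s" y] mult_right_mono[OF B[of s], of "K * norm y"] K(1) by (simp add: mult_ac)
  have "compact (range \<phi>)"
    unfolding periodic_range[where h = \<phi>, OF T per]
    by (intro compact_continuous_image continuous_on_subset[OF cont\<phi>]) auto
  then obtain \<delta> where \<delta>: "\<delta> > 0" "(\<Union>x\<in>range \<phi>. ball x \<delta>) \<subseteq> D"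
    using compact_subset_open_imp_ball_epsilon_subset[OF _ D_open] \<phi>D by blast
  \<comment> \<open>The first bound keeps the coordinate derivative invertible; the second makes
    \<open>U s *v y\<close> shorter than \<open>\<delta>\<close>, so the point stays in
    \<open>D\<close>.\<close>
  define \<epsilon> where "\<epsilon> = min \<epsilon>1 (\<delta> / (B * K + 1))"
  have \<epsilon>: "\<epsilon> > 0" unfolding \<epsilon>_def using \<epsilon>1 \<delta> BK by simp
  have lb': "c * norm x \<le> norm (?N s y x)" if "y \<in> ball 0 \<epsilon>" for s y x
    using lb that unfolding \<epsilon>_def by simp
  have inD: "\<phi> s + U s *v y \<in> D" if "y \<in> ball 0 \<epsilon>" for s y
  proof -
    have "norm y * (B * K + 1) < \<delta>" using that BK unfolding \<epsilon>_def by (simp add: pos_less_divide_eq)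
    moreover have "B * K * norm y \<le> norm y * (B * K + 1)" by (simp add: algebra_simps)
    ultimately have "norm (U s *v y) < \<delta>" using UB[of s y] by linarith
    hence "\<phi> s + U s *v y \<in> ball (\<phi> s) \<delta>" by (simp add: dist_norm)
    thus ?thesis using \<delta>(2) by blast
  qed
  define R where "R s y = inv_into UNIV (?N s y)" for s y
  have bij: "bij (?N s y)" if "y \<in> ball 0 \<epsilon>" for s y
    by (rule frame_map_bij[OF dim c lb'[OF that]])
  have NR: "?N s y (R s y z) = z" if "y \<in> ball 0 \<epsilon>" for s y z
    unfolding R_def using bij_is_surj[OF bij[OF that]] by (rule surj_f_inv_f)
  have R_eqI: "R s y z = x" if "y \<in> ball 0 \<epsilon>" "?N s y x = z" for s y z x
    unfolding R_def using bij_is_inj[OF bij[OF that(1)]] that(2) inv_f_f by metis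
  have R_bound: "norm (R s y z) \<le> inverse c * norm z" if "y \<in> ball 0 \<epsilon>" for s y z
    using lb'[OF that, of "R s y z" s] c unfolding NR[OF that] by (simp add: field_simps)
  define Z where "Z s y = \<phi> s + U s *v y" for s y
  \<comment> \<open>By linearity \<open>f\<close> and \<open>g\<close> are pulled back separately.
    The expected leading part \<open>(1, H *v y)\<close> is subtracted from the pullback of
    \<open>f\<close>, and the pullback of \<open>g\<close> is the perturbation term as it
    stands.\<close>
  define \<Lambda>0 where "\<Lambda>0 s y = fst (R s y (f (Z s y))) - 1" for s y
  define \<Lambda> where "\<Lambda> s y = snd (R s y (f (Z s y))) - H *v y" for s y
  define \<Lambda>t0 where "\<Lambda>t0 t s y = fst (R s y (g t (Z s y)))" for t s y
  define \<Lambda>t where "\<Lambda>t t s y = snd (R s y (g t (Z s y)))" for t s y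
  have flip_ball: "flip_w W y \<in> ball 0 \<epsilon>" if "y \<in> ball 0 \<epsilon>" for y using that by (simp add: norm_flip_w)
  have inj: "\<forall>s. \<forall>y \<in> ball 0 \<epsilon>. \<forall>a b.
      a *\<^sub>R (f (\<phi> s) + vector_derivative U (at s) *v y) + U s *v b = 0 \<longrightarrow> a = 0 \<and> b = 0"
  proof (intro allI ballI impI)
    fix s a b and y :: "real^'m" assume y: "y \<in> ball 0 \<epsilon>" and "a *\<^sub>R (f (\<phi> s) + vector_derivative U (at s) *v y) + U s *v b = 0"
    hence "?N s y (a, b) = 0" unfolding frame_map_def Vd by simp
    hence "c * norm (a, b) \<le> 0" using lb'[OF y, of "(a, b)" s] by simp
    hence "(a, b) = 0" using c by (simp add: mult_le_0_iff)
    thus "a = 0 \<and> b = 0" by (simp add: zero_prod_def)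
  qed
  have trans: "\<forall>t \<in> I. \<forall>s. \<forall>y \<in> ball 0 \<epsilon>.
      (let z = \<phi> s + U s *v y;
           sdot = 1 + \<Lambda>0 s y + \<Lambda>t0 t s y;
           ydot = H *v y + \<Lambda> s y + \<Lambda>t t s y
       in sdot *\<^sub>R (f (\<phi> s) + vector_derivative U (at s) *v y) + U s *v ydot = f z + g t z)"
  proof (intro allI ballI)
    fix t s and y :: "real^'m" assume y: "y \<in> ball 0 \<epsilon>"
    have "?N s y (R s y (f (Z s y)) + R s y (g t (Z s y))) = f (Z s y) + g t (Z s y)"
      unfolding linear_add[OF linear_frame_map] NR[OF y] ..
    thus "let z = \<phi> s + U s *v y;
           sdot = 1 + \<Lambda>0 s y + \<Lambda>t0 t s y;
           ydot = H *v y + \<Lambda> s y + \<Lambda>t t s y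
       in sdot *\<^sub>R (f (\<phi> s) + vector_derivative U (at s) *v y) + U s *v ydot = f z + g t z"
      unfolding Let_def Vd frame_map_def \<Lambda>0_def \<Lambda>_def \<Lambda>t0_def \<Lambda>t_def Z_def by simp
  qed
  have flat: "\<forall>s. \<Lambda>0 s 0 = 0 \<and> \<Lambda> s 0 = 0 \<and>
      ((\<Lambda>0 s) has_derivative (\<lambda>_. 0)) (at 0) \<and> ((\<Lambda> s) has_derivative (\<lambda>_. 0)) (at 0)"
  proof
    fix s
    define e where "e y = (\<Lambda>0 s y, \<Lambda> s y)" for y
    define h where "h y = f (\<phi> s + U s *v y)" for y
    have hd: "(h has_derivative (\<lambda>y. A s *v (U s *v y))) (at 0)"
    proof -
      have "((\<lambda>y. \<phi> s + U s *v y) has_derivative (\<lambda>y. U s *v y)) (at 0)"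
        by (auto intro!: derivative_eq_intros bounded_linear_imp_has_derivative)
      moreover have "(f has_derivative (\<lambda>x. A s *v x)) (at (\<phi> s + U s *v 0))" using fA[of s] by simp
      ultimately show ?thesis unfolding h_def by (rule has_derivative_compose)
    qed
    \<comment> \<open>Here \<open>U' = A U - U H\<close> enters: the image of
      \<open>(1, H *v y)\<close> is \<open>f (\<phi> s) + A s *v (U s *v y)\<close>, the first-order
      Taylor polynomial of \<open>h\<close>. Thus the frame map sends the error \<open>e y\<close>
      to the Taylor remainder of \<open>f\<close>, and the lower bound \<open>c\<close> carries its
      smallness back to \<open>e\<close>.\<close>
    have Ne: "?N s y (e y) = h y - h 0 - A s *v (U s *v y)" if y: "y \<in> ball 0 \<epsilon>" for y
    proof -
      have "e y = R s y (f (Z s y)) - (1, H *v y)"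
        unfolding e_def \<Lambda>0_def \<Lambda>_def by (simp add: prod_eq_iff)
      hence "?N s y (e y) = f (Z s y) - ?N s y (1, H *v y)"
        by (simp only: linear_diff[OF linear_frame_map] NR[OF y])
      also have "?N s y (1, H *v y) = h 0 + A s *v (U s *v y)"
        unfolding frame_map_def V_def h_def
        by (simp add: matrix_vector_mult_diff_rdistrib matrix_vector_mul_assoc)
      finally show ?thesis unfolding h_def Z_def by simp
    qed
    have eb: "norm (e y) \<le> inverse c * norm (h y - h 0 - A s *v (U s *v y))" if y: "y \<in> ball 0 \<epsilon>" for y
      using lb'[OF y, of "e y" s] c unfolding Ne[OF y] by (simp add: field_simps)
    have e0: "e 0 = 0" using eb[of 0] \<epsilon> by simp
    have "(e has_derivative (\<lambda>_. 0)) (at 0)"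
      unfolding has_derivative_at
    proof (intro conjI bounded_linear_zero)
      have lim: "((\<lambda>y. inverse c * (norm (h y - h 0 - A s *v (U s *v y)) / norm y)) \<longlongrightarrow> inverse c * 0) (at 0)"
        using hd unfolding has_derivative_at by (intro tendsto_intros) (simp add: diff_diff_eq)
      show "((\<lambda>y. norm (e (0 + y) - e 0 - 0) / norm y) \<longlongrightarrow> 0) (at 0)"
      proof (rule tendsto_sandwich[OF _ _ tendsto_const])
        show "\<forall>\<^sub>F y in at 0. 0 \<le> norm (e (0 + y) - e 0 - 0) / norm y" by simp
        have "\<forall>\<^sub>F y in at 0. y \<in> ball 0 \<epsilon>" by (rule eventually_at_in_open') (use \<epsilon> in auto)
        thus "\<forall>\<^sub>F y in at 0. norm (e (0 + y) - e 0 - 0) / norm y \<le> inverse c * (norm (h y - h 0 - A s *v (U s *v y)) / norm y)"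
        proof eventually_elim
          case (elim y)
          show ?case using divide_right_mono[OF eb[OF elim], of "norm y"] e0 by simp
        qed
      qed (use lim in simp)
    qed
    from has_derivative_fst[OF this] has_derivative_snd[OF this] e0
    show "\<Lambda>0 s 0 = 0 \<and> \<Lambda> s 0 = 0 \<and>
      ((\<Lambda>0 s) has_derivative (\<lambda>_. 0)) (at 0) \<and> ((\<Lambda> s) has_derivative (\<lambda>_. 0)) (at 0)"
      unfolding e_def by (simp add: zero_prod_def)
  qed
  have ZT: "Z (s + T) y = Z s (flip_w W y)" for s y
    unfolding Z_def per spec[OF UT] by (simp add: matrix_vector_mul_assoc[symmetric] flip_mat_mult_vector)
  have flip_flip: "flip_w W (flip_w W y) = y" for y by (simp add: flip_w_def Finite_Cartesian_Product.vec_eq_iff)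
  \<comment> \<open>Advancing \<open>s\<close> by \<open>T\<close> multiplies \<open>U\<close> and
    \<open>V\<close> by the flip, which can be absorbed into \<open>y\<close> and into the
    y-component of the preimage; injectivity then identifies the two preimages.\<close>
  have RT: "R (s + T) y z = (fst (R s (flip_w W y) z), flip_w W (snd (R s (flip_w W y) z)))"
    if y: "y \<in> ball 0 \<epsilon>" for s y z
  proof (rule R_eqI[OF y])
    have "?N (s + T) y (fst x, flip_w W (snd x)) = ?N s (flip_w W y) x" for x
      unfolding frame_map_def per VT spec[OF UT]
      by (simp add: matrix_vector_mul_assoc[symmetric] flip_mat_mult_vector flip_flip)
    thus "?N (s + T) y (fst (R s (flip_w W y) z), flip_w W (snd (R s (flip_w W y) z))) = z"
      using NR[OF flip_ball[OF y]] by simp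
  qed
  \<comment> \<open>The subtracted term \<open>H *v y\<close> obeys the same symmetry, because
    conjugation by the flip fixes \<open>H\<close>.\<close>
  have Hflip: "flip_w W (x - H *v flip_w W y) = flip_w W x - H *v y" for x y
  proof -
    have "flip_mat W *v (x - H *v (flip_mat W *v y)) = flip_mat W *v x - (flip_mat W ** H ** flip_mat W) *v y"
      by (simp add: matrix_vector_mult_diff_distrib matrix_vector_mul_assoc matrix_mul_assoc)
    also have "flip_mat W ** H ** flip_mat W = H"
      unfolding flipH by (simp add: matrix_mul_assoc[symmetric] flip_mat_involution)
    finally show ?thesis unfolding flip_mat_mult_vector .
  qed
  have symm: "\<forall>s. \<forall>y \<in> ball 0 \<epsilon>.
      \<Lambda>0 (s + T) y = \<Lambda>0 s (flip_w W y) \<and>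
      \<Lambda> (s + T) y = flip_w W (\<Lambda> s (flip_w W y)) \<and>
      (\<forall>t \<in> I. \<Lambda>t0 t (s + T) y = \<Lambda>t0 t s (flip_w W y) \<and>
               \<Lambda>t t (s + T) y = flip_w W (\<Lambda>t t s (flip_w W y)))"
    unfolding \<Lambda>0_def \<Lambda>_def \<Lambda>t0_def \<Lambda>t_def ZT Hflip by (simp add: RT)
  have bound: "\<exists>C > 0. \<forall>t \<in> I. \<forall>s. \<forall>y \<in> ball 0 \<epsilon>.
      \<bar>\<Lambda>t0 t s y\<bar> \<le> C * norm (g t (\<phi> s + U s *v y)) \<and>
      norm (proj_on (- W) (\<Lambda>t t s y)) \<le> C * norm (g t (\<phi> s + U s *v y)) \<and>
      norm (proj_on W (\<Lambda>t t s y)) \<le> C * norm (g t (\<phi> s + U s *v y))"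
  \<comment> \<open>The norm bound for the inverse frame map; taking components and projecting to v-
    or w-coordinates does not increase norms.\<close>
  proof (intro exI[of _ "inverse c"] conjI ballI allI)
    show "inverse c > 0" using c by simp
    fix t s and y :: "real^'m" assume y: "y \<in> ball 0 \<epsilon>"
    have b: "norm (R s y (g t (Z s y))) \<le> inverse c * norm (g t (\<phi> s + U s *v y))"
      using R_bound[OF y, of s "g t (Z s y)"] unfolding Z_def .
    have 1: "norm (\<Lambda>t0 t s y) \<le> norm (R s y (g t (Z s y)))" "norm (\<Lambda>t t s y) \<le> norm (R s y (g t (Z s y)))"
      unfolding \<Lambda>t0_def \<Lambda>t_def using norm_fst_le norm_snd_le by (metis prod.collapse)+
    show "\<bar>\<Lambda>t0 t s y\<bar> \<le> inverse c * norm (g t (\<phi> s + U s *v y))" using 1(1) b by simp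
    show "norm (proj_on (- W) (\<Lambda>t t s y)) \<le> inverse c * norm (g t (\<phi> s + U s *v y))"
      "norm (proj_on W (\<Lambda>t t s y)) \<le> inverse c * norm (g t (\<phi> s + U s *v y))"
      using order_trans[OF norm_proj_on_le order_trans[OF 1(2) b]] by blast+
  qed
  show ?thesis
    by (rule exI[of _ U], rule exI[of _ W], rule exI[of _ H], rule exI[of _ \<Lambda>0], rule exI[of _ \<Lambda>],
        rule exI[of _ \<Lambda>t0], rule exI[of _ \<Lambda>t], rule exI[of _ \<epsilon>], intro conjI,
        unfold r, fold A_def)
      (rule UCr W UT bd \<epsilon> inj trans eig flat symm bound | use inD in blast)+
qed

end
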